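(* Let $\mathcal{G}$ be a second-countable locally compact Hausdorff étale groupoid, $G$ a discrete group with unit $e$, $P\subseteq G$ a unital subsemigroup, and $c:\mathcal{G}\to G$ a continuous cocycle; write $\mathcal{G}_g:=c^{-1}(g)$ for $g\in G$, and for $p\in P$ let $\mathbf{X}(\mathcal{G})_p$ be the Hilbert $C_r^*(\mathcal{G}_e)$-bimodule $\overline{C_c(\mathcal{G}_p)}\subseteq C_r^*(\mathcal{G})$. For each $p,q\in P\setminus\{e\}$, there exists a $C_r^*(\mathcal{G}_e)$-linear inner-product preserving map $$M_{p,q}:\mathbf{X}(\mathcal{G})_p\otimes_{C_r^*(\mathcal{G}_e)}\mathbf{X}(\mathcal{G})_q\to\mathbf{X}(\mathcal{G})_{pq}$$ such that $$M_{p,q}(\xi\otimes_{C_r^*(\mathcal{G}_e)}\eta)=\xi\eta\qquad\text{for }\xi\in\mathbf{X}(\mathcal{G})_p,\ \eta\in\mathbf{X}(\mathcal{G})_q,$$ where the multiplication on the right-hand side takes place in $C_r^*(\mathcal{G})$. The maps $\{M_{p,q}:p,q\in P\setminus\{e\}\}$ are (all) surjective if and only if $c$ is an unperforated cocycle.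
   Context: A cocycle $c:\mathcal{G}\to G$ is a groupoid homomorphism: $c(\gamma\mu)=c(\gamma)c(\mu)$ whenever $\gamma\mu$ is defined. The cocycle $c$ is called unperforated if, whenever $\gamma\in\mathcal{G}_{pq}$ for some $p,q\in P$, there exist composable $\gamma'\in\mathcal{G}_p$ and $\gamma''\in\mathcal{G}_q$ such that $\gamma=\gamma'\gamma''$. $C_r^*(\mathcal{G})$ is the reduced groupoid $C^*$-algebra, the completion of the convolution $*$-algebra $C_c(\mathcal{G})$. Each $\mathcal{G}_g$ is clopen, $\mathcal{G}_e$ is an étale subgroupoid, and $C_c(\mathcal{G}_g)$ is identified with $\{f\in C_c(\mathcal{G}):\mathrm{supp}(f)\subseteq\mathcal{G}_g\}$. The identity map on $C_c(\mathcal{G}_e)$ extends to an isomorphism $I_e$ of $C_r^*(\mathcal{G}_e)$ onto the closure of $C_c(\mathcal{G}_e)$ in $C_r^*(\mathcal{G})$, and $C_r^*(\mathcal{G}_e)$ is identified with this image. A Hilbert $A$-bimodule is a (right) Hilbert $A$-module with a left action of $A$ given by a $*$-homomorphism into the adjointable operators. For $p\in P$, $\mathbf{X}(\mathcal{G})_p$ is the norm closure of $C_c(\mathcal{G}_p)$ in $C_r^*(\mathcal{G})$ (so $\mathbf{X}(\mathcal{G})_e=C_r^*(\mathcal{G}_e)$), which is a Hilbert $C_r^*(\mathcal{G}_e)$-bimodule with left and right actions given by multiplication in $C_r^*(\mathcal{G})$ and inner product $\langle\xi,\eta\rangle=I_e^{-1}(\xi^*\eta)$. The symbol $\otimes_A$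 denotes the balanced (interior) tensor product of Hilbert $A$-bimodules, with $\langle x\otimes_A y,w\otimes_A z\rangle_A=\langle y,\langle x,w\rangle_A\cdot z\rangle_A$. *)

theory Defs
  imports "HOL-Analysis.Analysis" "HOL-Algebra.Group"
begin

section \<open>The Hilbert space of square-summable functions\<close>

typedef 'a ell2 = "{f :: 'a \<Rightarrow> complex. (\<lambda>x. (cmod (f x))\<^sup>2) summable_on UNIV}"
  by (rule exI[of _ "\<lambda>_. 0"]) simp

setup_lifting type_definition_ell2

lemma ell2_summable: "(\<lambda>x. (cmod (Rep_ell2 u x))\<^sup>2) summable_on UNIV"
  using Rep_ell2[of u] by simp

lemma ell2_eqI: "(\<And>x. Rep_ell2 u x = Rep_ell2 v x) \<Longrightarrow> u = v"
  by (simp add: Rep_ell2_inject[symmetric] fun_eq_iff)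

lemma square_summable_add:
  fixes f g :: "'a \<Rightarrow> complex"
  assumes "(\<lambda>x. (cmod (f x))\<^sup>2) summable_on UNIV" "(\<lambda>x. (cmod (g x))\<^sup>2) summable_on UNIV"
  shows "(\<lambda>x. (cmod (f x + g x))\<^sup>2) summable_on UNIV"
proof (rule summable_on_comparison_test)
  show "(\<lambda>x. 2 * (cmod (f x))\<^sup>2 + 2 * (cmod (g x))\<^sup>2) summable_on UNIV"
    by (intro summable_on_add summable_on_cmult_right assms)
next
  fix x
  have "(cmod (f x + g x))\<^sup>2 \<le> (cmod (f x) + cmod (g x))\<^sup>2"
    by (intro power_mono norm_triangle_ineq) simp
  also have "\<dots> \<le> 2 * (cmod (f x))\<^sup>2 + 2 * (cmod (g x))\<^sup>2"
    using sum_squares_bound[of "cmod (f x)" "cmod (g x)"] by (simp add: power2_sum)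
  finally show "(cmod (f x + g x))\<^sup>2 \<le> 2 * (cmod (f x))\<^sup>2 + 2 * (cmod (g x))\<^sup>2" .
qed simp

lemma square_summable_scale:
  fixes f :: "'a \<Rightarrow> complex"
  assumes "(\<lambda>x. (cmod (f x))\<^sup>2) summable_on UNIV"
  shows "(\<lambda>x. (cmod (c * f x))\<^sup>2) summable_on UNIV"
  using summable_on_cmult_right[OF assms, of "(cmod c)\<^sup>2"]
  by (simp add: norm_mult power_mult_distrib)

lemma square_summable_mult:
  fixes f g :: "'a \<Rightarrow> complex"
  assumes "(\<lambda>x. (cmod (f x))\<^sup>2) summable_on UNIV" "(\<lambda>x. (cmod (g x))\<^sup>2) summable_on UNIV"
  shows "(\<lambda>x. cnj (f x) * g x) summable_on UNIV"
proof (rule abs_summable_summable, rule summable_on_comparison_test)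
  show "(\<lambda>x. (cmod (f x))\<^sup>2 + (cmod (g x))\<^sup>2) summable_on UNIV"
    by (intro summable_on_add assms)
next
  fix x
  have "2 * (cmod (f x) * cmod (g x)) \<le> (cmod (f x))\<^sup>2 + (cmod (g x))\<^sup>2"
    using sum_squares_bound[of "cmod (f x)" "cmod (g x)"] by simp
  moreover have "0 \<le> cmod (f x) * cmod (g x)" by simp
  ultimately have "cmod (f x) * cmod (g x) \<le> (cmod (f x))\<^sup>2 + (cmod (g x))\<^sup>2" by linarith
  then show "norm (cnj (f x) * g x) \<le> (cmod (f x))\<^sup>2 + (cmod (g x))\<^sup>2"
    by (simp add: norm_mult)
qed simp

lift_definition ell2_scale :: "complex \<Rightarrow> 'a ell2 \<Rightarrow> 'a ell2" is "\<lambda>c f x. c * f x"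
  by (rule square_summable_scale)

text \<open>Conjugate linear in the first variable.\<close>

definition ell2_cinner :: "'a ell2 \<Rightarrow> 'a ell2 \<Rightarrow> complex" where
  "ell2_cinner u v = (\<Sum>\<^sub>\<infinity>x. cnj (Rep_ell2 u x) * Rep_ell2 v x)"

instantiation ell2 :: (type) real_inner
begin

lift_definition zero_ell2 :: "'a ell2" is "\<lambda>_. 0" by simp
lift_definition plus_ell2 :: "'a ell2 \<Rightarrow> 'a ell2 \<Rightarrow> 'a ell2" is "\<lambda>f g x. f x + g x"
  by (rule square_summable_add)
lift_definition uminus_ell2 :: "'a ell2 \<Rightarrow> 'a ell2" is "\<lambda>f x. - f x" by simp
definition minus_ell2 :: "'a ell2 \<Rightarrow> 'a ell2 \<Rightarrow> 'a ell2" where "u - v = u + (- v)" for u v :: "'a ell2"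
definition scaleR_ell2 :: "real \<Rightarrow> 'a ell2 \<Rightarrow> 'a ell2" where
  "scaleR_ell2 r u = ell2_scale (of_real r) u"
definition inner_ell2 :: "'a ell2 \<Rightarrow> 'a ell2 \<Rightarrow> real" where
  "inner_ell2 u v = Re (ell2_cinner u v)"
definition norm_ell2 :: "'a ell2 \<Rightarrow> real" where
  "norm_ell2 u = sqrt (inner u u)"
definition sgn_ell2 :: "'a ell2 \<Rightarrow> 'a ell2" where
  "sgn_ell2 u = scaleR (inverse (norm u)) u"
definition dist_ell2 :: "'a ell2 \<Rightarrow> 'a ell2 \<Rightarrow> real" where
  "dist_ell2 u v = norm (u - v)"
definition uniformity_ell2 :: "('a ell2 \<times> 'a ell2) filter" where
  "uniformity_ell2 = (INF e\<in>{0<..}. principal {(x, y). dist x y < e})"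
definition open_ell2 :: "'a ell2 set \<Rightarrow> bool" where
  "open_ell2 U = (\<forall>x\<in>U. eventually (\<lambda>(x', y). x' = x \<longrightarrow> y \<in> U) uniformity)"

instance
proof
  fix u v w :: "'a ell2" and r s :: real
  show "u + v + w = u + (v + w)" "u + v = v + u" "0 + u = u"
    by (transfer; simp add: fun_eq_iff algebra_simps)+
  show "- u + u = 0" by transfer simp
  show "u - v = u + - v" by (rule minus_ell2_def)
  show "r *\<^sub>R (u + v) = r *\<^sub>R u + r *\<^sub>R v" "(r + s) *\<^sub>R u = r *\<^sub>R u + s *\<^sub>R u"
    "r *\<^sub>R s *\<^sub>R u = (r * s) *\<^sub>R u" "1 *\<^sub>R u = u"
    unfolding scaleR_ell2_def by (transfer; simp add: fun_eq_iff algebra_simps)+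
  show "dist u v = norm (u - v)" by (rule dist_ell2_def)
  show "sgn u = scaleR (inverse (norm u)) u" by (rule sgn_ell2_def)
  show "norm u = sqrt (inner u u)" by (rule norm_ell2_def)
  show "uniformity = (INF e\<in>{0<..}. principal {(x, y::'a ell2). dist x y < e})"
    by (rule uniformity_ell2_def)
  have cs: "(\<lambda>x. cnj (Rep_ell2 u x) * Rep_ell2 v x) summable_on UNIV" for u v :: "'a ell2"
    by (intro square_summable_mult ell2_summable)
  have "ell2_cinner v u = cnj (ell2_cinner u v)"
    unfolding ell2_cinner_def by (simp flip: infsum_cnj add: mult.commute)
  then show "inner u v = inner v u" by (simp add: inner_ell2_def)
  have "ell2_cinner (u + v) w = ell2_cinner u w + ell2_cinner v w"
    unfolding ell2_cinner_def infsum_add[OF cs cs, symmetric]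
    by (simp add: plus_ell2.rep_eq algebra_simps)
  then show "inner (u + v) w = inner u w + inner v w" by (simp add: inner_ell2_def)
  have "ell2_cinner (r *\<^sub>R u) v = of_real r * ell2_cinner u v"
    unfolding ell2_cinner_def infsum_cmult_right'[symmetric] scaleR_ell2_def
    by (simp add: ell2_scale.rep_eq algebra_simps)
  then show "inner (r *\<^sub>R u) v = r * inner u v" by (simp add: inner_ell2_def)
  have sq: "Re (ell2_cinner u u) = (\<Sum>\<^sub>\<infinity>x. (cmod (Rep_ell2 u x))\<^sup>2)"
    unfolding ell2_cinner_def infsum_Re[OF cs, symmetric]
    by (intro infsum_cong) (unfold cmod_power2, simp add: power2_eq_square)
  show "0 \<le> inner u u" unfolding inner_ell2_def sq by (simp add: infsum_nonneg)
  show "inner u u = 0 \<longleftrightarrow> u = 0"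
  proof
    assume "inner u u = 0"
    then have z: "(\<Sum>\<^sub>\<infinity>x. (cmod (Rep_ell2 u x))\<^sup>2) = 0" unfolding inner_ell2_def sq by simp
    have "(cmod (Rep_ell2 u x))\<^sup>2 = 0" for x
      by (rule nonneg_infsum_le_0D[OF _ ell2_summable]) (use z in auto)
    then show "u = 0" by (intro ell2_eqI) (simp add: zero_ell2.rep_eq)
  next
    assume "u = 0"
    then show "inner u u = 0" by (simp add: inner_ell2_def ell2_cinner_def zero_ell2.rep_eq)
  qed
qed (rule open_ell2_def)

end

lemma norm_ell2_sq: "(norm u)\<^sup>2 = (\<Sum>\<^sub>\<infinity>x. (cmod (Rep_ell2 u x))\<^sup>2)"
proof -
  have "(norm u)\<^sup>2 = Re (ell2_cinner u u)"
    by (simp add: power2_norm_eq_inner inner_ell2_def)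
  also have "\<dots> = (\<Sum>\<^sub>\<infinity>x. (cmod (Rep_ell2 u x))\<^sup>2)"
    unfolding ell2_cinner_def
      infsum_Re[OF square_summable_mult[OF ell2_summable ell2_summable], symmetric]
    by (intro infsum_cong) (unfold cmod_power2, simp add: power2_eq_square)
  finally show ?thesis .
qed

lemma Rep_ell2_diff: "Rep_ell2 (u - v) x = Rep_ell2 u x - Rep_ell2 v x"
  unfolding minus_ell2_def plus_ell2.rep_eq uminus_ell2.rep_eq by simp

lemma sum_le_norm_ell2:
  assumes "finite F"
  shows "(\<Sum>x\<in>F. (cmod (Rep_ell2 u x))\<^sup>2) \<le> (norm u)\<^sup>2"
  unfolding norm_ell2_sq by (intro finite_sum_le_infsum ell2_summable assms) auto

instance ell2 :: (type) banach
proof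
  fix X :: "nat \<Rightarrow> 'a ell2"
  assume X: "Cauchy X"
  have coord: "cmod (Rep_ell2 u x) \<le> norm u" for u :: "'a ell2" and x
    by (rule power2_le_imp_le) (use sum_le_norm_ell2[of "{x}" u] in simp_all)
  have "Cauchy (\<lambda>n. Rep_ell2 (X n) x)" for x
  proof (rule CauchyI)
    fix e :: real assume "e > 0"
    then obtain N where N: "\<forall>m\<ge>N. \<forall>n\<ge>N. norm (X m - X n) < e"
      using CauchyD[OF X] by blast
    have "norm (Rep_ell2 (X m) x - Rep_ell2 (X n) x) < e" if "m \<ge> N" "n \<ge> N" for m n
      using coord[of "X m - X n" x] N[rule_format, OF that] unfolding Rep_ell2_diff by linarith
    then show "\<exists>N. \<forall>m\<ge>N. \<forall>n\<ge>N. norm (Rep_ell2 (X m) x - Rep_ell2 (X n) x) < e"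
      by blast
  qed
  then have "\<exists>l. (\<lambda>n. Rep_ell2 (X n) x) \<longlonglongrightarrow> l" for x
    unfolding convergent_def[symmetric] by (rule Cauchy_convergent)
  then obtain f where "\<forall>x. (\<lambda>n. Rep_ell2 (X n) x) \<longlonglongrightarrow> f x"
    using choice[of "\<lambda>x l. (\<lambda>n. Rep_ell2 (X n) x) \<longlonglongrightarrow> l"] by blast
  then have f: "(\<lambda>n. Rep_ell2 (X n) x) \<longlonglongrightarrow> f x" for x ..
  have bound: "(\<Sum>x\<in>F. (cmod (Rep_ell2 (X m) x - f x))\<^sup>2) \<le> e\<^sup>2"
    if N: "\<And>m n. m \<ge> N \<Longrightarrow> n \<ge> N \<Longrightarrow> norm (X m - X n) < e" and "m \<ge> N" "finite F" for N e m F
  proof (rule LIMSEQ_le_const2)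
    show "(\<lambda>n. \<Sum>x\<in>F. (cmod (Rep_ell2 (X m) x - Rep_ell2 (X n) x))\<^sup>2)
        \<longlonglongrightarrow> (\<Sum>x\<in>F. (cmod (Rep_ell2 (X m) x - f x))\<^sup>2)"
      by (intro tendsto_intros f)
    have "(\<Sum>x\<in>F. (cmod (Rep_ell2 (X m) x - Rep_ell2 (X n) x))\<^sup>2) \<le> e\<^sup>2" if "n \<ge> N" for n
    proof -
      have "(norm (X m - X n))\<^sup>2 \<le> e\<^sup>2"
        using N[OF \<open>m \<ge> N\<close> that] by (intro power_mono) auto
      with sum_le_norm_ell2[OF \<open>finite F\<close>, of "X m - X n"] show ?thesis
        by (simp add: Rep_ell2_diff)
    qed
    then show "\<exists>K. \<forall>n\<ge>K. (\<Sum>x\<in>F. (cmod (Rep_ell2 (X m) x - Rep_ell2 (X n) x))\<^sup>2) \<le> e\<^sup>2"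
      by blast
  qed
  have summ: "(\<lambda>x. (cmod (Rep_ell2 (X m) x - f x))\<^sup>2) summable_on UNIV"
    if N: "\<And>m n. m \<ge> N \<Longrightarrow> n \<ge> N \<Longrightarrow> norm (X m - X n) < e" and "m \<ge> N" for N e m
    proof (rule nonneg_bdd_above_summable_on)
    show "bdd_above (sum (\<lambda>x. (cmod (Rep_ell2 (X m) x - f x))\<^sup>2) ` {F. F \<subseteq> UNIV \<and> finite F})"
    proof (rule bdd_aboveI2)
      fix F :: "'a set" assume "F \<in> {F. F \<subseteq> UNIV \<and> finite F}"
      then have "finite F" by simp
      with \<open>m \<ge> N\<close> show "(\<Sum>x\<in>F. (cmod (Rep_ell2 (X m) x - f x))\<^sup>2) \<le> e\<^sup>2"
        by (rule bound[rotated]) (rule N)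
    qed
  qed simp
  obtain N where N: "\<And>m n. m \<ge> N \<Longrightarrow> n \<ge> N \<Longrightarrow> norm (X m - X n) < 1"
    using CauchyD[OF X zero_less_one] by blast
  have "(\<lambda>x. (cmod (Rep_ell2 (X N) x - f x))\<^sup>2) summable_on UNIV"
    by (rule summ[OF _ order_refl]) (rule N)
  from square_summable_add[OF ell2_summable[of "X N"] square_summable_scale[OF this, where c = "- 1"]]
  have fs: "(\<lambda>x. (cmod (f x))\<^sup>2) summable_on UNIV" by simp
  define l where "l = Abs_ell2 f"
  have l: "Rep_ell2 l = f" unfolding l_def using fs by (simp add: Abs_ell2_inverse)
  have "X \<longlonglongrightarrow> l"
  proof (rule LIMSEQ_I)
    fix e :: real assume e: "e > 0"
    obtain N where N: "\<And>m n. m \<ge> N \<Longrightarrow> n \<ge> N \<Longrightarrow> norm (X m - X n) < e / 2"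
      using CauchyD[OF X half_gt_zero[OF e]] by blast
    have "norm (X m - l) < e" if "m \<ge> N" for m
    proof -
      have "(norm (X m - l))\<^sup>2 \<le> (e / 2)\<^sup>2"
        unfolding norm_ell2_sq Rep_ell2_diff l
      proof (rule infsum_le_finite_sums)
        show "(\<lambda>x. (cmod (Rep_ell2 (X m) x - f x))\<^sup>2) summable_on UNIV"
          using that by (rule summ[rotated]) (rule N)
        show "(\<Sum>x\<in>F. (cmod (Rep_ell2 (X m) x - f x))\<^sup>2) \<le> (e / 2)\<^sup>2" if "finite F" for F
          using \<open>m \<ge> N\<close> that by (rule bound[rotated]) (rule N)
      qed
      then have "norm (X m - l) \<le> e / 2"
        by (rule power2_le_imp_le) (use e in simp)
      with e show ?thesis by simp
    qed
    then show "\<exists>no. \<forall>n\<ge>no. norm (X n - l) < e" by blast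
  qed
  then show "convergent X" by (rule convergentI)
qed

text \<open>
  Operators on this Hilbert space.  The type only enforces real linearity; all operators in the
  algebras below are norm limits of complex linear ones.
\<close>

type_synonym 'a operator = "'a ell2 \<Rightarrow>\<^sub>L 'a ell2"

definition op_star :: "'a operator \<Rightarrow> 'a operator" where
  "op_star T = (THE S :: 'a operator. \<forall>u v. ell2_cinner (T u) v = ell2_cinner u (S v))"

definition op_scale :: "complex \<Rightarrow> 'a operator \<Rightarrow> 'a operator" where
  "op_scale z T = Blinfun (\<lambda>u. ell2_scale z (T u))"


section \<open>Etale groupoids\<close>

text \<open>
  The set of arrows is the underlying set of the topology and objects are identified with their
  identity arrows.  The product of \<^term>\<open>x\<close> and \<^term>\<open>y\<close> is only meaningful if
  the source of \<^term>\<open>x\<close> is the range of \<^term>\<open>y\<close>.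
\<close>

record 'a groupoid =
  gtop :: "'a topology"
  src :: "'a \<Rightarrow> 'a"
  rng :: "'a \<Rightarrow> 'a"
  gmul :: "'a \<Rightarrow> 'a \<Rightarrow> 'a"
  ginv :: "'a \<Rightarrow> 'a"

definition arrows :: "'a groupoid \<Rightarrow> 'a set" where
  "arrows G = topspace (gtop G)"

definition units :: "'a groupoid \<Rightarrow> 'a set" where
  "units G = src G ` arrows G"

definition composable :: "'a groupoid \<Rightarrow> ('a \<times> 'a) set" where
  "composable G = {(x, y). x \<in> arrows G \<and> y \<in> arrows G \<and> src G x = rng G y}"

locale groupoid =
  fixes G :: "'a groupoid"
  assumes src_closed: "x \<in> arrows G \<Longrightarrow> src G x \<in> arrows G"
    and rng_closed: "x \<in> arrows G \<Longrightarrow> rng G x \<in> arrows G"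
    and src_src: "x \<in> arrows G \<Longrightarrow> src G (src G x) = src G x"
    and rng_src: "x \<in> arrows G \<Longrightarrow> rng G (src G x) = src G x"
    and src_rng: "x \<in> arrows G \<Longrightarrow> src G (rng G x) = rng G x"
    and rng_rng: "x \<in> arrows G \<Longrightarrow> rng G (rng G x) = rng G x"
    and gmul_closed: "(x, y) \<in> composable G \<Longrightarrow> gmul G x y \<in> arrows G"
    and src_gmul: "(x, y) \<in> composable G \<Longrightarrow> src G (gmul G x y) = src G y"
    and rng_gmul: "(x, y) \<in> composable G \<Longrightarrow> rng G (gmul G x y) = rng G x"
    and gmul_assoc: "(x, y) \<in> composable G \<Longrightarrow> (y, z) \<in> composable G \<Longrightarrow>
      gmul G (gmul G x y) z = gmul G x (gmul G y z)"
    and gmul_src: "x \<in> arrows G \<Longrightarrow> gmul G x (src G x) = x"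
    and gmul_rng: "x \<in> arrows G \<Longrightarrow> gmul G (rng G x) x = x"
    and ginv_closed: "x \<in> arrows G \<Longrightarrow> ginv G x \<in> arrows G"
    and src_ginv: "x \<in> arrows G \<Longrightarrow> src G (ginv G x) = rng G x"
    and rng_ginv: "x \<in> arrows G \<Longrightarrow> rng G (ginv G x) = src G x"
    and gmul_ginv: "x \<in> arrows G \<Longrightarrow> gmul G x (ginv G x) = rng G x"
    and ginv_gmul: "x \<in> arrows G \<Longrightarrow> gmul G (ginv G x) x = src G x"

locale topological_groupoid = groupoid +
  assumes continuous_gmul:
      "continuous_map (subtopology (prod_topology (gtop G) (gtop G)) (composable G)) (gtop G)
         (\<lambda>(x, y). gmul G x y)"
    and continuous_ginv: "continuous_map (gtop G) (gtop G) (ginv G)"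

definition local_homeomorphism_map :: "'a topology \<Rightarrow> 'b topology \<Rightarrow> ('a \<Rightarrow> 'b) \<Rightarrow> bool" where
  "local_homeomorphism_map X Y f \<longleftrightarrow>
     (\<forall>x\<in>topspace X. \<exists>U. openin X U \<and> x \<in> U \<and> openin Y (f ` U) \<and>
        homeomorphic_map (subtopology X U) (subtopology Y (f ` U)) f)"

locale etale_groupoid = topological_groupoid +
  assumes local_homeomorphism_rng:
      "local_homeomorphism_map (gtop G) (subtopology (gtop G) (units G)) (rng G)"
    and local_homeomorphism_src:
      "local_homeomorphism_map (gtop G) (subtopology (gtop G) (units G)) (src G)"

definition subgroupoid :: "'a groupoid \<Rightarrow> 'a set \<Rightarrow> 'a groupoid" where
  "subgroupoid G S = G\<lparr>gtop := subtopology (gtop G) S\<rparr>"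


section \<open>Cocycles\<close>

definition continuous_cocycle ::
  "'a groupoid \<Rightarrow> ('g, 'm) monoid_scheme \<Rightarrow> ('a \<Rightarrow> 'g) \<Rightarrow> bool" where
  "continuous_cocycle G \<Gamma> c \<longleftrightarrow>
     continuous_map (gtop G) (discrete_topology (carrier \<Gamma>)) c \<and>
     (\<forall>(x, y)\<in>composable G. c (gmul G x y) = c x \<otimes>\<^bsub>\<Gamma>\<^esub> c y)"

definition fibre :: "'a groupoid \<Rightarrow> ('a \<Rightarrow> 'g) \<Rightarrow> 'g \<Rightarrow> 'a set" where
  "fibre G c g = {x \<in> arrows G. c x = g}"

definition unperforated ::
  "'a groupoid \<Rightarrow> ('g, 'm) monoid_scheme \<Rightarrow> 'g set \<Rightarrow> ('a \<Rightarrow> 'g) \<Rightarrow> bool" where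
  "unperforated G \<Gamma> P c \<longleftrightarrow>
     (\<forall>p\<in>P. \<forall>q\<in>P. \<forall>x\<in>fibre G c (p \<otimes>\<^bsub>\<Gamma>\<^esub> q).
        \<exists>y\<in>fibre G c p. \<exists>z\<in>fibre G c q. (y, z) \<in> composable G \<and> x = gmul G y z)"


section \<open>The reduced groupoid C*-algebra\<close>

definition gsupp :: "'a groupoid \<Rightarrow> ('a \<Rightarrow> complex) \<Rightarrow> 'a set" where
  "gsupp G f = gtop G closure_of {x \<in> arrows G. f x \<noteq> 0}"

text \<open>
  Functions on the groupoid vanish outside the set of arrows by convention, so that
  extension by zero from a clopen subset is the identity.
\<close>

definition Cc :: "'a groupoid \<Rightarrow> ('a \<Rightarrow> complex) set" where
  "Cc G = {f. continuous_map (gtop G) euclidean f \<and> compactin (gtop G) (gsupp G f) \<and>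
              (\<forall>x. x \<notin> arrows G \<longrightarrow> f x = 0)}"

text \<open>The sum over all factorizations \<open>x = y z\<close>, parametrized by \<open>y\<close>.\<close>

definition convolution ::
  "'a groupoid \<Rightarrow> ('a \<Rightarrow> complex) \<Rightarrow> ('a \<Rightarrow> complex) \<Rightarrow> 'a \<Rightarrow> complex" where
  "convolution G f h x =
     (if x \<in> arrows G
      then \<Sum>\<^sub>\<infinity>y\<in>{y \<in> arrows G. rng G y = rng G x}. f y * h (gmul G (ginv G y) x)
      else 0)"

text \<open>
  For a unit \<open>x\<close>, the regular representation \<open>\<pi>\<^sub>x\<close> lets \<open>f\<close> act on the square-summable functions
  on the source fibre of \<open>x\<close> by left convolution.  The direct sum of these Hilbert spaces over all
  units is the space of square-summable functions on the set of arrows, and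
  \<open>left_regular\<close> is the direct sum of all \<open>\<pi>\<^sub>x\<close>, extended by zero to functions
  supported off the arrows.  The reduced norm of \<open>f\<close> is the operator norm of \<open>left_regular G f\<close>,
  so the completion of \<open>C\<^sub>c(G)\<close> is the norm closure of its image.  Products are then given by
  composition and the involution by the adjoint.
\<close>

definition left_regular :: "'a groupoid \<Rightarrow> ('a \<Rightarrow> complex) \<Rightarrow> 'a operator" where
  "left_regular G f = Blinfun (\<lambda>u. Abs_ell2 (convolution G f (Rep_ell2 u)))"

definition reduced_algebra :: "'a groupoid \<Rightarrow> 'a operator set" where
  "reduced_algebra G = closure (left_regular G ` Cc G)"

text \<open>
  The continuous extension \<open>C\<^sub>r\<^sup>*(G\<^sub>e) \<rightarrow> C\<^sub>r\<^sup>*(G)\<close> of the identity map on \<open>C\<^sub>c(G\<^sub>e)\<close>, where \<open>S = G\<^sub>e\<close>.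
\<close>

definition reduced_embedding :: "'a groupoid \<Rightarrow> 'a set \<Rightarrow> 'a operator \<Rightarrow> 'a operator" where
  "reduced_embedding G S a = (THE b. \<exists>f :: nat \<Rightarrow> 'a \<Rightarrow> complex.
     (\<forall>n. f n \<in> Cc (subgroupoid G S)) \<and>
     (\<lambda>n. left_regular (subgroupoid G S) (f n)) \<longlonglongrightarrow> a \<and>
     (\<lambda>n. left_regular G (f n)) \<longlonglongrightarrow> b)"


section \<open>Hilbert bimodules and their interior tensor product\<close>

record ('b, 'x) hilbert_bimodule =
  bm_carrier :: "'x set"
  bm_add :: "'x \<Rightarrow> 'x \<Rightarrow> 'x"
  bm_scale :: "complex \<Rightarrow> 'x \<Rightarrow> 'x"
  bm_left :: "'b \<Rightarrow> 'x \<Rightarrow> 'x"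
  bm_right :: "'x \<Rightarrow> 'b \<Rightarrow> 'x"
  bm_inner :: "'x \<Rightarrow> 'x \<Rightarrow> 'b"

text \<open>
  A list \<open>[(x\<^sub>1, y\<^sub>1), \<dots>, (x\<^sub>n, y\<^sub>n)]\<close> stands for \<open>x\<^sub>1 \<otimes> y\<^sub>1 + \<dots> + x\<^sub>n \<otimes> y\<^sub>n\<close>.  The interior tensor
  product is the Hausdorff completion of the space of these sums with respect to the seminorm of the
  \<open>A\<close>-valued semi-inner product determined by
  \<open>\<langle>x \<otimes> y, w \<otimes> z\<rangle> = \<langle>y, \<langle>x, w\<rangle> z\<rangle>\<close>; its elements are classes of Cauchy sequences
  modulo null sequences.  The bilinearity relations and the balancing relation
  \<open>x a \<otimes> y = x \<otimes> a y\<close> are among the vectors of seminorm zero, hence hold in the quotient.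
\<close>

type_synonym ('x, 'y) formal_tensor = "('x \<times> 'y) list"

definition ft_inner :: "('b::real_normed_vector, 'x) hilbert_bimodule \<Rightarrow> ('b, 'y) hilbert_bimodule \<Rightarrow>
    ('x, 'y) formal_tensor \<Rightarrow> ('x, 'y) formal_tensor \<Rightarrow> 'b" where
  "ft_inner X Y s t =
     (\<Sum>(x, y)\<leftarrow>s. \<Sum>(w, z)\<leftarrow>t. bm_inner Y y (bm_left Y (bm_inner X x w) z))"

definition ft_scale :: "('b, 'x) hilbert_bimodule \<Rightarrow> complex \<Rightarrow>
    ('x, 'y) formal_tensor \<Rightarrow> ('x, 'y) formal_tensor" where
  "ft_scale X c s = map (\<lambda>(x, y). (bm_scale X c x, y)) s"

definition ft_dist :: "('b::real_normed_vector, 'x) hilbert_bimodule \<Rightarrow> ('b, 'y) hilbert_bimodule \<Rightarrow>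
    ('x, 'y) formal_tensor \<Rightarrow> ('x, 'y) formal_tensor \<Rightarrow> real" where
  "ft_dist X Y s t =
     (let d = s @ ft_scale X (-1) t in sqrt (norm (ft_inner X Y d d)))"

definition ft_Cauchy :: "('b::real_normed_vector, 'x) hilbert_bimodule \<Rightarrow> ('b, 'y) hilbert_bimodule \<Rightarrow>
    (nat \<Rightarrow> ('x, 'y) formal_tensor) set" where
  "ft_Cauchy X Y = {s. (\<forall>n. set (s n) \<subseteq> bm_carrier X \<times> bm_carrier Y) \<and>
     (\<forall>e>0. \<exists>N. \<forall>m\<ge>N. \<forall>n\<ge>N. ft_dist X Y (s m) (s n) < e)}"

definition ft_equiv :: "('b::real_normed_vector, 'x) hilbert_bimodule \<Rightarrow> ('b, 'y) hilbert_bimodule \<Rightarrow>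
    ((nat \<Rightarrow> ('x, 'y) formal_tensor) \<times> (nat \<Rightarrow> ('x, 'y) formal_tensor)) set" where
  "ft_equiv X Y = {(s, t). s \<in> ft_Cauchy X Y \<and> t \<in> ft_Cauchy X Y \<and>
     (\<lambda>n. ft_dist X Y (s n) (t n)) \<longlonglongrightarrow> 0}"

abbreviation ft_class :: "('b::real_normed_vector, 'x) hilbert_bimodule \<Rightarrow> ('b, 'y) hilbert_bimodule \<Rightarrow>
    (nat \<Rightarrow> ('x, 'y) formal_tensor) \<Rightarrow> (nat \<Rightarrow> ('x, 'y) formal_tensor) set" where
  "ft_class X Y s \<equiv> ft_equiv X Y `` {s}"

definition tensor :: "('b::real_normed_vector, 'x) hilbert_bimodule \<Rightarrow> ('b, 'y) hilbert_bimodule \<Rightarrow>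
    ('b, (nat \<Rightarrow> ('x, 'y) formal_tensor) set) hilbert_bimodule" where
  "tensor X Y =
     \<lparr>bm_carrier = ft_Cauchy X Y // ft_equiv X Y,
      bm_add = (\<lambda>u v. \<Union>s\<in>u. \<Union>t\<in>v. ft_class X Y (\<lambda>n. s n @ t n)),
      bm_scale = (\<lambda>c u. \<Union>s\<in>u. ft_class X Y (\<lambda>n. ft_scale X c (s n))),
      bm_left = (\<lambda>a u. \<Union>s\<in>u. ft_class X Y (\<lambda>n. map (\<lambda>(x, y). (bm_left X a x, y)) (s n))),
      bm_right = (\<lambda>u a. \<Union>s\<in>u. ft_class X Y (\<lambda>n. map (\<lambda>(x, y). (x, bm_right Y y a)) (s n))),
      bm_inner = (\<lambda>u v. THE b. \<exists>s\<in>u. \<exists>t\<in>v. (\<lambda>n. ft_inner X Y (s n) (t n)) \<longlonglongrightarrow> b)\<rparr>"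

definition elementary_tensor :: "('b::real_normed_vector, 'x) hilbert_bimodule \<Rightarrow>
    ('b, 'y) hilbert_bimodule \<Rightarrow> 'x \<Rightarrow> 'y \<Rightarrow> (nat \<Rightarrow> ('x, 'y) formal_tensor) set" where
  "elementary_tensor X Y x y = ft_class X Y (\<lambda>_. [(x, y)])"

text \<open>
  Complex linearity and right \<open>A\<close>-linearity are automatic for inner-product preserving maps;
  left \<open>A\<close>-linearity makes the map one of bimodules.
\<close>

definition bimodule_linear :: "'b set \<Rightarrow> ('b, 'x) hilbert_bimodule \<Rightarrow> ('b, 'y) hilbert_bimodule \<Rightarrow>
    ('x \<Rightarrow> 'y) \<Rightarrow> bool" where
  "bimodule_linear A X Y M \<longleftrightarrow>
     M ` bm_carrier X \<subseteq> bm_carrier Y \<and>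
     (\<forall>u\<in>bm_carrier X. \<forall>v\<in>bm_carrier X. M (bm_add X u v) = bm_add Y (M u) (M v)) \<and>
     (\<forall>z. \<forall>u\<in>bm_carrier X. M (bm_scale X z u) = bm_scale Y z (M u)) \<and>
     (\<forall>a\<in>A. \<forall>u\<in>bm_carrier X. M (bm_right X u a) = bm_right Y (M u) a) \<and>
     (\<forall>a\<in>A. \<forall>u\<in>bm_carrier X. M (bm_left X a u) = bm_left Y a (M u))"

definition inner_preserving :: "('b, 'x) hilbert_bimodule \<Rightarrow> ('b, 'y) hilbert_bimodule \<Rightarrow>
    ('x \<Rightarrow> 'y) \<Rightarrow> bool" where
  "inner_preserving X Y M \<longleftrightarrow>
     (\<forall>u\<in>bm_carrier X. \<forall>v\<in>bm_carrier X. bm_inner Y (M u) (M v) = bm_inner X u v)"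


section \<open>The bimodules of a cocycle\<close>

text \<open>
  In the following, \<open>e\<close> is the unit of the group, and the coefficient algebra is
  \<open>C\<^sub>r\<^sup>*(G\<^sub>e)\<close>, acting through its embedding into \<open>C\<^sub>r\<^sup>*(G)\<close>.
\<close>

definition coefficient_algebra ::
  "'a groupoid \<Rightarrow> ('g, 'm) monoid_scheme \<Rightarrow> ('a \<Rightarrow> 'g) \<Rightarrow> 'a operator set" where
  "coefficient_algebra G \<Gamma> c = reduced_algebra (subgroupoid G (fibre G c \<one>\<^bsub>\<Gamma>\<^esub>))"

definition fibre_bimodule :: "'a groupoid \<Rightarrow> ('g, 'm) monoid_scheme \<Rightarrow> ('a \<Rightarrow> 'g) \<Rightarrow> 'g \<Rightarrow>
    ('a operator, 'a operator) hilbert_bimodule" where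
  "fibre_bimodule G \<Gamma> c p =
     (let I = reduced_embedding G (fibre G c \<one>\<^bsub>\<Gamma>\<^esub>) in
     \<lparr>bm_carrier = closure (left_regular G ` {f \<in> Cc G. gsupp G f \<subseteq> fibre G c p}),
      bm_add = (+),
      bm_scale = op_scale,
      bm_left = (\<lambda>a x. I a o\<^sub>L x),
      bm_right = (\<lambda>x a. x o\<^sub>L I a),
      bm_inner = (\<lambda>x y. inv_into (coefficient_algebra G \<Gamma> c) I (op_star x o\<^sub>L y))\<rparr>)"

abbreviation fibre_tensor where
  "fibre_tensor G \<Gamma> c p q \<equiv> tensor (fibre_bimodule G \<Gamma> c p) (fibre_bimodule G \<Gamma> c q)"

definition multiplication_map :: "'a groupoid \<Rightarrow> ('g, 'm) monoid_scheme \<Rightarrow> ('a \<Rightarrow> 'g) \<Rightarrow> 'g \<Rightarrow> 'g \<Rightarrow>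
    ((nat \<Rightarrow> ('a operator, 'a operator) formal_tensor) set \<Rightarrow> 'a operator) \<Rightarrow> bool" where
  "multiplication_map G \<Gamma> c p q M \<longleftrightarrow>
     bimodule_linear (coefficient_algebra G \<Gamma> c)
       (fibre_tensor G \<Gamma> c p q) (fibre_bimodule G \<Gamma> c (p \<otimes>\<^bsub>\<Gamma>\<^esub> q)) M \<and>
     inner_preserving (fibre_tensor G \<Gamma> c p q) (fibre_bimodule G \<Gamma> c (p \<otimes>\<^bsub>\<Gamma>\<^esub> q)) M \<and>
     (\<forall>x\<in>bm_carrier (fibre_bimodule G \<Gamma> c p). \<forall>y\<in>bm_carrier (fibre_bimodule G \<Gamma> c q).
        M (elementary_tensor (fibre_bimodule G \<Gamma> c p) (fibre_bimodule G \<Gamma> c q) x y) = x o\<^sub>L y)"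

end

theory Submission
  imports Defs
begin

text \<open>
  Write \<open>X\<^sub>p\<close> for the closure of \<open>C\<^sub>c(G\<^sub>p)\<close> in the reduced algebra.  The inner product of the tensor product
  is \<open>\<langle>x \<otimes> y, w \<otimes> z\<rangle> = \<langle>y, \<langle>x, w\<rangle> z\<rangle>\<close>, which is \<open>y\<^sup>* x\<^sup>* w z = (x y)\<^sup>* (w z)\<close> for operators.  So the seminorm
  of a formal sum of elementary tensors is, by the C*-identity, the operator norm of the corresponding
  sum of products.  The interior tensor product is therefore the norm closure of the sums of products of
  \<open>X\<^sub>p\<close> and \<open>X\<^sub>q\<close>, and taking limits of products is a multiplication map
  (\<open>multiplication_exists\<close>).  It is the only one (\<open>multiplication_unique\<close>), so a multiplication map
  is surjective exactly when the sums of products are dense in \<open>X\<^sub>p\<^sub>q\<close> (\<open>multiplication_image\<close>).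

  This presupposes that the inner products \<open>x\<^sup>* w\<close>, which lie in the closure \<open>X\<^sub>\<one>\<close> of \<open>C\<^sub>c(G\<^sub>\<one>)\<close>, can be moved
  to the reduced algebra of the subgroupoid \<open>G\<^sub>\<one>\<close> and back without changing norms.  Right translations
  decompose the arrows of \<open>G\<close> into copies of source fibres of \<open>G\<^sub>\<one>\<close>, so the regular representation of \<open>G\<close>
  restricts on \<open>C\<^sub>c(G\<^sub>\<one>)\<close> to a direct sum of the representations that define the reduced norm of \<open>G\<^sub>\<one>\<close>
  (\<open>norm_left_regular_kernel\<close>).

  It remains to see that the sums of products are dense in \<open>X\<^sub>p\<^sub>q\<close> if and only if every arrow of degree
  \<open>p q\<close> is a product of arrows of degrees \<open>p\<close> and \<open>q\<close>.  If an arrow \<open>x\<close> is no such product, then all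
  convolutions of functions of degrees \<open>p\<close> and \<open>q\<close> vanish at \<open>x\<close>; evaluation at \<open>x\<close> is a matrix entry
  and so continuous, and it separates a bump function at \<open>x\<close> from the closed span of the products
  (\<open>factorizable_if_dense\<close>).  If all arrows factorize, then around each of them there is a convolution
  \<open>k = g * h\<close> of bump functions on bisections which does not vanish there.  By compactness,
  \<open>f = (\<Sum>k. F k k)\<close> for finitely many such \<open>k\<close> and suitable functions \<open>F k\<close>.  On the bisection where
  \<open>k\<close> lives, \<open>F k\<close> is the restriction of a function \<open>r\<close> that depends on the range of an arrow only,
  and \<open>r (g * h) = (r g) * h\<close>; so \<open>f\<close> is a finite sum of convolutions (\<open>dense_if_factorizable\<close>).
\<close>

section \<open>Operators on the space of square-summable functions\<close>

subsection \<open>The complex inner product\<close>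

lemma norm_ell2_scale: "norm (ell2_scale z u) = cmod z * norm u"
proof -
  have "(norm (ell2_scale z u))\<^sup>2 = (cmod z * norm u)\<^sup>2"
    unfolding norm_ell2_sq power_mult_distrib ell2_scale.rep_eq norm_mult
    by (rule infsum_cmult_right')
  then show ?thesis by (simp add: power2_eq_iff_nonneg)
qed

lemma ell2_scale_add_right: "ell2_scale z (u + v) = ell2_scale z u + ell2_scale z v"
  by (intro ell2_eqI) (simp add: ell2_scale.rep_eq plus_ell2.rep_eq algebra_simps)

lemma ell2_scale_scaleR: "ell2_scale z (r *\<^sub>R u) = r *\<^sub>R ell2_scale z u"
  by (intro ell2_eqI) (simp add: ell2_scale.rep_eq scaleR_ell2_def)

lemma bounded_linear_ell2_scale: "bounded_linear (ell2_scale z)"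
  by (intro bounded_linear_intro[where K = "cmod z"])
    (simp_all add: ell2_scale_add_right ell2_scale_scaleR norm_ell2_scale)

lemma Rep_ell2_scaleR: "Rep_ell2 (r *\<^sub>R u) x = of_real r * Rep_ell2 u x"
  by (simp add: scaleR_ell2_def ell2_scale.rep_eq)

lemma Rep_ell2_sum: "Rep_ell2 (\<Sum>i\<in>I. u i) x = (\<Sum>i\<in>I. Rep_ell2 (u i) x)"
  by (induct I rule: infinite_finite_induct) (simp_all add: zero_ell2.rep_eq plus_ell2.rep_eq)

lemma norm_Rep_ell2_le: "cmod (Rep_ell2 u x) \<le> norm u"
  by (rule power2_le_imp_le) (use sum_le_norm_ell2[of "{x}" u] in simp_all)

lemma bounded_linear_Rep_ell2: "bounded_linear (\<lambda>u. Rep_ell2 u x)"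
  by (intro bounded_linear_intro[where K = 1])
    (simp_all add: plus_ell2.rep_eq Rep_ell2_scaleR scaleR_conv_of_real norm_Rep_ell2_le)

lemma cinner_scale_left: "ell2_cinner (ell2_scale z u) v = cnj z * ell2_cinner u v"
  unfolding ell2_cinner_def infsum_cmult_right'[symmetric]
  by (simp add: ell2_scale.rep_eq algebra_simps)

text \<open>The imaginary part of the complex inner product is a real inner product against a
  rotated vector, so that continuity and sesquilinearity come from the real inner product.\<close>

lemma cinner_eq_inner: "ell2_cinner u v = Complex (inner u v) (inner (ell2_scale \<i> u) v)"
  by (simp add: inner_ell2_def cinner_scale_left complex_eq_iff)

lemma cinner_commute: "ell2_cinner v u = cnj (ell2_cinner u v)"
  unfolding ell2_cinner_def by (simp flip: infsum_cnj add: mult.commute)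

lemma cinner_add_left: "ell2_cinner (u + v) w = ell2_cinner u w + ell2_cinner v w"
  by (simp add: cinner_eq_inner complex_eq_iff ell2_scale_add_right inner_add_left)

lemma cinner_add_right: "ell2_cinner u (v + w) = ell2_cinner u v + ell2_cinner u w"
  by (simp add: cinner_eq_inner complex_eq_iff inner_add_right)

lemma cinner_diff_right: "ell2_cinner u (v - w) = ell2_cinner u v - ell2_cinner u w"
  by (simp add: cinner_eq_inner complex_eq_iff inner_diff_right)

lemma cinner_diff_left: "ell2_cinner (u - v) w = ell2_cinner u w - ell2_cinner v w"
  by (subst (1 2 3) cinner_commute) (simp add: cinner_diff_right)

lemma cinner_zero: "ell2_cinner 0 v = 0" "ell2_cinner v 0 = 0"
  using cinner_add_left[of 0 0 v] cinner_add_right[of v 0 0] by simp_all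

lemma cinner_nondegenerate:
  assumes "\<And>u. ell2_cinner u v = ell2_cinner u w"
  shows "v = w"
proof -
  have "inner (v - w) (v - w) = 0"
    using assms[of "v - w"] by (simp add: inner_ell2_def cinner_diff_right)
  then show ?thesis by simp
qed

lemma tendsto_cinner:
  assumes "(f \<longlongrightarrow> u) F" "(g \<longlongrightarrow> v) F"
  shows "((\<lambda>x. ell2_cinner (f x) (g x)) \<longlongrightarrow> ell2_cinner u v) F"
  unfolding cinner_eq_inner
  by (intro tendsto_Complex tendsto_inner bounded_linear.tendsto[OF bounded_linear_ell2_scale] assms)

subsection \<open>Point masses\<close>

lift_definition delta :: "complex \<Rightarrow> 'a \<Rightarrow> 'a ell2" is "\<lambda>z a x. if x = a then z else 0"
proof -
  fix z :: complex and a :: 'a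
  have "(\<lambda>x. (cmod (if x = a then z else 0))\<^sup>2) summable_on {a}" by simp
  then show "(\<lambda>x. (cmod (if x = a then z else 0))\<^sup>2) summable_on UNIV"
    by (rule summable_on_cong_neutral[THEN iffD1, rotated -1]) auto
qed

text \<open>The truncations of a vector to finite sets converge to it.  The point masses carry
  complex coefficients because \<open>V\<close> will be the set where two real linear maps agree.\<close>

lemma delta_total:
  assumes "closed V" and "0 \<in> V" and add: "\<And>u v. u \<in> V \<Longrightarrow> v \<in> V \<Longrightarrow> u + v \<in> V"
    and "\<And>z a. delta z a \<in> V"
  shows "u \<in> V"
proof -
  define t where "t F = (\<Sum>a\<in>F. delta (Rep_ell2 u a) a)" for F
  have Rt: "Rep_ell2 (t F) x = (if x \<in> F then Rep_ell2 u x else 0)" if "finite F" for F x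
    unfolding t_def Rep_ell2_sum delta.rep_eq using that by (simp add: sum.delta)
  have V: "t F \<in> V" for F
    unfolding t_def using assms by (induct F rule: infinite_finite_induct) auto
  have "(t \<longlongrightarrow> u) (finite_subsets_at_top UNIV)"
    unfolding tendsto_iff
  proof (intro allI impI)
    fix e :: real assume e: "e > 0"
    let ?f = "\<lambda>x. (cmod (Rep_ell2 u x))\<^sup>2"
    have "(?f has_sum (norm u)\<^sup>2) UNIV"
      unfolding norm_ell2_sq by (rule has_sum_infsum[OF ell2_summable])
    then have "(sum ?f \<longlongrightarrow> (norm u)\<^sup>2) (finite_subsets_at_top UNIV)"
      by (simp add: has_sum_def)
    then have "\<forall>\<^sub>F F in finite_subsets_at_top UNIV. dist (sum ?f F) ((norm u)\<^sup>2) < e\<^sup>2"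
      using e by (intro tendstoD) auto
    moreover have "\<forall>\<^sub>F F in finite_subsets_at_top UNIV. finite (F :: 'a set)"
      by (rule eventually_finite_subsets_at_top_weakI)
    ultimately show "\<forall>\<^sub>F F in finite_subsets_at_top UNIV. dist (t F) u < e"
    proof (eventually_elim)
      fix F :: "'a set" assume F: "dist (sum ?f F) ((norm u)\<^sup>2) < e\<^sup>2" and fin: "finite F"
      have "(norm (t F - u))\<^sup>2 = infsum ?f (UNIV - F)"
        unfolding norm_ell2_sq Rep_ell2_diff Rt[OF fin]
        by (rule infsum_cong_neutral) auto
      also have "\<dots> = infsum ?f UNIV - infsum ?f F"
        by (rule infsum_Diff) (use fin ell2_summable in auto)
      also have "\<dots> < e\<^sup>2"
        using F unfolding norm_ell2_sq dist_real_def infsum_finite[OF fin] by linarith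
      finally show "dist (t F) u < e"
        using e by (metis dist_norm power_less_imp_less_base less_imp_le)
    qed
  qed
  then show ?thesis
    by (intro Lim_in_closed_set[OF \<open>closed V\<close> _ finite_subsets_at_top_neq_bot]) (simp_all add: V)
qed

text \<open>Additivity and continuity spread an equality of operators, and likewise an adjunction, from the
  point masses to all vectors.  Identities in the reduced algebra thereby reduce to identities between
  matrix entries, and infinite sums never have to be interchanged.\<close>

lemma blinfun_eqI_delta:
  fixes S T :: "'a ell2 \<Rightarrow>\<^sub>L 'b::real_normed_vector"
  assumes "\<And>z a. S (delta z a) = T (delta z a)"
  shows "S = T"
proof (rule blinfun_eqI)
  fix u
  have "u \<in> {u. S u = T u}"
    by (rule delta_total)
      (auto simp: assms blinfun.add_right intro!: closed_Collect_eq continuous_intros)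
  then show "S u = T u" by simp
qed

subsection \<open>Adjoints\<close>

definition adjoint_pair :: "'a operator \<Rightarrow> 'a operator \<Rightarrow> bool" where
  "adjoint_pair T S \<longleftrightarrow> (\<forall>u v. ell2_cinner (T u) v = ell2_cinner u (S v))"

definition adjointable :: "'a operator \<Rightarrow> bool" where
  "adjointable T \<longleftrightarrow> (\<exists>S. adjoint_pair T S)"

lemma adjoint_pairI_delta:
  fixes T S :: "'a operator"
  assumes "\<And>z a w b. ell2_cinner (T (delta z a)) (delta w b) = ell2_cinner (delta z a) (S (delta w b))"
  shows "adjoint_pair T S"
proof -
  have 1: "ell2_cinner (T (delta z a)) v = ell2_cinner (delta z a) (S v)" for z a v
  proof -
    have "v \<in> {v. ell2_cinner (T (delta z a)) v = ell2_cinner (delta z a) (S v)}" (is "_ \<in> ?V")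
    proof (rule delta_total)
      show "closed ?V"
        unfolding cinner_eq_inner by (intro closed_Collect_eq continuous_intros)
    qed (simp_all add: assms blinfun.add_right cinner_add_right blinfun.zero_right cinner_zero)
    then show ?thesis by simp
  qed
  have "ell2_cinner (T u) v = ell2_cinner u (S v)" for u v
  proof -
    have "u \<in> {u. ell2_cinner (T u) v = ell2_cinner u (S v)}" (is "_ \<in> ?V")
    proof (rule delta_total)
      show "closed ?V"
        unfolding cinner_eq_inner
        by (intro closed_Collect_eq continuous_intros
            bounded_linear.continuous_on[OF bounded_linear_ell2_scale])
    qed (simp_all add: 1 blinfun.add_right cinner_add_left blinfun.zero_right cinner_zero)
    then show ?thesis by simp
  qed
  then show ?thesis by (simp add: adjoint_pair_def)
qed

lemma adjoint_pair_sym: "adjoint_pair T S \<Longrightarrow> adjoint_pair S T"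
  unfolding adjoint_pair_def
  by (subst (1 2) cinner_commute) simp

lemma op_star_eq:
  fixes T S :: "'a operator"
  assumes "adjoint_pair T S"
  shows "op_star T = S"
  unfolding op_star_def
proof (rule the_equality)
  show "\<forall>u v. ell2_cinner (T u) v = ell2_cinner u (S v)"
    using assms by (simp add: adjoint_pair_def)
next
  fix S' :: "'a operator" assume S': "\<forall>u v. ell2_cinner (T u) v = ell2_cinner u (S' v)"
  show "S' = S"
    by (intro blinfun_eqI cinner_nondegenerate) (metis S' assms adjoint_pair_def)
qed

lemma adjoint_pair_op_star: "adjointable T \<Longrightarrow> adjoint_pair T (op_star T)"
  unfolding adjointable_def using op_star_eq by blast

lemma adjoint_pair_adjointable: "adjoint_pair T S \<Longrightarrow> adjointable T"
  unfolding adjointable_def by blast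

lemma adjointable_op_star: "adjointable T \<Longrightarrow> adjointable (op_star T)"
  using adjoint_pair_op_star adjoint_pair_sym adjointable_def by blast

lemma op_star_op_star: "adjointable T \<Longrightarrow> op_star (op_star T) = T"
  using adjoint_pair_op_star adjoint_pair_sym op_star_eq by blast

lemma adjoint_pair_zero: "adjoint_pair (0 :: 'a operator) 0"
  by (simp add: adjoint_pair_def cinner_zero)

lemma adjoint_pair_add:
  "adjoint_pair T S \<Longrightarrow> adjoint_pair T' S' \<Longrightarrow> adjoint_pair (T + T') (S + S')"
  by (simp add: adjoint_pair_def plus_blinfun.rep_eq cinner_add_left cinner_add_right)

lemma adjoint_pair_diff:
  "adjoint_pair T S \<Longrightarrow> adjoint_pair T' S' \<Longrightarrow> adjoint_pair (T - T') (S - S')"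
  by (simp add: adjoint_pair_def minus_blinfun.rep_eq cinner_diff_left cinner_diff_right)

lemma adjoint_pair_compose:
  "adjoint_pair T S \<Longrightarrow> adjoint_pair T' S' \<Longrightarrow> adjoint_pair (T o\<^sub>L T') (S' o\<^sub>L S)"
  by (simp add: adjoint_pair_def)

lemma op_scale_apply: "blinfun_apply (op_scale z T) u = ell2_scale z (T u)"
  unfolding op_scale_def
  by (subst bounded_linear_Blinfun_apply)
    (intro bounded_linear_compose[OF bounded_linear_ell2_scale] blinfun.bounded_linear_right, rule refl)

lemma op_star_zero: "op_star 0 = 0"
  by (rule op_star_eq[OF adjoint_pair_zero])

lemma op_star_add: "adjointable S \<Longrightarrow> adjointable T \<Longrightarrow> op_star (S + T) = op_star S + op_star T"
  by (intro op_star_eq adjoint_pair_add adjoint_pair_op_star)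

lemma adjointable_diff: "adjointable S \<Longrightarrow> adjointable T \<Longrightarrow> adjointable (S - T)"
  and op_star_diff: "adjointable S \<Longrightarrow> adjointable T \<Longrightarrow> op_star (S - T) = op_star S - op_star T"
  using adjoint_pair_diff[OF adjoint_pair_op_star adjoint_pair_op_star, of S T]
  by (auto intro: adjoint_pair_adjointable op_star_eq)

lemma op_star_compose: "adjointable S \<Longrightarrow> adjointable T \<Longrightarrow> op_star (S o\<^sub>L T) = op_star T o\<^sub>L op_star S"
  by (intro op_star_eq adjoint_pair_compose adjoint_pair_op_star)

lemma op_scale_compose_left: "op_scale z S o\<^sub>L T = op_scale z (S o\<^sub>L T)"
  by (intro blinfun_eqI) (simp add: op_scale_apply)

lemma bounded_linear_op_scale: "bounded_linear (op_scale z)"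
proof (rule bounded_linear_intro[where K = "cmod z"])
  show "norm (op_scale z T) \<le> norm T * cmod z" for T
  proof (rule norm_blinfun_bound)
    show "norm (op_scale z T u) \<le> norm T * cmod z * norm u" for u
      using mult_left_mono[OF norm_blinfun[of T u], of "cmod z"]
      by (simp add: op_scale_apply norm_ell2_scale algebra_simps)
  qed simp
qed (auto intro!: blinfun_eqI simp: op_scale_apply plus_blinfun.rep_eq scaleR_blinfun.rep_eq
    ell2_scale_add_right ell2_scale_scaleR)

lemma op_scale_minus_one: "op_scale (- 1) T = - T"
  by (intro blinfun_eqI ell2_eqI)
    (simp add: op_scale_apply ell2_scale.rep_eq uminus_ell2.rep_eq uminus_blinfun.rep_eq)

lemma inner_op_star: "adjointable T \<Longrightarrow> inner (blinfun_apply T u) v = inner u (blinfun_apply (op_star T) v)"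
  using adjoint_pair_op_star[of T] by (simp add: adjoint_pair_def inner_ell2_def)

lemma norm_op_star_le:
  assumes "adjointable T"
  shows "norm (op_star T) \<le> norm T"
proof (rule norm_blinfun_bound)
  fix v
  have "norm (op_star T v) * norm (op_star T v) = inner (T (op_star T v)) v"
    by (simp add: inner_op_star[OF assms] dot_square_norm power2_eq_square)
  also have "\<dots> \<le> norm (T (op_star T v)) * norm v" by (rule norm_cauchy_schwarz)
  also have "\<dots> \<le> norm T * norm (op_star T v) * norm v"
    by (intro mult_right_mono norm_blinfun) auto
  finally show "norm (op_star T v) \<le> norm T * norm v"
    by (cases "op_star T v = 0") (auto simp: mult.commute mult.left_commute)
qed simp

lemma norm_op_star: "adjointable T \<Longrightarrow> norm (op_star T) = norm T"
  by (metis adjointable_op_star norm_op_star_le op_star_op_star order_antisym)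

lemma C_star_identity:
  assumes "adjointable T"
  shows "norm (op_star T o\<^sub>L T) = (norm T)\<^sup>2"
proof (rule antisym)
  show "norm (op_star T o\<^sub>L T) \<le> (norm T)\<^sup>2"
    using norm_blinfun_compose[of "op_star T" T] by (simp add: norm_op_star assms power2_eq_square)
  have "norm T \<le> sqrt (norm (op_star T o\<^sub>L T))"
  proof (rule norm_blinfun_bound)
    fix u
    have "(norm (T u))\<^sup>2 = inner u ((op_star T o\<^sub>L T) u)"
      by (simp add: power2_norm_eq_inner inner_op_star[OF assms])
    also have "\<dots> \<le> norm u * norm ((op_star T o\<^sub>L T) u)" by (rule norm_cauchy_schwarz)
    also have "\<dots> \<le> norm u * (norm (op_star T o\<^sub>L T) * norm u)"
      by (intro mult_left_mono norm_blinfun) auto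
    also have "\<dots> = (sqrt (norm (op_star T o\<^sub>L T)) * norm u)\<^sup>2"
      by (simp add: power_mult_distrib power2_eq_square)
    finally show "norm (T u) \<le> sqrt (norm (op_star T o\<^sub>L T)) * norm u"
      by (rule power2_le_imp_le) simp
  qed simp
  then show "(norm T)\<^sup>2 \<le> norm (op_star T o\<^sub>L T)"
    by (metis norm_ge_zero power_mono real_sqrt_pow2)
qed

text \<open>Taking adjoints is isometric, so the adjoints of a convergent sequence converge as well, and their
  limit is an adjoint of the limit.  In this way every operator of the reduced algebra inherits an
  adjoint from the compactly supported functions.\<close>

lemma adjointable_limit:
  assumes T: "\<And>n. adjointable (T n)" and lim: "T \<longlonglongrightarrow> L"
  shows "adjointable L" and "(\<lambda>n. op_star (T n)) \<longlonglongrightarrow> op_star L"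
proof -
  have "Cauchy (\<lambda>n. op_star (T n))"
  proof (rule metric_CauchyI)
    fix e :: real assume "e > 0"
    then obtain M where "\<forall>m\<ge>M. \<forall>n\<ge>M. dist (T m) (T n) < e"
      using lim convergent_Cauchy convergentI metric_CauchyD by blast
    moreover have "dist (op_star (T m)) (op_star (T n)) = dist (T m) (T n)" for m n
      unfolding dist_norm by (metis T adjointable_diff norm_op_star op_star_diff)
    ultimately show "\<exists>M. \<forall>m\<ge>M. \<forall>n\<ge>M. dist (op_star (T m)) (op_star (T n)) < e" by metis
  qed
  then obtain S where S: "(\<lambda>n. op_star (T n)) \<longlonglongrightarrow> S"
    using Cauchy_convergent_iff convergent_def by blast
  have "adjoint_pair L S"
    unfolding adjoint_pair_def
  proof (intro allI)
    fix u v
    have "(\<lambda>n. ell2_cinner (T n u) v) \<longlonglongrightarrow> ell2_cinner (L u) v"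
      by (intro tendsto_cinner tendsto_intros lim)
    moreover have "(\<lambda>n. ell2_cinner u (op_star (T n) v)) \<longlonglongrightarrow> ell2_cinner u (S v)"
      by (intro tendsto_cinner tendsto_intros S)
    moreover have "ell2_cinner (T n u) v = ell2_cinner u (op_star (T n) v)" for n
      using adjoint_pair_op_star[OF T] by (simp add: adjoint_pair_def)
    ultimately show "ell2_cinner (L u) v = ell2_cinner u (S v)"
      by (metis (no_types, lifting) LIMSEQ_unique ext)
  qed
  then show "adjointable L" "(\<lambda>n. op_star (T n)) \<longlonglongrightarrow> op_star L"
    using S op_star_eq adjoint_pair_adjointable by auto
qed

section \<open>Interior tensor products of bimodules of operators\<close>

text \<open>The bimodules of a cocycle are spaces of operators that differ only in the carrier \<open>X\<close>; the
  coefficient algebra \<open>A\<close> acts through its embedding \<open>I\<close>.\<close>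

definition operator_bimodule ::
  "'a operator set \<Rightarrow> ('a operator \<Rightarrow> 'a operator) \<Rightarrow> 'a operator set \<Rightarrow>
    ('a operator, 'a operator) hilbert_bimodule" where
  "operator_bimodule A I X =
     \<lparr>bm_carrier = X, bm_add = (+), bm_scale = op_scale,
      bm_left = (\<lambda>a x. I a o\<^sub>L x), bm_right = (\<lambda>x a. x o\<^sub>L I a),
      bm_inner = (\<lambda>x y. inv_into A I (op_star x o\<^sub>L y))\<rparr>"

lemma operator_bimodule_simps [simp]:
  "bm_carrier (operator_bimodule A I X) = X"
  "bm_add (operator_bimodule A I X) = (+)"
  "bm_scale (operator_bimodule A I X) = op_scale"
  "bm_left (operator_bimodule A I X) = (\<lambda>a x. I a o\<^sub>L x)"
  "bm_right (operator_bimodule A I X) = (\<lambda>x a. x o\<^sub>L I a)"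
  "bm_inner (operator_bimodule A I X) = (\<lambda>x y. inv_into A I (op_star x o\<^sub>L y))"
  by (simp_all add: operator_bimodule_def)

definition sum_of_products :: "('a operator, 'a operator) formal_tensor \<Rightarrow> 'a operator" where
  "sum_of_products s = (\<Sum>(x, y)\<leftarrow>s. x o\<^sub>L y)"

lemma sum_of_products_simps [simp]:
  "sum_of_products [] = 0"
  "sum_of_products ((x, y) # s) = (x o\<^sub>L y) + sum_of_products s"
  "sum_of_products (s @ t) = sum_of_products s + sum_of_products t"
  by (simp_all add: sum_of_products_def)

lemma sum_of_products_scale:
  "sum_of_products (ft_scale (operator_bimodule A I X) z s) = op_scale z (sum_of_products s)"
  by (induct s)
    (auto simp: ft_scale_def op_scale_compose_left
      linear_0[OF bounded_linear.linear[OF bounded_linear_op_scale]]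
      linear_add[OF bounded_linear.linear[OF bounded_linear_op_scale]])

lemma blinfun_compose_minus_right:
  fixes x :: "'a operator"
  shows "x o\<^sub>L (y - z) = (x o\<^sub>L y) - (x o\<^sub>L z)"
  by (rule bounded_bilinear.diff_right[OF bounded_bilinear_blinfun_compose])

lemma blinfun_compose_minus_left:
  fixes x :: "'a operator"
  shows "(y - z) o\<^sub>L x = (y o\<^sub>L x) - (z o\<^sub>L x)"
  by (rule bounded_bilinear.diff_left[OF bounded_bilinear_blinfun_compose])

lemma blinfun_compose_plus_right:
  fixes x :: "'a operator"
  shows "x o\<^sub>L (y + z) = (x o\<^sub>L y) + (x o\<^sub>L z)"
  by (rule bounded_bilinear.add_right[OF bounded_bilinear_blinfun_compose])

lemma blinfun_compose_plus_left:
  fixes x :: "'a operator"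
  shows "(y + z) o\<^sub>L x = (y o\<^sub>L x) + (z o\<^sub>L x)"
  by (rule bounded_bilinear.add_left[OF bounded_bilinear_blinfun_compose])

lemma blinfun_compose_assoc': "(x o\<^sub>L y) o\<^sub>L z = x o\<^sub>L (y o\<^sub>L z)"
  by (rule blinfun_eqI) simp

text \<open>\<open>X\<close>, \<open>Y\<close> and \<open>Z\<close> stand for the homogeneous parts of degrees \<open>p\<close>, \<open>q\<close> and \<open>p q\<close>.  The decisive
  conditions are that \<open>I\<close> is isometric and that \<open>X\<^sup>* X\<close> and \<open>Z\<^sup>* Z\<close> lie in its image: together with
  \<open>X Y \<subseteq> Z\<close> they let the inner product of the tensor product be computed by multiplying operators.\<close>

locale operator_bimodule_pair =
  fixes A :: "'a operator set" and I :: "'a operator \<Rightarrow> 'a operator" and X Y Z :: "'a operator set"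
  assumes A_zero: "0 \<in> A"
    and A_diff: "a \<in> A \<Longrightarrow> b \<in> A \<Longrightarrow> a - b \<in> A"
    and I_diff: "a \<in> A \<Longrightarrow> b \<in> A \<Longrightarrow> I (a - b) = I a - I b"
    and norm_I: "a \<in> A \<Longrightarrow> norm (I a) = norm a"
    and X_adjointable: "X \<subseteq> Collect adjointable"
    and Y_adjointable: "Y \<subseteq> Collect adjointable"
    and X_scale: "x \<in> X \<Longrightarrow> op_scale z x \<in> X"
    and X_left: "a \<in> A \<Longrightarrow> x \<in> X \<Longrightarrow> I a o\<^sub>L x \<in> X"
    and Y_right: "a \<in> A \<Longrightarrow> y \<in> Y \<Longrightarrow> y o\<^sub>L I a \<in> Y"
    and X_inner: "x \<in> X \<Longrightarrow> w \<in> X \<Longrightarrow> op_star x o\<^sub>L w \<in> I ` A"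
    and Z_inner: "x \<in> Z \<Longrightarrow> w \<in> Z \<Longrightarrow> op_star x o\<^sub>L w \<in> I ` A"
    and product_closed: "x \<in> X \<Longrightarrow> y \<in> Y \<Longrightarrow> x o\<^sub>L y \<in> Z"
    and Z_zero: "0 \<in> Z"
    and Z_add: "x \<in> Z \<Longrightarrow> y \<in> Z \<Longrightarrow> x + y \<in> Z"
    and Z_closed: "closed Z"
    and Z_adjointable: "Z \<subseteq> Collect adjointable"
begin

abbreviation J :: "'a operator \<Rightarrow> 'a operator" where "J \<equiv> inv_into A I"
abbreviation BX where "BX \<equiv> operator_bimodule A I X"
abbreviation BY where "BY \<equiv> operator_bimodule A I Y"
abbreviation BZ where "BZ \<equiv> operator_bimodule A I Z"

lemma I_J: "b \<in> I ` A \<Longrightarrow> I (J b) = b" and J_in: "b \<in> I ` A \<Longrightarrow> J b \<in> A"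
  by (auto intro: f_inv_into_f inv_into_into)

lemma I_zero: "I 0 = 0"
  using I_diff[OF A_zero A_zero] by simp

lemma inj_on_I: "inj_on I A"
proof (rule inj_onI)
  fix a b assume "a \<in> A" "b \<in> A" "I a = I b"
  then have "norm (a - b) = 0" using norm_I[OF A_diff, of a b] by (simp add: I_diff)
  then show "a = b" by simp
qed

lemma J_I: "a \<in> A \<Longrightarrow> J (I a) = a"
  by (rule inv_into_f_f[OF inj_on_I])

lemma J_zero: "J 0 = 0"
  using J_I[OF A_zero] by (simp add: I_zero)

lemma J_diff:
  assumes "b \<in> I ` A" "d \<in> I ` A"
  shows "J (b - d) = J b - J d"
proof -
  have "b - d = I (J b - J d)" using assms by (simp add: I_diff J_in I_J)
  then show ?thesis using assms by (simp add: J_I J_in A_diff)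
qed

lemma image_I_diff: "b \<in> I ` A \<Longrightarrow> d \<in> I ` A \<Longrightarrow> b - d \<in> I ` A"
  by (metis A_diff I_J I_diff J_in imageI)

lemma J_add:
  assumes "b \<in> I ` A" "d \<in> I ` A"
  shows "J (b + d) = J b + J d"
proof -
  have z: "0 \<in> I ` A" using A_zero I_zero by (metis imageI)
  have "J (b - (0 - d)) = J b - (0 - J d)"
    using assms z by (simp only: J_diff image_I_diff J_zero)
  then show ?thesis by simp
qed

lemma norm_J: "b \<in> I ` A \<Longrightarrow> norm (J b) = norm b"
  by (metis I_J J_in norm_I)

lemma tendsto_J:
  assumes "\<And>n. f n \<in> I ` A" "b \<in> I ` A" "f \<longlonglongrightarrow> b"
  shows "(\<lambda>n. J (f n)) \<longlonglongrightarrow> J b"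
proof -
  have "norm (J (f n) - J b) = norm (f n - b)" for n
    using assms by (simp add: J_diff[symmetric] norm_J image_I_diff)
  with \<open>f \<longlonglongrightarrow> b\<close> show ?thesis
    by (subst LIM_zero_iff[symmetric], subst tendsto_norm_zero_iff[symmetric])
      (simp add: tendsto_norm_zero_iff LIM_zero_iff)
qed

lemma product_adjointable: "x \<in> X \<Longrightarrow> y \<in> Y \<Longrightarrow> adjointable (x o\<^sub>L y)"
  using product_closed Z_adjointable by blast

lemma sum_of_products_in: "set s \<subseteq> X \<times> Y \<Longrightarrow> sum_of_products s \<in> Z"
  by (induct s) (auto simp: Z_zero Z_add product_closed)

lemma adjointable_sum_of_products: "set s \<subseteq> X \<times> Y \<Longrightarrow> adjointable (sum_of_products s)"
  using sum_of_products_in Z_adjointable by blast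

text \<open>The defining formula \<open>\<langle>x \<otimes> y, w \<otimes> z\<rangle> = \<langle>y, \<langle>x, w\<rangle> z\<rangle>\<close> reads
  \<open>y\<^sup>* x\<^sup>* w z = (x y)\<^sup>* (w z)\<close> for operators: the semi-inner product of formal tensors is that of
  their sums of products, and everything below is a consequence of this.\<close>

lemma ft_inner_eq:
  assumes "set s \<subseteq> X \<times> Y" "set t \<subseteq> X \<times> Y"
  shows "ft_inner BX BY s t = J (op_star (sum_of_products s) o\<^sub>L sum_of_products t)"
proof -
  have one: "bm_inner BY y (bm_left BY (bm_inner BX x w) z) = J (op_star (x o\<^sub>L y) o\<^sub>L (w o\<^sub>L z))"
    if "x \<in> X" "y \<in> Y" "w \<in> X" for x y w z
    using that X_adjointable Y_adjointable
    by (auto simp: I_J X_inner op_star_compose subset_iff blinfun_compose_assoc')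
  have row: "(\<Sum>(w, z)\<leftarrow>t. bm_inner BY y (bm_left BY (bm_inner BX x w) z)) =
      J (op_star (x o\<^sub>L y) o\<^sub>L sum_of_products t)"
    if x: "x \<in> X" and y: "y \<in> Y" for x y
    using assms(2)
  proof (induct t)
    case Nil
    then show ?case by (simp add: J_zero)
  next
    case (Cons a t)
    obtain w z where a: "a = (w, z)" by (cases a)
    with Cons.prems have wz: "w \<in> X" "z \<in> Y" and t: "set t \<subseteq> X \<times> Y" by auto
    show ?case
      using x y wz t Cons.hyps[OF t]
      by (simp only: a list.map sum_list.Cons prod.case one sum_of_products_simps
          blinfun_compose_plus_right J_add Z_inner product_closed sum_of_products_in)
  qed
  show ?thesis
    using assms(1)
  proof (induct s)
    case Nil
    then show ?case by (simp add: J_zero ft_inner_def op_star_zero)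
  next
    case (Cons a s)
    obtain x y where a: "a = (x, y)" by (cases a)
    with Cons.prems have xy: "x \<in> X" "y \<in> Y" and s: "set s \<subseteq> X \<times> Y" by auto
    have "ft_inner BX BY (a # s) t =
        J (op_star (x o\<^sub>L y) o\<^sub>L sum_of_products t) + ft_inner BX BY s t"
      unfolding ft_inner_def a list.map sum_list.Cons prod.case row[OF xy] ..
    also have "\<dots> = J ((op_star (x o\<^sub>L y) o\<^sub>L sum_of_products t) +
        (op_star (sum_of_products s) o\<^sub>L sum_of_products t))"
      unfolding Cons.hyps[OF s]
      by (intro J_add[symmetric] Z_inner product_closed xy sum_of_products_in s assms(2))
    finally show ?case
      by (simp add: a op_star_add product_adjointable adjointable_sum_of_products xy s
          blinfun_compose_plus_left)
  qed
qed

lemma set_ft_scale: "set s \<subseteq> X \<times> Y \<Longrightarrow> set (ft_scale BX z s) \<subseteq> X \<times> Y"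
  by (auto simp: ft_scale_def X_scale)

text \<open>By the C*-identity the seminorm of a formal tensor is the operator norm of its sum of products.
  Hence the interior tensor product is a copy of the norm closure of the sums of products.\<close>

lemma ft_dist_eq:
  assumes "set s \<subseteq> X \<times> Y" "set t \<subseteq> X \<times> Y"
  shows "ft_dist BX BY s t = norm (sum_of_products s - sum_of_products t)"
proof -
  let ?d = "s @ ft_scale BX (- 1) t"
  have d: "set ?d \<subseteq> X \<times> Y" using assms set_ft_scale by simp
  have e: "sum_of_products ?d = sum_of_products s - sum_of_products t"
    by (simp add: sum_of_products_scale op_scale_minus_one)
  show ?thesis
    unfolding ft_dist_def Let_def ft_inner_eq[OF d d]
    by (subst norm_J) (use d in \<open>auto simp: Z_inner sum_of_products_in e[symmetric]
      C_star_identity[OF adjointable_sum_of_products] simp del: sum_of_products_simps\<close>)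
qed

abbreviation cauchy_tensors where "cauchy_tensors \<equiv> ft_Cauchy BX BY"

lemma cauchy_tensors_iff:
  "s \<in> cauchy_tensors \<longleftrightarrow>
    (\<forall>n. set (s n) \<subseteq> X \<times> Y) \<and> Cauchy (\<lambda>n. sum_of_products (s n))"
  unfolding ft_Cauchy_def Cauchy_def dist_norm by (auto simp: ft_dist_eq)

definition product_limit :: "(nat \<Rightarrow> ('a operator, 'a operator) formal_tensor) \<Rightarrow> 'a operator" where
  "product_limit s = lim (\<lambda>n. sum_of_products (s n))"

lemma tendsto_product_limit:
  "s \<in> cauchy_tensors \<Longrightarrow> (\<lambda>n. sum_of_products (s n)) \<longlonglongrightarrow> product_limit s"
  unfolding cauchy_tensors_iff product_limit_def
  by (simp add: Cauchy_convergent_iff convergent_LIMSEQ_iff)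

lemma cauchy_tensorsI:
  assumes "\<And>n. set (s n) \<subseteq> X \<times> Y" "(\<lambda>n. sum_of_products (s n)) \<longlonglongrightarrow> z"
  shows "s \<in> cauchy_tensors" and "product_limit s = z"
  using assms by (auto simp: cauchy_tensors_iff product_limit_def limI
      intro!: convergent_Cauchy convergentI)

lemma product_limit_in: "s \<in> cauchy_tensors \<Longrightarrow> product_limit s \<in> Z"
  by (rule closed_sequentially[OF Z_closed _ tendsto_product_limit])
    (auto simp: cauchy_tensors_iff sum_of_products_in)

lemma ft_equiv_iff:
  "(s, t) \<in> ft_equiv BX BY \<longleftrightarrow>
    s \<in> cauchy_tensors \<and> t \<in> cauchy_tensors \<and> product_limit s = product_limit t"
proof -
  have "(\<lambda>n. ft_dist BX BY (s n) (t n)) \<longlonglongrightarrow> 0 \<longleftrightarrow> product_limit s = product_limit t"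
    if st: "s \<in> cauchy_tensors" "t \<in> cauchy_tensors"
  proof -
    have *: "(\<lambda>n. ft_dist BX BY (s n) (t n)) \<longlonglongrightarrow> norm (product_limit s - product_limit t)"
      using st tendsto_norm[OF tendsto_diff[OF st[THEN tendsto_product_limit]]]
      by (simp add: cauchy_tensors_iff ft_dist_eq)
    show ?thesis
      using * LIMSEQ_unique[OF *, of 0] by auto
  qed
  then show ?thesis by (auto simp: ft_equiv_def)
qed

lemma ft_class_iff:
  "s \<in> cauchy_tensors \<Longrightarrow>
    t \<in> ft_class BX BY s \<longleftrightarrow> t \<in> cauchy_tensors \<and> product_limit t = product_limit s"
  by (auto simp: ft_equiv_iff)

lemma ft_class_self: "s \<in> cauchy_tensors \<Longrightarrow> s \<in> ft_class BX BY s"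
  by (simp only: ft_class_iff)

lemma ft_class_eqI:
  "s \<in> cauchy_tensors \<Longrightarrow> t \<in> cauchy_tensors \<Longrightarrow> product_limit s = product_limit t \<Longrightarrow>
    ft_class BX BY s = ft_class BX BY t"
  by (rule Set.set_eqI) (simp only: ft_class_iff)

lemma carrier_tensor: "bm_carrier (tensor BX BY) = ft_class BX BY ` cauchy_tensors"
  by (auto simp: tensor_def quotient_def)

text \<open>Operations on classes can be computed on one representative as soon as their effect on the
  limit of products depends only on this limit.\<close>

lemma UN_ft_class:
  assumes s: "s \<in> cauchy_tensors"
    and F: "\<And>t. t \<in> cauchy_tensors \<Longrightarrow> F t \<in> cauchy_tensors \<and> product_limit (F t) = g (product_limit t)"
  shows "(\<Union>t\<in>ft_class BX BY s. ft_class BX BY (F t)) = ft_class BX BY (F s)"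
proof -
  have "ft_class BX BY (F t) = ft_class BX BY (F s)" if "t \<in> ft_class BX BY s" for t
  proof -
    from that s have "t \<in> cauchy_tensors" "product_limit t = product_limit s"
      by (simp_all only: ft_class_iff)
    then show ?thesis using s F by (intro ft_class_eqI) auto
  qed
  with ft_class_self[OF s] show ?thesis by blast
qed

lemma cauchy_add:
  assumes "s \<in> cauchy_tensors" "t \<in> cauchy_tensors"
  shows "(\<lambda>n. s n @ t n) \<in> cauchy_tensors"
    and "product_limit (\<lambda>n. s n @ t n) = product_limit s + product_limit t"
  by (rule cauchy_tensorsI[where z = "product_limit s + product_limit t"];
    use assms in \<open>auto simp: cauchy_tensors_iff intro!: tendsto_add tendsto_product_limit\<close>)+

lemma cauchy_scale:
  assumes s: "s \<in> cauchy_tensors"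
  shows "(\<lambda>n. ft_scale BX z (s n)) \<in> cauchy_tensors" (is "?s \<in> _")
    and "product_limit (\<lambda>n. ft_scale BX z (s n)) = op_scale z (product_limit s)"
proof -
  have l: "(\<lambda>n. sum_of_products (?s n)) \<longlonglongrightarrow> op_scale z (product_limit s)"
    unfolding sum_of_products_scale
    by (rule bounded_linear.tendsto[OF bounded_linear_op_scale tendsto_product_limit[OF s]])
  have m: "set (?s n) \<subseteq> X \<times> Y" for n
    using s by (intro set_ft_scale) (simp add: cauchy_tensors_iff)
  show "?s \<in> cauchy_tensors" "product_limit ?s = op_scale z (product_limit s)"
    using cauchy_tensorsI[OF m l] by auto
qed

lemma sum_of_products_left:
  "sum_of_products (map (\<lambda>(x, y). (bm_left BX a x, y)) s) = I a o\<^sub>L sum_of_products s"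
  by (induct s) (auto simp: blinfun_compose_plus_right blinfun_compose_assoc')

lemma sum_of_products_right:
  "sum_of_products (map (\<lambda>(x, y). (x, bm_right BY y a)) s) = sum_of_products s o\<^sub>L I a"
  by (induct s) (auto simp: blinfun_compose_plus_left blinfun_compose_assoc')

lemma cauchy_left:
  assumes a: "a \<in> A" and s: "s \<in> cauchy_tensors"
  shows "(\<lambda>n. map (\<lambda>(x, y). (bm_left BX a x, y)) (s n)) \<in> cauchy_tensors" (is "?s \<in> _")
    and "product_limit (\<lambda>n. map (\<lambda>(x, y). (bm_left BX a x, y)) (s n)) = I a o\<^sub>L product_limit s"
proof -
  have l: "(\<lambda>n. sum_of_products (?s n)) \<longlonglongrightarrow> (I a o\<^sub>L product_limit s)"
    unfolding sum_of_products_left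
    by (intro bounded_bilinear.tendsto[OF bounded_bilinear_blinfun_compose] tendsto_const
        tendsto_product_limit s)
  have m: "set (?s n) \<subseteq> X \<times> Y" for n
    using s a by (fastforce simp: cauchy_tensors_iff X_left)
  show "?s \<in> cauchy_tensors" "product_limit ?s = I a o\<^sub>L product_limit s"
    using cauchy_tensorsI[OF m l] by auto
qed

lemma cauchy_right:
  assumes a: "a \<in> A" and s: "s \<in> cauchy_tensors"
  shows "(\<lambda>n. map (\<lambda>(x, y). (x, bm_right BY y a)) (s n)) \<in> cauchy_tensors" (is "?s \<in> _")
    and "product_limit (\<lambda>n. map (\<lambda>(x, y). (x, bm_right BY y a)) (s n)) = product_limit s o\<^sub>L I a"
proof -
  have l: "(\<lambda>n. sum_of_products (?s n)) \<longlonglongrightarrow> (product_limit s o\<^sub>L I a)"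
    unfolding sum_of_products_right
    by (intro bounded_bilinear.tendsto[OF bounded_bilinear_blinfun_compose] tendsto_const
        tendsto_product_limit s)
  have m: "set (?s n) \<subseteq> X \<times> Y" for n
    using s a by (fastforce simp: cauchy_tensors_iff Y_right)
  show "?s \<in> cauchy_tensors" "product_limit ?s = product_limit s o\<^sub>L I a"
    using cauchy_tensorsI[OF m l] by auto
qed

lemma tensor_add:
  assumes s: "s \<in> cauchy_tensors" and t: "t \<in> cauchy_tensors"
  shows "bm_add (tensor BX BY) (ft_class BX BY s) (ft_class BX BY t) = ft_class BX BY (\<lambda>n. s n @ t n)"
proof -
  have "(\<Union>t'\<in>ft_class BX BY t. ft_class BX BY (\<lambda>n. s' n @ t' n)) = ft_class BX BY (\<lambda>n. s' n @ t n)"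
    if "s' \<in> cauchy_tensors" for s'
    by (rule UN_ft_class[where g = "\<lambda>z. product_limit s' + z"]) (auto simp: t that cauchy_add)
  then have "bm_add (tensor BX BY) (ft_class BX BY s) (ft_class BX BY t) =
      (\<Union>s'\<in>ft_class BX BY s. ft_class BX BY (\<lambda>n. s' n @ t n))"
    using s by (simp add: tensor_def ft_class_iff del: Image_singleton_iff)
  also have "\<dots> = ft_class BX BY (\<lambda>n. s n @ t n)"
    by (rule UN_ft_class[where g = "\<lambda>z. z + product_limit t"]) (auto simp: s t cauchy_add)
  finally show ?thesis .
qed

lemma tensor_scale:
  assumes s: "s \<in> cauchy_tensors"
  shows "bm_scale (tensor BX BY) z (ft_class BX BY s) = ft_class BX BY (\<lambda>n. ft_scale BX z (s n))"
  unfolding tensor_def hilbert_bimodule.simps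
  by (rule UN_ft_class[OF s, where g = "op_scale z"]) (simp add: cauchy_scale)

lemma tensor_left:
  assumes a: "a \<in> A" and s: "s \<in> cauchy_tensors"
  shows "bm_left (tensor BX BY) a (ft_class BX BY s) =
    ft_class BX BY (\<lambda>n. map (\<lambda>(x, y). (bm_left BX a x, y)) (s n))"
  unfolding tensor_def hilbert_bimodule.simps
  by (rule UN_ft_class[OF s, where g = "\<lambda>z. I a o\<^sub>L z"])
    (simp add: cauchy_left[OF a] del: operator_bimodule_simps)

lemma tensor_right:
  assumes a: "a \<in> A" and s: "s \<in> cauchy_tensors"
  shows "bm_right (tensor BX BY) (ft_class BX BY s) a =
    ft_class BX BY (\<lambda>n. map (\<lambda>(x, y). (x, bm_right BY y a)) (s n))"
  unfolding tensor_def hilbert_bimodule.simps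
  by (rule UN_ft_class[OF s, where g = "\<lambda>z. z o\<^sub>L I a"])
    (simp add: cauchy_right[OF a] del: operator_bimodule_simps)

lemma tensor_inner:
  assumes s: "s \<in> cauchy_tensors" and t: "t \<in> cauchy_tensors"
  shows "bm_inner (tensor BX BY) (ft_class BX BY s) (ft_class BX BY t) =
    J (op_star (product_limit s) o\<^sub>L product_limit t)"
proof -
  have *: "(\<lambda>n. ft_inner BX BY (s' n) (t' n)) \<longlonglongrightarrow> J (op_star (product_limit s) o\<^sub>L product_limit t)"
    if "s' \<in> ft_class BX BY s" "t' \<in> ft_class BX BY t" for s' t'
  proof -
    from that s t have s': "s' \<in> cauchy_tensors" "product_limit s' = product_limit s"
      and t': "t' \<in> cauchy_tensors" "product_limit t' = product_limit t"
      by (simp_all only: ft_class_iff)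
    have e: "ft_inner BX BY (s' n) (t' n) =
        J (op_star (sum_of_products (s' n)) o\<^sub>L sum_of_products (t' n))" for n
      using s' t' by (intro ft_inner_eq) (auto simp: cauchy_tensors_iff)
    show ?thesis
      unfolding e
    proof (rule tendsto_J)
      show "op_star (sum_of_products (s' n)) o\<^sub>L sum_of_products (t' n) \<in> I ` A" for n
        using s' t' by (intro Z_inner sum_of_products_in) (auto simp: cauchy_tensors_iff)
      show "op_star (product_limit s) o\<^sub>L product_limit t \<in> I ` A"
        by (intro Z_inner product_limit_in s t)
      have "(\<lambda>n. op_star (sum_of_products (s' n))) \<longlonglongrightarrow> op_star (product_limit s)"
        unfolding s'(2)[symmetric] using s'
        by (intro adjointable_limit(2) tendsto_product_limit adjointable_sum_of_products)
          (auto simp: cauchy_tensors_iff)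
      then show "(\<lambda>n. op_star (sum_of_products (s' n)) o\<^sub>L sum_of_products (t' n))
          \<longlonglongrightarrow> (op_star (product_limit s) o\<^sub>L product_limit t)"
        unfolding t'(2)[symmetric]
        by (intro bounded_bilinear.tendsto[OF bounded_bilinear_blinfun_compose] tendsto_product_limit t')
    qed
  qed
  show ?thesis
    unfolding tensor_def hilbert_bimodule.simps
  proof (rule the_equality)
    show "\<exists>s'\<in>ft_class BX BY s. \<exists>t'\<in>ft_class BX BY t. (\<lambda>n. ft_inner BX BY (s' n) (t' n))
        \<longlonglongrightarrow> J (op_star (product_limit s) o\<^sub>L product_limit t)"
      using ft_class_self[OF s] ft_class_self[OF t] * by blast
  qed (use * LIMSEQ_unique in blast)
qed

definition is_multiplication ::
  "((nat \<Rightarrow> ('a operator, 'a operator) formal_tensor) set \<Rightarrow> 'a operator) \<Rightarrow> bool" where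
  "is_multiplication M \<longleftrightarrow> bimodule_linear A (tensor BX BY) BZ M \<and>
     inner_preserving (tensor BX BY) BZ M \<and>
     (\<forall>x\<in>X. \<forall>y\<in>Y. M (elementary_tensor BX BY x y) = x o\<^sub>L y)"

lemma constant_tensor:
  assumes "set s \<subseteq> X \<times> Y"
  shows "(\<lambda>_. s) \<in> cauchy_tensors" "product_limit (\<lambda>_. s) = sum_of_products s"
  using cauchy_tensorsI[of "\<lambda>_. s" "sum_of_products s"] assms by auto

text \<open>The witness sends the class of a Cauchy sequence of formal tensors to the limit of their sums of
  products.\<close>

theorem multiplication_exists: "\<exists>M. is_multiplication M"
proof
  define M where "M u = product_limit (SOME s. s \<in> u)"
    for u :: "(nat \<Rightarrow> ('a operator, 'a operator) formal_tensor) set"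
  have M: "M (ft_class BX BY s) = product_limit s" if "s \<in> cauchy_tensors" for s
  proof -
    have "(SOME t. t \<in> ft_class BX BY s) \<in> ft_class BX BY s"
      using ft_class_self[OF that] by (rule someI[of "\<lambda>t. t \<in> ft_class BX BY s"])
    then show ?thesis unfolding M_def using that by (simp only: ft_class_iff)
  qed
  show "is_multiplication M"
    unfolding is_multiplication_def
  proof (intro conjI ballI)
    show "bimodule_linear A (tensor BX BY) BZ M"
      unfolding bimodule_linear_def carrier_tensor
      by (auto simp: M product_limit_in tensor_add tensor_scale tensor_left tensor_right
          cauchy_add cauchy_scale cauchy_left cauchy_right
          simp del: operator_bimodule_simps(4-5) Image_singleton_iff)
        (simp_all)
    show "inner_preserving (tensor BX BY) BZ M"
      unfolding inner_preserving_def carrier_tensor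
      by (auto simp: M tensor_inner simp del: Image_singleton_iff)
  next
    fix x y assume "x \<in> X" "y \<in> Y"
    then have "set [(x, y)] \<subseteq> X \<times> Y" by simp
    then show "M (elementary_tensor BX BY x y) = x o\<^sub>L y"
      unfolding elementary_tensor_def by (simp add: M constant_tensor del: Image_singleton_iff)
  qed
qed

text \<open>Additivity fixes a multiplication map on finite sums of elementary tensors.  If \<open>T\<close> and \<open>T'\<close>
  are its value and the limit of products on the class of \<open>s\<close>, then preservation of inner products
  gives \<open>T\<^sup>* T = T'\<^sup>* T'\<close> and \<open>T\<^sup>* R = T'\<^sup>* R\<close> for every sum of products \<open>R\<close>, hence for the limit
  \<open>R = T'\<close>; so \<open>(T - T')\<^sup>* (T - T') = 0\<close>, and the C*-identity gives \<open>T = T'\<close>.\<close>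

theorem multiplication_unique:
  assumes M: "is_multiplication M" and s: "s \<in> cauchy_tensors"
  shows "M (ft_class BX BY s) = product_limit s"
proof -
  have carr: "ft_class BX BY t \<in> bm_carrier (tensor BX BY)" if "t \<in> cauchy_tensors" for t
    using that by (simp add: carrier_tensor)
  have MZ: "M (ft_class BX BY t) \<in> Z" if "t \<in> cauchy_tensors" for t
    using M carr[OF that] by (auto simp: is_multiplication_def bimodule_linear_def)
  have add: "M (ft_class BX BY (\<lambda>n. t n @ t' n)) = M (ft_class BX BY t) + M (ft_class BX BY t')"
    if "t \<in> cauchy_tensors" "t' \<in> cauchy_tensors" for t t'
  proof -
    have "M (bm_add (tensor BX BY) (ft_class BX BY t) (ft_class BX BY t')) =
        M (ft_class BX BY t) + M (ft_class BX BY t')"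
      using M carr[OF that(1)] carr[OF that(2)]
      by (auto simp: is_multiplication_def bimodule_linear_def)
    then show ?thesis unfolding tensor_add[OF that] .
  qed
  have fin: "M (ft_class BX BY (\<lambda>_. t)) = sum_of_products t" if "set t \<subseteq> X \<times> Y" for t
    using that
  proof (induct t)
    case Nil
    have "(\<lambda>_. []) \<in> cauchy_tensors" by (rule constant_tensor) simp
    from add[OF this this] show ?case by simp
  next
    case (Cons a t)
    obtain x y where a: "a = (x, y)" by (cases a)
    with Cons.prems have xy: "x \<in> X" "y \<in> Y" and t: "set t \<subseteq> X \<times> Y" by auto
    have "M (ft_class BX BY (\<lambda>_. [(x, y)] @ t)) =
        M (ft_class BX BY (\<lambda>_. [(x, y)])) + M (ft_class BX BY (\<lambda>_. t))"
      by (rule add) (use xy t in \<open>auto intro!: constant_tensor\<close>)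
    also have "M (ft_class BX BY (\<lambda>_. [(x, y)])) = x o\<^sub>L y"
      using M xy unfolding is_multiplication_def elementary_tensor_def by auto
    finally show ?case
      using Cons.hyps[OF t] by (simp add: a)
  qed
  have inner: "op_star (M (ft_class BX BY t)) o\<^sub>L M (ft_class BX BY t') =
      op_star (product_limit t) o\<^sub>L product_limit t'"
    if t: "t \<in> cauchy_tensors" and t': "t' \<in> cauchy_tensors" for t t'
  proof -
    have "J (op_star (M (ft_class BX BY t)) o\<^sub>L M (ft_class BX BY t')) =
        J (op_star (product_limit t) o\<^sub>L product_limit t')"
      using M carr[OF t] carr[OF t']
      by (simp add: is_multiplication_def inner_preserving_def tensor_inner[OF t t']
          del: Image_singleton_iff)
    from arg_cong[OF this, of I] show ?thesis
      by (simp only: I_J Z_inner MZ t t' product_limit_in)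
  qed
  define T where "T = M (ft_class BX BY s)"
  define T' where "T' = product_limit s"
  have adj: "adjointable T" "adjointable T'"
    using MZ[OF s] product_limit_in[OF s] Z_adjointable by (auto simp: T_def T'_def)
  have lim: "(\<lambda>n. R o\<^sub>L sum_of_products (s n)) \<longlonglongrightarrow> (R o\<^sub>L T')" for R :: "'a operator"
    unfolding T'_def
    by (intro bounded_bilinear.tendsto[OF bounded_bilinear_blinfun_compose] tendsto_const
        tendsto_product_limit s)
  have "op_star T o\<^sub>L sum_of_products (s n) = op_star T' o\<^sub>L sum_of_products (s n)" for n
  proof -
    have n: "set (s n) \<subseteq> X \<times> Y" using s by (simp add: cauchy_tensors_iff)
    from inner[OF s constant_tensor(1)[OF n]] show ?thesis
      by (simp add: T_def T'_def fin[OF n] constant_tensor(2)[OF n] del: Image_singleton_iff)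
  qed
  with lim[of "op_star T"] lim[of "op_star T'"] have 1: "op_star T o\<^sub>L T' = op_star T' o\<^sub>L T'"
    by (metis (no_types, lifting) LIMSEQ_unique ext)
  then have 2: "op_star T' o\<^sub>L T = op_star T' o\<^sub>L T'"
    by (metis adj adjointable_op_star op_star_compose op_star_op_star)
  have 3: "op_star T o\<^sub>L T = op_star T' o\<^sub>L T'"
    using inner[OF s s] by (simp add: T_def T'_def)
  have "op_star (T - T') o\<^sub>L (T - T') = 0"
    using adj by (simp add: op_star_diff blinfun_compose_minus_left blinfun_compose_minus_right 1 2 3)
  with C_star_identity[OF adjointable_diff[OF adj]] have "T = T'" by simp
  then show ?thesis by (simp add: T_def T'_def)
qed

text \<open>Surjectivity onto \<open>Z\<close> thus becomes the question whether the sums of products are dense in \<open>Z\<close>.\<close>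

corollary multiplication_image:
  assumes "is_multiplication M"
  shows "M ` bm_carrier (tensor BX BY) = closure (sum_of_products ` {s. set s \<subseteq> X \<times> Y})"
proof -
  have "M ` bm_carrier (tensor BX BY) = product_limit ` cauchy_tensors"
    unfolding carrier_tensor image_image
    by (intro image_cong refl multiplication_unique assms)
  also have "\<dots> = closure (sum_of_products ` {s. set s \<subseteq> X \<times> Y})"
  proof (intro Set.set_eqI iffI)
    fix z assume "z \<in> product_limit ` cauchy_tensors"
    then obtain s where s: "s \<in> cauchy_tensors" "z = product_limit s" by blast
    then show "z \<in> closure (sum_of_products ` {s. set s \<subseteq> X \<times> Y})"
      unfolding closure_sequential using tendsto_product_limit[OF s(1)]
      by (intro exI[of _ "\<lambda>n. sum_of_products (s n)"]) (auto simp: cauchy_tensors_iff)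
  next
    fix z assume "z \<in> closure (sum_of_products ` {s. set s \<subseteq> X \<times> Y})"
    then obtain w where w: "\<And>n. w n \<in> sum_of_products ` {s. set s \<subseteq> X \<times> Y}" "w \<longlonglongrightarrow> z"
      unfolding closure_sequential by blast
    then have "\<forall>n. \<exists>s. set s \<subseteq> X \<times> Y \<and> w n = sum_of_products s" by blast
    from choice[OF this] obtain s
      where s: "\<And>n. set (s n) \<subseteq> X \<times> Y" "w = (\<lambda>n. sum_of_products (s n))" by blast
    have "s \<in> cauchy_tensors" "product_limit s = z"
      using cauchy_tensorsI[of s z] s(1) w(2) unfolding s(2) by auto
    then show "z \<in> product_limit ` cauchy_tensors" by blast
  qed
  finally show ?thesis .
qed

end

section \<open>Compactly supported functions on a locally compact etale groupoid\<close>

subsection \<open>Continuous complex functions\<close>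

lemma continuous_map_binop:
  fixes \<phi> :: "complex \<times> complex \<Rightarrow> complex"
  assumes "continuous_map X euclidean f" "continuous_map X euclidean g" "continuous_on UNIV \<phi>"
  shows "continuous_map X euclidean (\<lambda>x. \<phi> (f x, g x))"
proof -
  have "continuous_map X (prod_topology euclidean euclidean) (\<lambda>x. (f x, g x))"
    using assms by (simp only: continuous_map_paired)
  then have "continuous_map X euclidean (\<lambda>x. (f x, g x))"
    by (simp only: prod_topology_euclidean)
  then have "continuous_map X euclidean (\<phi> \<circ> (\<lambda>x. (f x, g x)))"
    by (rule continuous_map_compose) (simp add: assms(3))
  then show ?thesis by (simp add: o_def)
qed

lemma continuous_map_complex_add:
  fixes f g :: "'x \<Rightarrow> complex"
  assumes "continuous_map X euclidean f" "continuous_map X euclidean g"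
  shows "continuous_map X euclidean (\<lambda>x. f x + g x)"
  using continuous_map_binop[OF assms, of "\<lambda>(a, b). a + b"]
  by (simp add: case_prod_unfold continuous_intros)

lemma continuous_map_complex_mult:
  fixes f g :: "'x \<Rightarrow> complex"
  assumes "continuous_map X euclidean f" "continuous_map X euclidean g"
  shows "continuous_map X euclidean (\<lambda>x. f x * g x)"
  using continuous_map_binop[OF assms, of "\<lambda>(a, b). a * b"]
  by (simp add: case_prod_unfold continuous_intros)

lemma continuous_map_complex_cnj:
  assumes "continuous_map X euclidean f"
  shows "continuous_map X euclidean (\<lambda>x. cnj (f x))"
  using continuous_map_binop[OF assms assms, of "\<lambda>(a, b). cnj a"]
  by (simp add: case_prod_unfold continuous_intros)

lemma continuous_map_complex_sum:
  fixes f :: "'i \<Rightarrow> 'x \<Rightarrow> complex"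
  assumes "\<And>i. i \<in> I \<Longrightarrow> continuous_map X euclidean (f i)"
  shows "continuous_map X euclidean (\<lambda>x. \<Sum>i\<in>I. f i x)"
  using assms by (induct I rule: infinite_finite_induct) (auto intro: continuous_map_complex_add)

lemma continuous_map_complex_inverse:
  fixes f :: "'x \<Rightarrow> complex"
  assumes "continuous_map X euclidean f" and "\<And>x. x \<in> topspace X \<Longrightarrow> f x \<noteq> 0"
  shows "continuous_map X euclidean (\<lambda>x. inverse (f x))"
proof -
  have "continuous_map X (top_of_set (- {0})) f"
    using assms by (auto simp: continuous_map_in_subtopology)
  moreover have "continuous_map (top_of_set (- {0})) euclidean (inverse :: complex \<Rightarrow> complex)"
    by (auto intro!: continuous_intros)
  ultimately have "continuous_map X euclidean (inverse \<circ> f)"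
    by (rule continuous_map_compose)
  then show ?thesis by (simp add: o_def)
qed

lemma continuous_map_locally:
  assumes "\<And>x. x \<in> topspace X \<Longrightarrow> \<exists>U. openin X U \<and> x \<in> U \<and> continuous_map (subtopology X U) Y f"
  shows "continuous_map X Y f"
proof -
  let ?I = "{U. openin X U \<and> continuous_map (subtopology X U) Y f}"
  show ?thesis
    by (rule pasting_lemma[where I = ?I and T = id and f = "\<lambda>_. f"]) (use assms in auto)
qed

subsection \<open>Local homeomorphisms\<close>

lemma local_homeomorphism_continuous:
  assumes "local_homeomorphism_map X Y f"
  shows "continuous_map X Y f"
proof (rule continuous_map_locally)
  fix x assume "x \<in> topspace X"
  then obtain U where "openin X U" "x \<in> U"
    and h: "homeomorphic_map (subtopology X U) (subtopology Y (f ` U)) f"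
    using assms unfolding local_homeomorphism_map_def by blast
  moreover have "continuous_map (subtopology X U) Y f"
    using homeomorphic_imp_continuous_map[OF h] by (simp add: continuous_map_in_subtopology)
  ultimately show "\<exists>U. openin X U \<and> x \<in> U \<and> continuous_map (subtopology X U) Y f" by blast
qed

lemma local_homeomorphism_open:
  assumes "local_homeomorphism_map X Y f" and O: "openin X V"
  shows "openin Y (f ` V)"
  unfolding openin_subopen[of Y "f ` V"]
proof
  fix y assume "y \<in> f ` V"
  then obtain x where x: "x \<in> V" "y = f x" by blast
  then have "x \<in> topspace X" using O openin_subset by blast
  then obtain U where U: "openin X U" "x \<in> U" "openin Y (f ` U)"
    and h: "homeomorphic_map (subtopology X U) (subtopology Y (f ` U)) f"
    using assms(1) unfolding local_homeomorphism_map_def by blast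
  have "openin (subtopology X U) (V \<inter> U)" using O by (rule openin_subtopology_Int)
  then have "openin (subtopology Y (f ` U)) (f ` (V \<inter> U))"
    using homeomorphic_imp_open_map[OF h] by (simp add: open_map_def)
  then have "openin Y (f ` (V \<inter> U))" using U(3) openin_trans_full by blast
  then show "\<exists>T. openin Y T \<and> y \<in> T \<and> T \<subseteq> f ` V" using x U by blast
qed

lemma local_homeomorphism_inj:
  assumes "local_homeomorphism_map X Y f" "x \<in> topspace X"
  shows "\<exists>U. openin X U \<and> x \<in> U \<and> inj_on f U"
proof -
  obtain U where U: "openin X U" "x \<in> U"
    and h: "homeomorphic_map (subtopology X U) (subtopology Y (f ` U)) f"
    using assms unfolding local_homeomorphism_map_def by blast
  have "inj_on f U"
    using homeomorphic_imp_injective_map[OF h] openin_subset[OF U(1)]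
    by (simp add: Int_absorb1)
  with U show ?thesis by blast
qed

subsection \<open>Groupoid algebra\<close>

context groupoid
begin

lemma composable_iff: "(x, y) \<in> composable G \<longleftrightarrow> x \<in> arrows G \<and> y \<in> arrows G \<and> src G x = rng G y"
  by (simp add: composable_def)

lemma ginv_ginv:
  assumes x: "x \<in> arrows G"
  shows "ginv G (ginv G x) = x"
proof -
  let ?y = "ginv G x"
  have y: "?y \<in> arrows G" "ginv G ?y \<in> arrows G" using x by (simp_all add: ginv_closed)
  have "gmul G (gmul G (ginv G ?y) ?y) x = gmul G (ginv G ?y) (gmul G ?y x)"
    using x y by (intro gmul_assoc) (simp_all add: composable_iff src_ginv rng_ginv)
  then show ?thesis
    using x y by (simp add: ginv_gmul src_ginv gmul_rng) (metis gmul_src rng_ginv src_ginv)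
qed

lemma gmul_ginv_cancel:
  assumes "y \<in> arrows G" "x \<in> arrows G" "rng G y = rng G x"
  shows "gmul G y (gmul G (ginv G y) x) = x"
  using assms gmul_assoc[of y "ginv G y" x]
  by (simp add: composable_iff ginv_closed src_ginv rng_ginv gmul_ginv gmul_rng)

lemma ginv_gmul_cancel:
  assumes "(y, x) \<in> composable G"
  shows "gmul G (ginv G y) (gmul G y x) = x"
  using assms gmul_assoc[of "ginv G y" y x]
  by (simp add: composable_iff ginv_closed src_ginv rng_ginv ginv_gmul gmul_rng)

lemma gmul_ginv_cancel_right:
  assumes "(x, y) \<in> composable G"
  shows "gmul G (gmul G x y) (ginv G y) = x"
  using assms gmul_assoc[of x y "ginv G y"]
  by (simp add: composable_iff ginv_closed src_ginv rng_ginv gmul_ginv) (metis gmul_src)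

lemma left_quotient:
  assumes "y \<in> arrows G" "x \<in> arrows G" "rng G y = rng G x"
  shows "gmul G (ginv G y) x \<in> arrows G" "src G (gmul G (ginv G y) x) = src G x"
    "rng G (gmul G (ginv G y) x) = src G y"
  using assms by (simp_all add: composable_iff ginv_closed src_ginv rng_ginv gmul_closed src_gmul rng_gmul)

lemma right_quotient:
  assumes "y \<in> arrows G" "x \<in> arrows G" "src G y = src G x"
  shows "gmul G x (ginv G y) \<in> arrows G" "rng G (gmul G x (ginv G y)) = rng G x"
    "src G (gmul G x (ginv G y)) = rng G y" "gmul G (gmul G x (ginv G y)) y = x"
proof -
  show "gmul G x (ginv G y) \<in> arrows G" "rng G (gmul G x (ginv G y)) = rng G x"
    "src G (gmul G x (ginv G y)) = rng G y"
    using assms by (simp_all add: composable_iff ginv_closed src_ginv rng_ginv gmul_closed src_gmul rng_gmul)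
  show "gmul G (gmul G x (ginv G y)) y = x"
    using assms gmul_assoc[of x "ginv G y" y]
    by (simp add: composable_iff ginv_closed src_ginv rng_ginv ginv_gmul) (metis gmul_src)
qed

lemma ginv_eqI:
  assumes "(x, y) \<in> composable G" "gmul G x y = rng G x"
  shows "ginv G x = y"
proof -
  have "gmul G (ginv G x) (gmul G x y) = y" by (rule ginv_gmul_cancel[OF assms(1)])
  then show ?thesis
    using assms by (simp add: composable_iff) (metis gmul_src ginv_closed src_ginv)
qed

lemma ginv_mult:
  assumes "(x, y) \<in> composable G"
  shows "ginv G (gmul G x y) = gmul G (ginv G y) (ginv G x)"
proof (rule ginv_eqI)
  have *: "x \<in> arrows G" "y \<in> arrows G" "src G x = rng G y"
    using assms by (simp_all add: composable_iff)
  then have c: "(ginv G y, ginv G x) \<in> composable G"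
    by (simp add: composable_iff ginv_closed src_ginv rng_ginv)
  show 1: "(gmul G x y, gmul G (ginv G y) (ginv G x)) \<in> composable G"
    using * c assms by (simp add: composable_iff gmul_closed src_gmul rng_gmul rng_ginv ginv_closed src_ginv)
  have "gmul G (gmul G x y) (gmul G (ginv G y) (ginv G x)) =
      gmul G (gmul G (gmul G x y) (ginv G y)) (ginv G x)"
    using * c assms
    by (intro gmul_assoc[symmetric]) (simp_all add: composable_iff gmul_closed src_gmul rng_ginv ginv_closed src_ginv)
  then show "gmul G (gmul G x y) (gmul G (ginv G y) (ginv G x)) = rng G (gmul G x y)"
    using * assms by (simp add: gmul_ginv_cancel_right gmul_ginv rng_gmul)
qed

end

subsection \<open>Bump functions and partitions\<close>

locale lch_etale_groupoid = etale_groupoid +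
  assumes locally_compact: "locally_compact_space (gtop G)"
    and Hausdorff: "Hausdorff_space (gtop G)"
begin

lemma topspace_gtop [simp]: "topspace (gtop G) = arrows G"
  by (simp add: arrows_def)

lemma openin_arrows: "openin (gtop G) U \<Longrightarrow> U \<subseteq> arrows G"
  using openin_subset by fastforce

lemma compactin_arrows: "compactin (gtop G) K \<Longrightarrow> K \<subseteq> arrows G"
  using compactin_subset_topspace by fastforce

lemma compactin_closedin: "compactin (gtop G) K \<Longrightarrow> closedin (gtop G) K"
  by (rule compactin_imp_closedin[OF Hausdorff])

lemma continuous_rng: "continuous_map (gtop G) (gtop G) (rng G)"
  using local_homeomorphism_continuous[OF local_homeomorphism_rng]
  by (simp add: continuous_map_in_subtopology)

lemma continuous_src: "continuous_map (gtop G) (gtop G) (src G)"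
  using local_homeomorphism_continuous[OF local_homeomorphism_src]
  by (simp add: continuous_map_in_subtopology)

text \<open>In a Hausdorff space the support of a function that vanishes off a compact set is closed in it and
  so compact itself; any compact set that contains the points where \<open>f\<close> is nonzero serves as a witness.\<close>

lemma Cc_iff:
  "f \<in> Cc G \<longleftrightarrow> continuous_map (gtop G) euclidean f \<and>
    (\<exists>K. compactin (gtop G) K \<and> (\<forall>x. f x \<noteq> 0 \<longrightarrow> x \<in> K))"
proof
  assume f: "f \<in> Cc G"
  have "x \<in> gsupp G f" if "f x \<noteq> 0" for x
  proof -
    have "x \<in> {x \<in> arrows G. f x \<noteq> 0}" using f that by (auto simp: Cc_def)
    then show ?thesis
      using closure_of_subset[of "{x \<in> arrows G. f x \<noteq> 0}" "gtop G"] by (auto simp: gsupp_def)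
  qed
  with f show "continuous_map (gtop G) euclidean f \<and>
      (\<exists>K. compactin (gtop G) K \<and> (\<forall>x. f x \<noteq> 0 \<longrightarrow> x \<in> K))"
    unfolding Cc_def by blast
next
  assume "continuous_map (gtop G) euclidean f \<and>
    (\<exists>K. compactin (gtop G) K \<and> (\<forall>x. f x \<noteq> 0 \<longrightarrow> x \<in> K))"
  then obtain K where f: "continuous_map (gtop G) euclidean f" and K: "compactin (gtop G) K"
    and fK: "\<And>x. f x \<noteq> 0 \<Longrightarrow> x \<in> K" by blast
  have "gsupp G f \<subseteq> K"
    unfolding gsupp_def by (rule closure_of_minimal) (use fK compactin_closedin[OF K] in auto)
  then have "compactin (gtop G) (gsupp G f)"
    by (rule closed_compactin[OF K]) (simp add: gsupp_def)
  moreover have "f x = 0" if "x \<notin> arrows G" for x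
    using that fK compactin_arrows[OF K] by blast
  ultimately show "f \<in> Cc G" using f by (simp add: Cc_def)
qed

lemma CcI:
  "continuous_map (gtop G) euclidean f \<Longrightarrow> compactin (gtop G) K \<Longrightarrow>
    (\<And>x. f x \<noteq> 0 \<Longrightarrow> x \<in> K) \<Longrightarrow> f \<in> Cc G"
  unfolding Cc_iff by blast

lemma Cc_continuous: "f \<in> Cc G \<Longrightarrow> continuous_map (gtop G) euclidean f"
  by (simp add: Cc_def)

lemma Cc_arrows: "f \<in> Cc G \<Longrightarrow> f x \<noteq> 0 \<Longrightarrow> x \<in> arrows G"
  by (auto simp: Cc_def)

lemma Cc_support:
  assumes "f \<in> Cc G"
  obtains K where "compactin (gtop G) K" "\<And>x. f x \<noteq> 0 \<Longrightarrow> x \<in> K"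
  using assms unfolding Cc_iff by blast

lemma gsupp_Cc: "f \<in> Cc G \<Longrightarrow> f x \<noteq> 0 \<Longrightarrow> x \<in> gsupp G f"
  using closure_of_subset[of "{x \<in> arrows G. f x \<noteq> 0}" "gtop G"] by (auto simp: gsupp_def Cc_def)

lemma Cc_zero: "(\<lambda>_. 0) \<in> Cc G"
  by (rule CcI[where K = "{}"]) auto

lemma Cc_add:
  assumes f: "f \<in> Cc G" and g: "g \<in> Cc G"
  shows "(\<lambda>x. f x + g x) \<in> Cc G"
proof -
  obtain K L where K: "compactin (gtop G) K" "\<And>x. f x \<noteq> 0 \<Longrightarrow> x \<in> K"
    and L: "compactin (gtop G) L" "\<And>x. g x \<noteq> 0 \<Longrightarrow> x \<in> L"
    using f g Cc_support by metis
  show ?thesis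
  proof (rule CcI[where K = "K \<union> L"])
    show "x \<in> K \<union> L" if "f x + g x \<noteq> 0" for x
      using that K(2)[of x] L(2)[of x] by (cases "f x = 0") auto
  qed (use K L in \<open>auto intro: continuous_map_complex_add Cc_continuous f g compactin_Un\<close>)
qed

lemma Cc_mult:
  assumes f: "continuous_map (gtop G) euclidean f" and g: "g \<in> Cc G"
  shows "(\<lambda>x. f x * g x) \<in> Cc G"
proof -
  obtain L where L: "compactin (gtop G) L" "\<And>x. g x \<noteq> 0 \<Longrightarrow> x \<in> L"
    using Cc_support[OF g] by blast
  show ?thesis
    by (rule CcI[where K = L])
      (use L in \<open>auto intro: continuous_map_complex_mult Cc_continuous f g\<close>)
qed

lemma Cc_sum: "(\<And>i. i \<in> I \<Longrightarrow> f i \<in> Cc G) \<Longrightarrow> (\<lambda>x. \<Sum>i\<in>I. f i x) \<in> Cc G"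
  by (induct I rule: infinite_finite_induct) (auto intro: Cc_add Cc_zero)

lemma Cc_scale: "f \<in> Cc G \<Longrightarrow> (\<lambda>x. z * f x) \<in> Cc G"
  by (rule Cc_mult) auto

text \<open>Near a zero of \<open>k\<close> the function \<open>f\<close> vanishes identically, so the convention \<open>x / 0 = 0\<close> gives the
  continuous extension of the quotient.\<close>

lemma Cc_divide:
  assumes f: "f \<in> Cc G" and k: "continuous_map (gtop G) euclidean k"
    and nz: "\<And>x. x \<in> gsupp G f \<Longrightarrow> k x \<noteq> 0"
  shows "(\<lambda>x. f x / k x) \<in> Cc G"
proof -
  have "continuous_map (gtop G) euclidean (\<lambda>x. f x / k x)"
  proof (rule continuous_map_locally)
    fix x assume x: "x \<in> topspace (gtop G)"
    show "\<exists>U. openin (gtop G) U \<and> x \<in> U \<and> continuous_map (subtopology (gtop G) U) euclidean (\<lambda>x. f x / k x)"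
    proof (cases "k x = 0")
      case True
      let ?U = "arrows G - gsupp G f"
      have "closedin (gtop G) (gsupp G f)" by (simp add: gsupp_def)
      then have "openin (gtop G) ?U" by (simp add: closedin_def)
      moreover have "continuous_map (subtopology (gtop G) ?U) euclidean (\<lambda>x. f x / k x)"
        by (rule continuous_map_eq[where f = "\<lambda>_. 0"]) (use gsupp_Cc[OF f] in auto)
      ultimately show ?thesis using True nz x by (intro exI[of _ ?U]) auto
    next
      case False
      let ?U = "{x \<in> topspace (gtop G). k x \<in> - {0}}"
      have "openin (gtop G) ?U"
        by (rule openin_continuous_map_preimage[OF k]) auto
      moreover have "continuous_map (subtopology (gtop G) ?U) euclidean (\<lambda>x. f x * inverse (k x))"
        by (intro continuous_map_complex_mult continuous_map_complex_inverse
            continuous_map_from_subtopology Cc_continuous f k) auto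
      ultimately show ?thesis using False x by (intro exI[of _ ?U]) (auto simp: divide_inverse)
    qed
  qed
  moreover obtain K where "compactin (gtop G) K" "\<And>x. f x \<noteq> 0 \<Longrightarrow> x \<in> K"
    using Cc_support[OF f] by blast
  ultimately show ?thesis by (intro CcI[where K = K]) auto
qed

text \<open>Complete regularity separates \<open>x\<close> from the complement of a neighbourhood that local compactness
  places inside a compact subset of \<open>U\<close>.\<close>

lemma bump_function:
  assumes "openin (gtop G) U" "x \<in> U"
  shows "\<exists>f\<in>Cc G. f x \<noteq> 0 \<and> (\<exists>K. compactin (gtop G) K \<and> K \<subseteq> U \<and> (\<forall>y. f y \<noteq> 0 \<longrightarrow> y \<in> K))"
proof -
  have "neighbourhood_base_of (\<lambda>C. compactin (gtop G) C \<and> closedin (gtop G) C) (gtop G)"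
    using locally_compact_space_neighbourhood_base_closedin locally_compact Hausdorff by blast
  then obtain V K where V: "openin (gtop G) V" "x \<in> V" "V \<subseteq> K" "K \<subseteq> U"
    and K: "compactin (gtop G) K"
    using assms unfolding neighbourhood_base_of by meson
  have "regular_space (gtop G)"
    using locally_compact Hausdorff locally_compact_Hausdorff_imp_regular_space by blast
  then have "completely_regular_space (gtop G)"
    using completely_regular_eq_regular_space[OF locally_compact] by simp
  moreover have "closedin (gtop G) (arrows G - V)" "x \<in> topspace (gtop G) - (arrows G - V)"
    using V openin_arrows[OF V(1)] openin_arrows[OF assms(1)] by (auto simp: closedin_def Diff_Diff_Int Int_absorb1)
  ultimately obtain b where b: "continuous_map (gtop G) euclideanreal b" "b x = 0"
    "b ` (arrows G - V) \<subseteq> {1}"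
    unfolding completely_regular_space_alt by blast
  define f where "f y = (if y \<in> arrows G then complex_of_real (1 - b y) else 0)" for y
  have "continuous_map (gtop G) euclidean ((\<lambda>r. complex_of_real (1 - r)) \<circ> b)"
    by (rule continuous_map_compose[OF b(1)]) (auto intro!: continuous_intros)
  then have "continuous_map (gtop G) euclidean f"
    by (rule continuous_map_eq) (simp add: f_def)
  moreover have fK: "y \<in> K" if "f y \<noteq> 0" for y
    using that b(3) V(3) by (auto simp: f_def split: if_splits)
  ultimately have "f \<in> Cc G" using K by (auto intro: CcI)
  moreover have "f x \<noteq> 0" using b(2) V openin_arrows[OF V(1)] by (auto simp: f_def)
  ultimately show ?thesis using fK K V by blast
qed

text \<open>If the functions \<open>h \<in> S\<close> have no common zero in the support of \<open>f\<close>, then by compactness finitely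
  many of them already have none, and \<open>F h = f h\<^sup>* / (\<Sum>h. \<bar>h\<bar>\<^sup>2)\<close>, with the complex conjugate \<open>h\<^sup>*\<close>,
  solves \<open>f = (\<Sum>h. F h h)\<close>.  With bump functions for \<open>h\<close> this is a partition of unity; with
  convolutions for \<open>h\<close> it yields factorizations.\<close>

lemma Cc_decompose:
  assumes f: "f \<in> Cc G" and S: "\<And>h. h \<in> S \<Longrightarrow> continuous_map (gtop G) euclidean h"
    and nz: "\<And>x. x \<in> gsupp G f \<Longrightarrow> \<exists>h\<in>S. h x \<noteq> 0"
  shows "\<exists>S' F. finite S' \<and> S' \<subseteq> S \<and> (\<forall>h\<in>S'. F h \<in> Cc G) \<and>
    (\<forall>h x. F h x \<noteq> 0 \<longrightarrow> f x \<noteq> 0 \<and> h x \<noteq> 0) \<and> f = (\<lambda>x. \<Sum>h\<in>S'. F h x * h x)"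
proof -
  define W where "W h = {x \<in> topspace (gtop G). h x \<in> - {0 :: complex}}" for h
  have "compactin (gtop G) (gsupp G f)" using f by (simp add: Cc_def)
  moreover have "openin (gtop G) U" if "U \<in> W ` S" for U
    using that S unfolding W_def
    by (auto simp del: topspace_gtop Compl_iff intro!: openin_continuous_map_preimage)
  moreover have "gsupp G f \<subseteq> \<Union> (W ` S)"
  proof
    fix x assume x: "x \<in> gsupp G f"
    then have "x \<in> arrows G" using closure_of_subset_topspace[of "gtop G"] by (auto simp: gsupp_def)
    with nz[OF x] show "x \<in> \<Union> (W ` S)" by (auto simp: W_def)
  qed
  ultimately obtain \<F> where "finite \<F>" "\<F> \<subseteq> W ` S" and cov: "gsupp G f \<subseteq> \<Union> \<F>"
    unfolding compactin_def by meson
  then obtain S' where S': "S' \<subseteq> S" "finite S'" "\<F> = W ` S'"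
    using finite_subset_image by metis
  define \<kappa> where "\<kappa> x = (\<Sum>h\<in>S'. h x * cnj (h x))" for x
  have \<kappa>: "continuous_map (gtop G) euclidean \<kappa>"
    unfolding \<kappa>_def using S S'(1)
    by (intro continuous_map_complex_sum continuous_map_complex_mult continuous_map_complex_cnj) auto
  have \<kappa>_nz: "\<kappa> x \<noteq> 0" if "x \<in> gsupp G f" for x
  proof -
    from that cov S' obtain h where h: "h \<in> S'" "h x \<noteq> 0" by (auto simp: W_def)
    have "\<kappa> x = complex_of_real (\<Sum>h\<in>S'. (cmod (h x))\<^sup>2)"
      by (simp add: \<kappa>_def complex_norm_square[symmetric])
    moreover have "(\<Sum>h\<in>S'. (cmod (h x))\<^sup>2) > 0"
      by (rule sum_pos2[OF S'(2) h(1)]) (use h in auto)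
    ultimately show ?thesis by (simp only: of_real_eq_0_iff)
  qed
  define F where "F h x = cnj (h x) * (f x / \<kappa> x)" for h x
  show ?thesis
  proof (intro exI conjI)
    show "\<forall>h\<in>S'. F h \<in> Cc G"
      unfolding F_def using S S'(1)
      by (intro ballI Cc_mult Cc_divide f \<kappa> \<kappa>_nz continuous_map_complex_cnj) auto
    show "\<forall>h x. F h x \<noteq> 0 \<longrightarrow> f x \<noteq> 0 \<and> h x \<noteq> 0" by (simp add: F_def)
    show "f = (\<lambda>x. \<Sum>h\<in>S'. F h x * h x)"
    proof
      fix x
      have "(\<Sum>h\<in>S'. F h x * h x) = \<kappa> x * (f x / \<kappa> x)"
        unfolding F_def \<kappa>_def sum_distrib_right by (simp add: mult_ac)
      also have "\<dots> = f x" using \<kappa>_nz gsupp_Cc[OF f] by (cases "f x = 0") auto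
      finally show "f x = (\<Sum>h\<in>S'. F h x * h x)" by simp
    qed
  qed (use S' in auto)
qed

subsection \<open>Bisections\<close>

definition bisection :: "'a set \<Rightarrow> bool" where
  "bisection U \<longleftrightarrow> openin (gtop G) U \<and> inj_on (rng G) U \<and> inj_on (src G) U"

lemma bisection_exists:
  assumes "x \<in> arrows G"
  shows "\<exists>U. bisection U \<and> x \<in> U"
proof -
  obtain U V where "openin (gtop G) U" "x \<in> U" "inj_on (rng G) U"
    "openin (gtop G) V" "x \<in> V" "inj_on (src G) V"
    using local_homeomorphism_inj[OF local_homeomorphism_rng, of x]
      local_homeomorphism_inj[OF local_homeomorphism_src, of x] assms by auto
  then have "bisection (U \<inter> V) \<and> x \<in> U \<inter> V"
    unfolding bisection_def by (auto intro: openin_Int inj_on_subset)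
  then show ?thesis by blast
qed

lemma bisection_subset: "bisection U \<Longrightarrow> openin (gtop G) V \<Longrightarrow> V \<subseteq> U \<Longrightarrow> bisection V"
  unfolding bisection_def by (blast intro: inj_on_subset)

definition bisection_supported :: "('a \<Rightarrow> complex) \<Rightarrow> bool" where
  "bisection_supported f \<longleftrightarrow> f \<in> Cc G \<and>
    (\<exists>U K. bisection U \<and> compactin (gtop G) K \<and> K \<subseteq> U \<and> (\<forall>x. f x \<noteq> 0 \<longrightarrow> x \<in> K))"

text \<open>A convolution by a function carried by a bisection has at most one nonzero summand at each point,
  so properties that are stable under addition are best proved for such functions.\<close>

lemma Cc_induct [consumes 1, case_names bisection add]:
  assumes f: "f \<in> Cc G" and bis: "\<And>f. bisection_supported f \<Longrightarrow> P f"
    and add: "\<And>f g. f \<in> Cc G \<Longrightarrow> g \<in> Cc G \<Longrightarrow> P f \<Longrightarrow> P g \<Longrightarrow> P (\<lambda>x. f x + g x)"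
  shows "P f"
proof -
  have nz: "\<exists>h\<in>Collect bisection_supported. h x \<noteq> 0" if "x \<in> gsupp G f" for x
  proof -
    have "x \<in> arrows G"
      using that closure_of_subset_topspace[of "gtop G"] by (auto simp: gsupp_def)
    then obtain U where "bisection U" "x \<in> U" using bisection_exists by blast
    with bump_function[of U x] show ?thesis
      unfolding bisection_supported_def bisection_def by blast
  qed
  have cont: "continuous_map (gtop G) euclidean h" if "h \<in> Collect bisection_supported" for h
    using that by (auto simp: bisection_supported_def intro: Cc_continuous)
  obtain S' F where S': "finite S'" "S' \<subseteq> Collect bisection_supported"
    and F: "\<And>h. h \<in> S' \<Longrightarrow> F h \<in> Cc G" "f = (\<lambda>x. \<Sum>h\<in>S'. F h x * h x)"
    using Cc_decompose[OF f cont nz] by auto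
  have one: "bisection_supported (\<lambda>x. F h x * h x)" if "h \<in> S'" for h
  proof -
    from that S' have h: "bisection_supported h" by blast
    then have "(\<lambda>x. F h x * h x) \<in> Cc G"
      using F(1)[OF that] by (auto simp: bisection_supported_def intro: Cc_mult Cc_continuous)
    with h show ?thesis unfolding bisection_supported_def by (metis mult_zero_right)
  qed
  have zero: "bisection_supported (\<lambda>_. 0)"
    unfolding bisection_supported_def using Cc_zero by (auto simp: bisection_def intro!: exI[of _ "{}"])
  have "P (\<lambda>x. \<Sum>h\<in>T. F h x * h x) \<and> (\<lambda>x. \<Sum>h\<in>T. F h x * h x) \<in> Cc G" if "T \<subseteq> S'" for T
    using finite_subset[OF that S'(1)] that
  proof (induct T rule: finite_induct)
    case empty
    then show ?case by (simp add: bis zero Cc_zero)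
  next
    case (insert h T)
    then have h: "bisection_supported (\<lambda>x. F h x * h x)" by (simp add: one)
    then have "(\<lambda>x. F h x * h x) \<in> Cc G" by (simp add: bisection_supported_def)
    with insert bis[OF h] show ?case by (auto intro!: add Cc_add)
  qed
  then show ?thesis using F(2) by blast
qed

text \<open>The range map is open, so the arrow of a bisection with a given range depends continuously on
  this range.\<close>

lemma continuous_bisection_section:
  assumes U: "bisection U"
  defines "D \<equiv> {x \<in> arrows G. rng G x \<in> rng G ` U}"
  shows "openin (gtop G) D"
    and "continuous_map (subtopology (gtop G) D) (gtop G) (\<lambda>x. inv_into U (rng G) (rng G x))"
proof -
  have *: "openin (gtop G) {x \<in> arrows G. rng G x \<in> rng G ` V}" if "openin (gtop G) V" for V
    using openin_continuous_map_preimage[OF local_homeomorphism_continuous[OF local_homeomorphism_rng]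
        local_homeomorphism_open[OF local_homeomorphism_rng that]] by simp
  have oU: "openin (gtop G) U" and inj: "inj_on (rng G) U" using U by (auto simp: bisection_def)
  show "openin (gtop G) D" unfolding D_def by (rule *[OF oU])
  show "continuous_map (subtopology (gtop G) D) (gtop G) (\<lambda>x. inv_into U (rng G) (rng G x))"
    unfolding continuous_map_def
  proof (intro conjI allI impI)
    have "inv_into U (rng G) (rng G x) \<in> U" if "x \<in> D" for x
      using that inv_into_into[of "rng G x" "rng G" U] by (simp add: D_def)
    then show "(\<lambda>x. inv_into U (rng G) (rng G x)) \<in> topspace (subtopology (gtop G) D) \<rightarrow> topspace (gtop G)"
      using openin_arrows[OF oU] by auto
    fix V assume V: "openin (gtop G) V"
    have e: "{x \<in> topspace (subtopology (gtop G) D). inv_into U (rng G) (rng G x) \<in> V} =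
        D \<inter> {x \<in> arrows G. rng G x \<in> rng G ` (U \<inter> V)}"
      using inj by (auto simp: D_def inv_into_f_f dest: inj_onD)
    show "openin (subtopology (gtop G) D)
        {x \<in> topspace (subtopology (gtop G) D). inv_into U (rng G) (rng G x) \<in> V}"
      unfolding e by (intro openin_subtopology_Int2 * openin_Int oU V)
  qed
qed

subsection \<open>Convolution\<close>

text \<open>The arrows \<open>y\<close> that can contribute a nonzero summand \<open>f(y) h(y\<^sup>-\<^sup>1 x)\<close> to a convolution at \<open>x\<close>.\<close>

definition row :: "('a \<Rightarrow> complex) \<Rightarrow> 'a \<Rightarrow> 'a set" where
  "row f x = {y \<in> arrows G. rng G y = rng G x \<and> f y \<noteq> 0}"

lemma convolution_eq_sum:
  assumes "finite Y" "row f x \<subseteq> Y" "Y \<subseteq> {y \<in> arrows G. rng G y = rng G x}" "x \<in> arrows G"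
  shows "convolution G f h x = (\<Sum>y\<in>Y. f y * h (gmul G (ginv G y) x))"
proof -
  have "((\<lambda>y. f y * h (gmul G (ginv G y) x)) has_sum (\<Sum>y\<in>Y. f y * h (gmul G (ginv G y) x)))
      {y \<in> arrows G. rng G y = rng G x}"
    by (rule has_sum_finite_neutralI) (use assms in \<open>auto simp: row_def\<close>)
  then show ?thesis using assms(4) by (simp add: convolution_def infsumI)
qed

lemma convolution_bisection:
  assumes U: "bisection U" and f: "\<And>x. f x \<noteq> 0 \<Longrightarrow> x \<in> U"
  shows "convolution G f h x = (if x \<in> arrows G \<and> rng G x \<in> rng G ` U
    then f (inv_into U (rng G) (rng G x)) * h (gmul G (ginv G (inv_into U (rng G) (rng G x))) x) else 0)"
proof (cases "x \<in> arrows G \<and> rng G x \<in> rng G ` U")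
  case True
  let ?y = "inv_into U (rng G) (rng G x)"
  have y: "?y \<in> U" "rng G ?y = rng G x" using True by (auto intro: inv_into_into f_inv_into_f)
  have "row f x \<subseteq> {?y}" using f y U by (auto simp: row_def bisection_def inj_on_def)
  moreover have "?y \<in> arrows G" using y U by (auto simp: bisection_def dest: openin_arrows)
  ultimately show ?thesis using True y by (subst convolution_eq_sum[of "{?y}"]) auto
next
  case False
  show ?thesis
  proof (cases "x \<in> arrows G")
    case True
    with False have "rng G x \<notin> rng G ` U" by simp
    then have "f y = 0" if "rng G y = rng G x" for y
      using f[of y] imageI[of y U "rng G"] that by auto
    then have "row f x = {}" by (auto simp: row_def)
    with True False show ?thesis by (subst convolution_eq_sum[of "{}"]) auto
  qed (simp add: convolution_def)
qed

lemma finite_row: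
  assumes "f \<in> Cc G"
  shows "finite (row f x)"
  using assms
proof (induct rule: Cc_induct)
  case (bisection f)
  then obtain U where "inj_on (rng G) U" "\<And>x. f x \<noteq> 0 \<Longrightarrow> x \<in> U"
    unfolding bisection_supported_def bisection_def by blast
  then have "row f x \<subseteq> {inv_into U (rng G) (rng G x)}"
    by (auto simp: row_def) (metis inv_into_f_f)
  then show ?case by (rule finite_subset) simp
next
  case (add f g)
  have "row (\<lambda>x. f x + g x) x \<subseteq> row f x \<union> row g x" by (auto simp: row_def)
  with add show ?case by (blast intro: finite_subset)
qed

lemma convolution_row:
  "f \<in> Cc G \<Longrightarrow> x \<in> arrows G \<Longrightarrow>
    convolution G f h x = (\<Sum>y\<in>row f x. f y * h (gmul G (ginv G y) x))"
  by (rule convolution_eq_sum) (auto simp: finite_row, auto simp: row_def)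

lemma convolution_off_arrows: "x \<notin> arrows G \<Longrightarrow> convolution G f h x = 0"
  by (simp add: convolution_def)

lemma convolution_add_left:
  assumes "f \<in> Cc G" "g \<in> Cc G"
  shows "convolution G (\<lambda>x. f x + g x) h x = convolution G f h x + convolution G g h x"
proof (cases "x \<in> arrows G")
  case True
  let ?Y = "row f x \<union> row g x"
  have Y: "finite ?Y" "?Y \<subseteq> {y \<in> arrows G. rng G y = rng G x}"
    using assms by (auto simp: finite_row) (auto simp: row_def)
  have "row (\<lambda>x. f x + g x) x \<subseteq> ?Y" by (auto simp: row_def)
  then show ?thesis
    using Y True
    by (simp add: convolution_eq_sum[OF Y(1) _ Y(2) True] algebra_simps sum.distrib)
qed (simp add: convolution_off_arrows)

text \<open>Let \<open>f\<close> vanish off a compact subset \<open>K\<close> of a bisection \<open>U\<close>.  On the open set of arrows whose range lies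
  in \<open>r(U)\<close> the convolution is a single product of continuous functions, and it vanishes on the set of
  arrows whose range lies off the closed set \<open>r(K)\<close>; these two open sets cover the groupoid.  In
  the case \<open>h = 1\<close> the convolution sums the values of \<open>f\<close> over all arrows with a given range.\<close>

lemma continuous_convolution:
  assumes "f \<in> Cc G" and h: "continuous_map (gtop G) euclidean h"
  shows "continuous_map (gtop G) euclidean (convolution G f h)"
  using assms(1)
proof (induct rule: Cc_induct)
  case (bisection f)
  then obtain U K where f: "f \<in> Cc G" and U: "bisection U" and K: "compactin (gtop G) K" "K \<subseteq> U"
    and fK: "\<And>x. f x \<noteq> 0 \<Longrightarrow> x \<in> K"
    unfolding bisection_supported_def by blast
  then have fU: "\<And>x. f x \<noteq> 0 \<Longrightarrow> x \<in> U" by blast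
  define D where "D = {x \<in> arrows G. rng G x \<in> rng G ` U}"
  define y where "y x = inv_into U (rng G) (rng G x)" for x
  have D: "openin (gtop G) D"
    and y: "continuous_map (subtopology (gtop G) D) (gtop G) y"
    using continuous_bisection_section[OF U] by (simp_all add: D_def y_def[abs_def])
  have yU: "y x \<in> U" "rng G (y x) = rng G x" if "x \<in> D" for x
    using that by (auto simp: D_def y_def intro: inv_into_into f_inv_into_f)
  have UG: "U \<subseteq> arrows G" using U by (auto simp: bisection_def dest: openin_arrows)
  have *: "convolution G f h x = f (y x) * h (gmul G (ginv G (y x)) x)" if "x \<in> D" for x
    using that unfolding D_def y_def by (subst convolution_bisection[OF U fU]) auto
  show ?case
  proof (rule continuous_map_locally)
    fix x assume x: "x \<in> topspace (gtop G)"
    show "\<exists>V. openin (gtop G) V \<and> x \<in> V \<and> continuous_map (subtopology (gtop G) V) euclidean (convolution G f h)"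
    proof (cases "x \<in> D")
      case True
      have "continuous_map (subtopology (gtop G) D) (subtopology (prod_topology (gtop G) (gtop G)) (composable G))
          (\<lambda>x. (ginv G (y x), x))"
      proof (rule continuous_map_into_subtopology)
        show "continuous_map (subtopology (gtop G) D) (prod_topology (gtop G) (gtop G)) (\<lambda>x. (ginv G (y x), x))"
          using continuous_map_compose[OF y continuous_ginv]
          by (intro continuous_map_pairedI) (auto simp: o_def intro: continuous_map_from_subtopology)
        show "(\<lambda>x. (ginv G (y x), x)) \<in> topspace (subtopology (gtop G) D) \<rightarrow> composable G"
          using yU UG by (auto simp: composable_iff ginv_closed src_ginv D_def subset_iff)
      qed
      from continuous_map_compose[OF continuous_map_compose[OF this continuous_gmul] h]
      have "continuous_map (subtopology (gtop G) D) euclidean (\<lambda>x. h (gmul G (ginv G (y x)) x))"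
        by (simp add: o_def)
      moreover have "continuous_map (subtopology (gtop G) D) euclidean (\<lambda>x. f (y x))"
        using continuous_map_compose[OF y Cc_continuous[OF f]] by (simp add: o_def)
      ultimately have "continuous_map (subtopology (gtop G) D) euclidean
          (\<lambda>x. f (y x) * h (gmul G (ginv G (y x)) x))"
        by (intro continuous_map_complex_mult)
      then have "continuous_map (subtopology (gtop G) D) euclidean (convolution G f h)"
        by (rule continuous_map_eq) (simp add: *)
      then show ?thesis using D True by blast
    next
      case False
      define E where "E = {x \<in> topspace (gtop G). rng G x \<in> arrows G - rng G ` K}"
      have zero: "convolution G f h z = 0" if "z \<in> E" for z
      proof -
        have "f y = 0" if "rng G y = rng G z" for y
          using fK[of y] imageI[of y K "rng G"] that \<open>z \<in> E\<close> by (auto simp: E_def)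
        then have "row f z = {}" by (auto simp: row_def)
        then show ?thesis using that by (subst convolution_eq_sum[of "{}"]) (auto simp: E_def)
      qed
      have "closedin (gtop G) (rng G ` K)"
        by (intro compactin_closedin image_compactin[OF K(1)] continuous_rng)
      then have "openin (gtop G) (arrows G - rng G ` K)"
        by (simp add: closedin_def)
      then have "openin (gtop G) E"
        unfolding E_def by (rule openin_continuous_map_preimage[OF continuous_rng])
      moreover have "x \<in> E" using False x K(2) by (auto simp: E_def D_def rng_closed)
      moreover have "continuous_map (subtopology (gtop G) E) euclidean (convolution G f h)"
        by (rule continuous_map_eq[where f = "\<lambda>_. 0"]) (use zero in auto)
      ultimately show ?thesis by blast
    qed
  qed
next
  case (add f g)
  then show ?case
    unfolding convolution_add_left[OF add(1,2), abs_def] by (intro continuous_map_complex_add)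
qed

lemma convolution_nonzero:
  assumes "convolution G f h x \<noteq> 0"
  shows "\<exists>y z. (y, z) \<in> composable G \<and> x = gmul G y z \<and> f y \<noteq> 0 \<and> h z \<noteq> 0"
proof -
  have x: "x \<in> arrows G" using assms by (auto simp: convolution_def split: if_splits)
  have "\<exists>y. y \<in> arrows G \<and> rng G y = rng G x \<and> f y * h (gmul G (ginv G y) x) \<noteq> 0"
  proof (rule ccontr)
    assume "\<not> ?thesis"
    then have "convolution G f h x = 0" using x by (auto simp: convolution_def intro!: infsum_0)
    with assms show False by simp
  qed
  then obtain y where "y \<in> arrows G" "rng G y = rng G x" "f y \<noteq> 0" "h (gmul G (ginv G y) x) \<noteq> 0"
    by auto
  with x show ?thesis
    by (intro exI[of _ y] exI[of _ "gmul G (ginv G y) x"])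
      (simp add: composable_iff gmul_ginv_cancel left_quotient)
qed

text \<open>The convolution vanishes off the set of products of composable pairs in \<open>K \<times> L\<close>.  This set is
  compact, because composability is a closed condition in a Hausdorff groupoid.\<close>

lemma Cc_convolution:
  assumes f: "f \<in> Cc G" and h: "h \<in> Cc G"
  shows "convolution G f h \<in> Cc G"
proof -
  obtain K L where K: "compactin (gtop G) K" "\<And>x. f x \<noteq> 0 \<Longrightarrow> x \<in> K"
    and L: "compactin (gtop G) L" "\<And>x. h x \<noteq> 0 \<Longrightarrow> x \<in> L"
    using f h Cc_support by metis
  let ?P = "prod_topology (gtop G) (gtop G)"
  have "composable G = {p \<in> topspace ?P. (src G \<circ> fst) p = (rng G \<circ> snd) p}"
    by (auto simp: composable_def)
  moreover have "closedin ?P {p \<in> topspace ?P. (src G \<circ> fst) p = (rng G \<circ> snd) p}"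
    by (intro closedin_continuous_maps_eq[OF Hausdorff] continuous_map_compose[OF _ continuous_src]
        continuous_map_compose[OF _ continuous_rng] continuous_map_fst continuous_map_snd)
  ultimately have "closedin ?P (composable G)" by simp
  moreover have KL: "compactin ?P (K \<times> L)" using K L by (simp add: compactin_Times)
  ultimately have "compactin ?P ((K \<times> L) \<inter> composable G)" by (metis compact_Int_closedin)
  then have "compactin (subtopology ?P (composable G)) ((K \<times> L) \<inter> composable G)"
    by (simp add: compactin_subtopology)
  from image_compactin[OF this continuous_gmul]
  have "compactin (gtop G) ((\<lambda>(x, y). gmul G x y) ` ((K \<times> L) \<inter> composable G))" .
  then show ?thesis
    by (rule CcI[rotated]) (use continuous_convolution[OF f Cc_continuous[OF h]] K L
      in \<open>auto dest!: convolution_nonzero intro!: image_eqI\<close>)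
qed

definition adjoint_function :: "('a \<Rightarrow> complex) \<Rightarrow> 'a \<Rightarrow> complex" where
  "adjoint_function f x = (if x \<in> arrows G then cnj (f (ginv G x)) else 0)"

lemma Cc_adjoint_function:
  assumes f: "f \<in> Cc G"
  shows "adjoint_function f \<in> Cc G"
proof -
  obtain K where K: "compactin (gtop G) K" "\<And>x. f x \<noteq> 0 \<Longrightarrow> x \<in> K"
    using Cc_support[OF f] by blast
  have "continuous_map (gtop G) euclidean (\<lambda>x. cnj ((f \<circ> ginv G) x))"
    by (intro continuous_map_complex_cnj continuous_map_compose[OF continuous_ginv] Cc_continuous f)
  then have "continuous_map (gtop G) euclidean (adjoint_function f)"
    by (rule continuous_map_eq) (simp add: adjoint_function_def)
  moreover have "compactin (gtop G) (ginv G ` K)"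
    by (rule image_compactin[OF K(1) continuous_ginv])
  moreover have "x \<in> ginv G ` K" if "adjoint_function f x \<noteq> 0" for x
    using that K(2)[of "ginv G x"] ginv_ginv[of x]
    by (auto simp: adjoint_function_def image_iff split: if_splits intro!: bexI[of _ "ginv G x"])
  ultimately show ?thesis by (rule CcI)
qed

end

section \<open>The left regular representation\<close>

lemma ell2_exists:
  assumes "B \<ge> 0" and le: "\<And>F. finite F \<Longrightarrow> (\<Sum>x\<in>F. (cmod (g x))\<^sup>2) \<le> B\<^sup>2"
  shows "\<exists>v. Rep_ell2 v = g \<and> norm v \<le> B"
proof -
  have s: "(\<lambda>x. (cmod (g x))\<^sup>2) summable_on UNIV"
    by (rule nonneg_bdd_above_summable_on) (auto intro!: bdd_aboveI2 le)
  then have R: "Rep_ell2 (Abs_ell2 g) = g" by (simp add: Abs_ell2_inverse)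
  have "(norm (Abs_ell2 g))\<^sup>2 \<le> B\<^sup>2"
    unfolding norm_ell2_sq R by (rule infsum_le_finite_sums[OF s le])
  with R \<open>B \<ge> 0\<close> show ?thesis by (blast intro: power2_le_imp_le)
qed

text \<open>Composition with a partial injection followed by a bounded multiplication operator is bounded.
  Restrictions to a set of arrows, right translations, and convolution by a function supported in
  a bisection all have this form.\<close>

lemma ell2_weighted_pullback:
  assumes inj: "inj_on \<phi> D" and m: "\<And>x. cmod (m x) \<le> M"
  shows "\<exists>v. Rep_ell2 v = (\<lambda>x. if x \<in> D then m x * Rep_ell2 u (\<phi> x) else 0) \<and> norm v \<le> M * norm u"
proof (rule ell2_exists)
  have M: "M \<ge> 0" using m norm_ge_zero order_trans by blast
  then show "M * norm u \<ge> 0" by simp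
  fix F :: "'a set" assume F: "finite F"
  have "(\<Sum>x\<in>F. (cmod (if x \<in> D then m x * Rep_ell2 u (\<phi> x) else 0))\<^sup>2) =
      (\<Sum>x\<in>F \<inter> D. (cmod (m x * Rep_ell2 u (\<phi> x)))\<^sup>2)"
    by (rule sum.mono_neutral_cong_right) (use F in auto)
  also have "\<dots> \<le> (\<Sum>x\<in>F \<inter> D. M\<^sup>2 * (cmod (Rep_ell2 u (\<phi> x)))\<^sup>2)"
    using m by (auto intro!: sum_mono mult_right_mono power_mono simp: norm_mult power_mult_distrib)
  also have "\<dots> = M\<^sup>2 * (\<Sum>z\<in>\<phi> ` (F \<inter> D). (cmod (Rep_ell2 u z))\<^sup>2)"
    unfolding sum_distrib_left[symmetric]
    by (subst sum.reindex) (use inj in \<open>auto intro: inj_on_subset\<close>)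
  also have "\<dots> \<le> M\<^sup>2 * (norm u)\<^sup>2"
    by (intro mult_left_mono sum_le_norm_ell2) (use F in auto)
  finally show "(\<Sum>x\<in>F. (cmod (if x \<in> D then m x * Rep_ell2 u (\<phi> x) else 0))\<^sup>2) \<le> (M * norm u)\<^sup>2"
    by (simp add: power_mult_distrib)
qed

lemma cinner_delta_right: "ell2_cinner u (delta w b) = cnj (Rep_ell2 u b) * w"
proof -
  have "ell2_cinner u (delta w b) = infsum (\<lambda>x. cnj (Rep_ell2 u x) * Rep_ell2 (delta w b) x) {b}"
    unfolding ell2_cinner_def by (rule infsum_cong_neutral) (auto simp: delta.rep_eq)
  then show ?thesis by (simp add: delta.rep_eq)
qed

lemma cinner_delta_left: "ell2_cinner (delta z a) u = cnj z * Rep_ell2 u a"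
  by (subst cinner_commute) (simp add: cinner_delta_right)

context lch_etale_groupoid
begin

lemma Cc_bounded:
  assumes f: "f \<in> Cc G"
  shows "\<exists>M. \<forall>x. cmod (f x) \<le> M"
proof -
  obtain K where K: "compactin (gtop G) K" "\<And>x. f x \<noteq> 0 \<Longrightarrow> x \<in> K"
    using Cc_support[OF f] by blast
  have "compact (f ` K)"
    using image_compactin[OF K(1) Cc_continuous[OF f]] by simp
  then obtain M where M: "\<And>x. x \<in> K \<Longrightarrow> cmod (f x) \<le> M"
    using compact_imp_bounded bounded_iff by (metis imageI)
  have "cmod (f x) \<le> max M 0" for x
    using M[of x] K(2)[of x] by (cases "f x = 0") auto
  then show ?thesis by blast
qed

text \<open>For \<open>f\<close> carried by a bisection \<open>U\<close>, convolution by \<open>f\<close> is a weighted composition with the partial map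
  \<open>x \<mapsto> y\<^sup>-\<^sup>1 x\<close>, where \<open>y \<in> U\<close> has the range of \<open>x\<close>.  This map is injective, since \<open>y\<close> is also determined
  by its source, which is the range of \<open>y\<^sup>-\<^sup>1 x\<close>.\<close>

lemma convolution_bounded:
  assumes "f \<in> Cc G"
  shows "\<exists>C. \<forall>u :: 'a ell2. \<exists>v. Rep_ell2 v = convolution G f (Rep_ell2 u) \<and> norm v \<le> C * norm u"
  using assms
proof (induct rule: Cc_induct)
  case (bisection f)
  then obtain U where f: "f \<in> Cc G" and U: "bisection U" and fU: "\<And>x. f x \<noteq> 0 \<Longrightarrow> x \<in> U"
    unfolding bisection_supported_def by blast
  obtain M where M: "\<And>x. cmod (f x) \<le> M" using Cc_bounded[OF f] by blast
  define D where "D = {x \<in> arrows G. rng G x \<in> rng G ` U}"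
  define y where "y x = inv_into U (rng G) (rng G x)" for x
  define \<phi> where "\<phi> x = gmul G (ginv G (y x)) x" for x
  have y: "y x \<in> U" "y x \<in> arrows G" "rng G (y x) = rng G x" if "x \<in> D" for x
  proof -
    have "rng G x \<in> rng G ` U" using that by (simp add: D_def)
    then show "y x \<in> U" "rng G (y x) = rng G x"
      unfolding y_def by (rule inv_into_into, rule f_inv_into_f)
    then show "y x \<in> arrows G" using U openin_arrows unfolding bisection_def by blast
  qed
  have "inj_on \<phi> D"
  proof (rule inj_onI)
    fix x x' assume x: "x \<in> D" "x' \<in> D" and e: "\<phi> x = \<phi> x'"
    then have a: "x \<in> arrows G" "x' \<in> arrows G" by (auto simp: D_def)
    have "src G (y x) = rng G (\<phi> x)" "src G (y x') = rng G (\<phi> x')"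
      using left_quotient(3) y x a by (simp_all add: \<phi>_def)
    then have "src G (y x) = src G (y x')" using e by simp
    then have "y x = y x'" using y x U unfolding bisection_def by (metis inj_onD)
    moreover have "x = gmul G (y x) (\<phi> x)" "x' = gmul G (y x') (\<phi> x')"
      using gmul_ginv_cancel y x a by (simp_all add: \<phi>_def)
    ultimately show "x = x'" using e by metis
  qed
  from ell2_weighted_pullback[OF this, of "\<lambda>x. f (y x)" M]
  have "\<exists>v. Rep_ell2 v = (\<lambda>x. if x \<in> D then f (y x) * Rep_ell2 u (\<phi> x) else 0) \<and> norm v \<le> M * norm u"
    for u using M by blast
  moreover have "convolution G f (Rep_ell2 u) =
      (\<lambda>x. if x \<in> D then f (y x) * Rep_ell2 u (\<phi> x) else 0)" for u
  proof
    fix x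
    show "convolution G f (Rep_ell2 u) x = (if x \<in> D then f (y x) * Rep_ell2 u (\<phi> x) else 0)"
      by (subst convolution_bisection[OF U fU]) (auto simp: D_def y_def \<phi>_def)
  qed
  ultimately show ?case by metis
next
  case (add f g)
  then obtain C1 C2 where
    1: "\<And>u :: 'a ell2. \<exists>v. Rep_ell2 v = convolution G f (Rep_ell2 u) \<and> norm v \<le> C1 * norm u" and
    2: "\<And>u :: 'a ell2. \<exists>v. Rep_ell2 v = convolution G g (Rep_ell2 u) \<and> norm v \<le> C2 * norm u"
    by blast
  have "\<exists>v. Rep_ell2 v = convolution G (\<lambda>x. f x + g x) (Rep_ell2 u) \<and> norm v \<le> (C1 + C2) * norm u"
    for u :: "'a ell2"
  proof -
    obtain v1 v2 where "Rep_ell2 v1 = convolution G f (Rep_ell2 u)" "norm v1 \<le> C1 * norm u"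
      "Rep_ell2 v2 = convolution G g (Rep_ell2 u)" "norm v2 \<le> C2 * norm u"
      using 1 2 by meson
    then show ?thesis
      using norm_triangle_ineq[of v1 v2]
      by (intro exI[of _ "v1 + v2"])
        (auto simp: plus_ell2.rep_eq fun_eq_iff convolution_add_left[OF add(1,2)] algebra_simps)
  qed
  then show ?case by blast
qed

lemma Rep_left_regular:
  assumes f: "f \<in> Cc G"
  shows "Rep_ell2 (blinfun_apply (left_regular G f) u) = convolution G f (Rep_ell2 u)"
proof -
  obtain C where C: "\<And>u :: 'a ell2. \<exists>v. Rep_ell2 v = convolution G f (Rep_ell2 u) \<and> norm v \<le> C * norm u"
    using convolution_bounded[OF f] by blast
  define T where "T u = Abs_ell2 (convolution G f (Rep_ell2 u))" for u
  have T: "Rep_ell2 (T u) = convolution G f (Rep_ell2 u)" "norm (T u) \<le> norm u * C" for u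
    using C[of u] by (auto simp: T_def Rep_ell2_inverse mult.commute dest!: sym[of "Rep_ell2 _"])
  have "bounded_linear T"
  proof (rule bounded_linear_intro[OF _ _ T(2)])
    show "T (u + v) = T u + T v" for u v
    proof (rule ell2_eqI)
      show "Rep_ell2 (T (u + v)) x = Rep_ell2 (T u + T v) x" for x
        by (cases "x \<in> arrows G")
          (simp_all add: T plus_ell2.rep_eq convolution_row[OF f] convolution_off_arrows
            algebra_simps sum.distrib)
    qed
    show "T (r *\<^sub>R u) = r *\<^sub>R T u" for r u
    proof (rule ell2_eqI)
      show "Rep_ell2 (T (r *\<^sub>R u)) x = Rep_ell2 (r *\<^sub>R T u) x" for x
        by (cases "x \<in> arrows G")
          (simp_all add: T Rep_ell2_scaleR convolution_row[OF f] convolution_off_arrows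
            sum_distrib_left mult_ac)
    qed
  qed
  then show ?thesis
    unfolding left_regular_def T_def[symmetric, abs_def] by (simp add: bounded_linear_Blinfun_apply T)
qed

text \<open>The entry at \<open>(b, a)\<close> is \<open>f(b a\<^sup>-\<^sup>1)\<close>.  With these entries, multiplicativity of the representation
  becomes associativity in the groupoid, and \<open>(a b\<^sup>-\<^sup>1)\<^sup>-\<^sup>1 = b a\<^sup>-\<^sup>1\<close> gives the adjoint.\<close>

lemma left_regular_delta:
  assumes f: "f \<in> Cc G"
  shows "Rep_ell2 (blinfun_apply (left_regular G f) (delta z a)) b =
    (if a \<in> arrows G \<and> b \<in> arrows G \<and> src G a = src G b then f (gmul G b (ginv G a)) * z else 0)"
proof (cases "b \<in> arrows G")
  case b: True
  show ?thesis
  proof (cases "a \<in> arrows G \<and> src G a = src G b")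
    case True
    then have a: "a \<in> arrows G" "src G a = src G b" by auto
    let ?y = "gmul G b (ginv G a)"
    have y: "?y \<in> arrows G" "rng G ?y = rng G b" "src G ?y = rng G a" "gmul G ?y a = b"
      using right_quotient[of a b] a b by auto
    have iff: "gmul G (ginv G y) b = a \<longleftrightarrow> y = ?y" if y': "y \<in> arrows G" "rng G y = rng G b" for y
    proof
      assume "gmul G (ginv G y) b = a"
      moreover have "gmul G y (gmul G (ginv G y) b) = b" "src G y = rng G (gmul G (ginv G y) b)"
        using gmul_ginv_cancel y' b left_quotient(3) by auto
      ultimately show "y = ?y"
        using gmul_ginv_cancel_right[of y a] y' a by (simp add: composable_iff)
    next
      assume "y = ?y"
      then show "gmul G (ginv G y) b = a"
        using ginv_gmul_cancel[of ?y a] y a by (simp add: composable_iff)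
    qed
    have "convolution G f (Rep_ell2 (delta z a)) b =
        (\<Sum>y\<in>insert ?y (row f b). f y * Rep_ell2 (delta z a) (gmul G (ginv G y) b))"
      by (rule convolution_eq_sum) (use finite_row[OF f] y b in \<open>auto simp: row_def\<close>)
    also have "\<dots> = (\<Sum>y\<in>insert ?y (row f b). if y = ?y then f ?y * z else 0)"
    proof (rule sum.cong)
      fix x assume "x \<in> insert ?y (row f b)"
      then have "x \<in> arrows G" "rng G x = rng G b" using y by (auto simp: row_def)
      from iff[OF this] show "f x * Rep_ell2 (delta z a) (gmul G (ginv G x) b) =
          (if x = ?y then f ?y * z else 0)"
        by (simp add: delta.rep_eq)
    qed simp
    also have "\<dots> = f ?y * z" using finite_row[OF f] by simp
    finally show ?thesis using a b by (simp add: Rep_left_regular[OF f])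
  next
    case False
    have "convolution G f (Rep_ell2 (delta z a)) b = 0"
      unfolding convolution_row[OF f b]
    proof (rule sum.neutral, rule ballI)
      fix y assume "y \<in> row f b"
      then have "y \<in> arrows G" "rng G y = rng G b" by (auto simp: row_def)
      with left_quotient[of y b] b False have "gmul G (ginv G y) b \<noteq> a" by metis
      then show "f y * Rep_ell2 (delta z a) (gmul G (ginv G y) b) = 0"
        by (simp add: delta.rep_eq)
    qed
    with False show ?thesis by (auto simp: Rep_left_regular[OF f])
  qed
qed (simp add: Rep_left_regular[OF f] convolution_off_arrows)

lemma left_regular_eqI:
  assumes "f \<in> Cc G"
    and "\<And>z a b. Rep_ell2 (blinfun_apply T (delta z a)) b =
      (if a \<in> arrows G \<and> b \<in> arrows G \<and> src G a = src G b then f (gmul G b (ginv G a)) * z else 0)"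
  shows "T = left_regular G f"
  by (intro blinfun_eqI_delta ell2_eqI) (simp only: assms left_regular_delta)

lemma left_regular_add:
  assumes "f \<in> Cc G" "g \<in> Cc G"
  shows "left_regular G (\<lambda>x. f x + g x) = left_regular G f + left_regular G g"
  by (rule left_regular_eqI[symmetric])
    (simp_all add: assms Cc_add plus_blinfun.rep_eq plus_ell2.rep_eq left_regular_delta algebra_simps)

lemma left_regular_scale:
  assumes "f \<in> Cc G"
  shows "left_regular G (\<lambda>x. w * f x) = op_scale w (left_regular G f)"
  by (rule left_regular_eqI[symmetric])
    (simp_all add: assms Cc_scale op_scale_apply ell2_scale.rep_eq left_regular_delta algebra_simps)

lemma left_regular_zero: "left_regular G (\<lambda>_. 0) = 0"
  by (rule left_regular_eqI[symmetric]) (simp_all add: Cc_zero zero_ell2.rep_eq)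

lemma left_regular_diff:
  assumes "f \<in> Cc G" "g \<in> Cc G"
  shows "left_regular G (\<lambda>x. f x - g x) = left_regular G f - left_regular G g"
  using left_regular_add[OF assms(1) Cc_scale[OF assms(2), of "- 1"]] left_regular_scale[OF assms(2), of "- 1"]
  by (simp add: op_scale_minus_one)

lemma Cc_diff: "f \<in> Cc G \<Longrightarrow> g \<in> Cc G \<Longrightarrow> (\<lambda>x. f x - g x) \<in> Cc G"
  using Cc_add[OF _ Cc_scale[of g "- 1"], of f] by simp

lemma left_regular_sum:
  assumes "finite I" "\<And>i. i \<in> I \<Longrightarrow> f i \<in> Cc G"
  shows "left_regular G (\<lambda>x. \<Sum>i\<in>I. f i x) = (\<Sum>i\<in>I. left_regular G (f i))"
  using assms
  by (induct I rule: finite_induct) (simp_all add: left_regular_zero left_regular_add Cc_sum)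

lemma left_regular_convolution:
  assumes f: "f \<in> Cc G" and g: "g \<in> Cc G"
  shows "left_regular G f o\<^sub>L left_regular G g = left_regular G (convolution G f g)"
proof (rule left_regular_eqI[OF Cc_convolution[OF f g]])
  fix z a b
  show "Rep_ell2 (blinfun_apply (left_regular G f o\<^sub>L left_regular G g) (delta z a)) b =
    (if a \<in> arrows G \<and> b \<in> arrows G \<and> src G a = src G b
     then convolution G f g (gmul G b (ginv G a)) * z else 0)"
  proof (cases "b \<in> arrows G")
    case b: True
    have L: "Rep_ell2 (blinfun_apply (left_regular G f o\<^sub>L left_regular G g) (delta z a)) b =
        (\<Sum>y\<in>row f b. f y * Rep_ell2 (blinfun_apply (left_regular G g) (delta z a)) (gmul G (ginv G y) b))"
      by (simp add: Rep_left_regular[OF f] convolution_row[OF f b])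
    have yb: "y \<in> arrows G" "rng G y = rng G b" "gmul G (ginv G y) b \<in> arrows G"
      "src G (gmul G (ginv G y) b) = src G b" if "y \<in> row f b" for y
      using that left_quotient[of y b] b by (auto simp: row_def)
    show ?thesis
    proof (cases "a \<in> arrows G \<and> src G a = src G b")
      case True
      then have a: "a \<in> arrows G" "src G a = src G b" by auto
      let ?x = "gmul G b (ginv G a)"
      have x: "?x \<in> arrows G" "rng G ?x = rng G b" using right_quotient a b by auto
      have "row f ?x = row f b" by (simp add: row_def x)
      then have "convolution G f g ?x * z = (\<Sum>y\<in>row f b. f y * (g (gmul G (ginv G y) ?x) * z))"
        by (simp add: convolution_row[OF f x(1)] sum_distrib_right mult.assoc)
      also have "\<dots> = (\<Sum>y\<in>row f b. f y *
          Rep_ell2 (blinfun_apply (left_regular G g) (delta z a)) (gmul G (ginv G y) b))"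
      proof (rule sum.cong)
        fix y assume y: "y \<in> row f b"
        have "gmul G (gmul G (ginv G y) b) (ginv G a) = gmul G (ginv G y) ?x"
          using yb[OF y] a b by (intro gmul_assoc) (simp_all add: composable_iff ginv_closed src_ginv rng_ginv)
        then show "f y * (g (gmul G (ginv G y) ?x) * z) =
            f y * Rep_ell2 (blinfun_apply (left_regular G g) (delta z a)) (gmul G (ginv G y) b)"
          using yb[OF y] a b by (simp add: left_regular_delta[OF g])
      qed simp
      finally show ?thesis using a b L by simp
    next
      case False
      then have "f y * Rep_ell2 (blinfun_apply (left_regular G g) (delta z a)) (gmul G (ginv G y) b) = 0"
        if "y \<in> row f b" for y
        using yb[OF that] by (auto simp: left_regular_delta[OF g])
      then have "(\<Sum>y\<in>row f b. f y *
          Rep_ell2 (blinfun_apply (left_regular G g) (delta z a)) (gmul G (ginv G y) b)) = 0"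
        by (intro sum.neutral ballI)
      then show ?thesis using False L by auto
    qed
  qed (simp add: Rep_left_regular[OF f] convolution_off_arrows)
qed

lemma adjoint_pair_left_regular:
  assumes f: "f \<in> Cc G"
  shows "adjoint_pair (left_regular G f) (left_regular G (adjoint_function f))"
proof (rule adjoint_pairI_delta)
  fix z a w b
  have "adjoint_function f (gmul G a (ginv G b)) = cnj (f (gmul G b (ginv G a)))"
    if "a \<in> arrows G" "b \<in> arrows G" "src G a = src G b"
    using that right_quotient(1)[of b a]
    by (simp add: adjoint_function_def ginv_mult ginv_ginv composable_iff ginv_closed rng_ginv)
  then show "ell2_cinner (left_regular G f (delta z a)) (delta w b) =
      ell2_cinner (delta z a) (left_regular G (adjoint_function f) (delta w b))"
    by (auto simp: cinner_delta_left cinner_delta_right left_regular_delta f Cc_adjoint_function)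
qed

lemma adjointable_left_regular: "f \<in> Cc G \<Longrightarrow> adjointable (left_regular G f)"
  using adjoint_pair_left_regular adjointable_def by blast

lemma op_star_left_regular:
  "f \<in> Cc G \<Longrightarrow> op_star (left_regular G f) = left_regular G (adjoint_function f)"
  by (rule op_star_eq[OF adjoint_pair_left_regular])

end

section \<open>The grading of the reduced algebra by a cocycle\<close>

text \<open>An operator that respects a decomposition of the index set into classes is bounded by a common
  bound for its restrictions to the classes.\<close>

lemma infsum_le_by_classes:
  fixes f g :: "'a \<Rightarrow> real" and \<kappa> :: "'a \<Rightarrow> 'k"
  assumes f: "f summable_on UNIV" and g: "g summable_on UNIV"
    and le: "\<And>k. infsum f {x. \<kappa> x = k} \<le> C * infsum g {x. \<kappa> x = k}"
  shows "infsum f UNIV \<le> C * infsum g UNIV"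
proof -
  define \<Sigma> where "\<Sigma> = Sigma UNIV (\<lambda>k. {x. \<kappa> x = k})"
  have bij: "bij_betw (\<lambda>x. (\<kappa> x, x)) UNIV \<Sigma>"
    by (rule bij_betwI[where g = snd]) (auto simp: \<Sigma>_def)
  have s: "(\<lambda>(k, x). h x) summable_on \<Sigma>" if "h summable_on UNIV" for h :: "'a \<Rightarrow> real"
    using that summable_on_reindex_bij_betw[OF bij, of "\<lambda>(k, x). h x"] by simp
  have i: "infsum h UNIV = (\<Sum>\<^sub>\<infinity>k. infsum h {x. \<kappa> x = k})" if "h summable_on UNIV" for h :: "'a \<Rightarrow> real"
    using infsum_reindex_bij_betw[OF bij, of "\<lambda>(k, x). h x"]
      infsum_Sigma_banach[OF s[OF that, unfolded \<Sigma>_def]] by (simp add: \<Sigma>_def)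
  have c: "(\<lambda>k. infsum h {x. \<kappa> x = k}) summable_on UNIV" if "h summable_on UNIV" for h :: "'a \<Rightarrow> real"
    using summable_on_Sigma_banach[OF s[OF that, unfolded \<Sigma>_def]] by simp
  have "infsum f UNIV \<le> (\<Sum>\<^sub>\<infinity>k. C * infsum g {x. \<kappa> x = k})"
    unfolding i[OF f] by (intro infsum_mono c summable_on_cmult_right f g le)
  also have "\<dots> = C * infsum g UNIV"
    unfolding i[OF g] by (rule infsum_cmult_right')
  finally show ?thesis .
qed

locale cocycle_groupoid = lch_etale_groupoid G + group \<Gamma>
  for G :: "'a groupoid" and \<Gamma> :: "('g, 'm) monoid_scheme" (structure) +
  fixes c :: "'a \<Rightarrow> 'g"
  assumes cocycle: "continuous_cocycle G \<Gamma> c"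
begin

subsection \<open>Homogeneous functions\<close>

lemma c_closed: "x \<in> arrows G \<Longrightarrow> c x \<in> carrier \<Gamma>"
  using cocycle by (auto simp: continuous_cocycle_def continuous_map_def)

lemma c_gmul: "(x, y) \<in> composable G \<Longrightarrow> c (gmul G x y) = c x \<otimes> c y"
  using cocycle by (auto simp: continuous_cocycle_def)

lemma c_rng: "x \<in> arrows G \<Longrightarrow> c (rng G x) = \<one>"
  using c_gmul[of "rng G x" "rng G x"] gmul_rng[of "rng G x"]
  by (simp add: composable_iff rng_closed rng_rng src_rng c_closed)

lemma c_ginv:
  assumes "x \<in> arrows G"
  shows "c (ginv G x) = inv (c x)"
proof -
  have "c (ginv G x) \<otimes> c x = \<one>"
    using assms c_gmul[of "ginv G x" x] c_rng[of "src G x"]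
    by (simp add: composable_iff ginv_closed src_ginv ginv_gmul src_closed rng_src)
  then show ?thesis using assms by (metis c_closed ginv_closed inv_equality)
qed

lemma closedin_fibre: "closedin (gtop G) (fibre G c p)"
  and openin_fibre: "openin (gtop G) (fibre G c p)"
proof -
  have c: "continuous_map (gtop G) (discrete_topology (carrier \<Gamma>)) c"
    using cocycle by (simp add: continuous_cocycle_def)
  have e: "fibre G c p = {x \<in> topspace (gtop G). c x \<in> {p} \<inter> carrier \<Gamma>}"
    using c_closed by (auto simp: fibre_def)
  show "closedin (gtop G) (fibre G c p)" "openin (gtop G) (fibre G c p)"
    unfolding e
    by (rule closedin_continuous_map_preimage[OF c] openin_continuous_map_preimage[OF c]; simp)+
qed

text \<open>This is \<open>C\<^sub>c(G\<^sub>p)\<close>, extended by zero.\<close>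

definition homogeneous :: "'g \<Rightarrow> ('a \<Rightarrow> complex) set" where
  "homogeneous p = {f \<in> Cc G. gsupp G f \<subseteq> fibre G c p}"

lemma homogeneous_iff: "f \<in> homogeneous p \<longleftrightarrow> f \<in> Cc G \<and> (\<forall>x. f x \<noteq> 0 \<longrightarrow> c x = p)"
proof -
  have "gsupp G f \<subseteq> fibre G c p \<longleftrightarrow> (\<forall>x. f x \<noteq> 0 \<longrightarrow> c x = p)" if f: "f \<in> Cc G"
  proof
    assume "gsupp G f \<subseteq> fibre G c p"
    then show "\<forall>x. f x \<noteq> 0 \<longrightarrow> c x = p" using gsupp_Cc[OF f] by (auto simp: fibre_def)
  next
    assume "\<forall>x. f x \<noteq> 0 \<longrightarrow> c x = p"
    then show "gsupp G f \<subseteq> fibre G c p"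
      unfolding gsupp_def by (intro closure_of_minimal closedin_fibre) (auto simp: fibre_def)
  qed
  then show ?thesis by (auto simp: homogeneous_def)
qed

lemma homogeneous_Cc: "f \<in> homogeneous p \<Longrightarrow> f \<in> Cc G"
  by (simp add: homogeneous_iff)

lemma homogeneous_convolution:
  assumes f: "f \<in> homogeneous p" and g: "g \<in> homogeneous q"
  shows "convolution G f g \<in> homogeneous (p \<otimes> q)"
proof -
  have "c x = p \<otimes> q" if "convolution G f g x \<noteq> 0" for x
    using convolution_nonzero[OF that] f g by (auto simp: homogeneous_iff c_gmul)
  then show ?thesis using f g by (simp add: homogeneous_iff Cc_convolution)
qed

lemma homogeneous_adjoint_function:
  assumes "f \<in> homogeneous p"
  shows "adjoint_function f \<in> homogeneous (inv p)"
proof -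
  have "c x = inv p" if "adjoint_function f x \<noteq> 0" for x
  proof -
    from that have x: "x \<in> arrows G" "f (ginv G x) \<noteq> 0"
      by (auto simp: adjoint_function_def split: if_splits)
    with assms have "c (ginv G x) = p" by (simp add: homogeneous_iff)
    then have "inv p = inv (inv (c x))" by (simp only: c_ginv[OF x(1)])
    then show ?thesis by (simp only: inv_inv[OF c_closed[OF x(1)]])
  qed
  then show ?thesis using assms by (simp add: homogeneous_iff Cc_adjoint_function)
qed

lemma homogeneous_zero: "(\<lambda>_. 0) \<in> homogeneous p"
  by (simp add: homogeneous_iff Cc_zero)

lemma homogeneous_add: "f \<in> homogeneous p \<Longrightarrow> g \<in> homogeneous p \<Longrightarrow> (\<lambda>x. f x + g x) \<in> homogeneous p"
  unfolding homogeneous_iff by (auto intro: Cc_add) (metis add.right_neutral)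

lemma homogeneous_diff: "f \<in> homogeneous p \<Longrightarrow> g \<in> homogeneous p \<Longrightarrow> (\<lambda>x. f x - g x) \<in> homogeneous p"
  unfolding homogeneous_iff by (auto intro: Cc_diff) metis

lemma homogeneous_scale: "f \<in> homogeneous p \<Longrightarrow> (\<lambda>x. z * f x) \<in> homogeneous p"
  by (auto simp: homogeneous_iff Cc_scale)

text \<open>For \<open>p \<in> P\<close> this is the bimodule \<open>X(G)\<^sub>p\<close>; it makes sense for every degree, and adjoints exchange
  the degrees \<open>p\<close> and \<open>p\<^sup>-\<^sup>1\<close>.\<close>

definition spectral_subspace :: "'g \<Rightarrow> 'a operator set" where
  "spectral_subspace p = closure (left_regular G ` homogeneous p)"

lemma closed_spectral_subspace: "closed (spectral_subspace p)"
  by (simp add: spectral_subspace_def)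

lemma left_regular_in_spectral: "f \<in> homogeneous p \<Longrightarrow> left_regular G f \<in> spectral_subspace p"
  unfolding spectral_subspace_def by (auto intro: closure_subset[THEN subsetD])

lemma spectral_sequence:
  assumes "x \<in> spectral_subspace p"
  shows "\<exists>f. (\<forall>n. f n \<in> homogeneous p) \<and> (\<lambda>n. left_regular G (f n)) \<longlonglongrightarrow> x"
proof -
  obtain w where w: "\<And>n. w n \<in> left_regular G ` homogeneous p" "w \<longlonglongrightarrow> x"
    using assms unfolding spectral_subspace_def closure_sequential by blast
  then have "\<forall>n. \<exists>f. f \<in> homogeneous p \<and> w n = left_regular G f" by blast
  from choice[OF this] obtain f where f: "\<And>n. f n \<in> homogeneous p" "w = (\<lambda>n. left_regular G (f n))"
    by blast
  with w show ?thesis by blast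
qed

lemma spectral_limit:
  "(\<And>n. f n \<in> spectral_subspace p) \<Longrightarrow> f \<longlonglongrightarrow> x \<Longrightarrow> x \<in> spectral_subspace p"
  by (rule closed_sequentially[OF closed_spectral_subspace])

lemma spectral_add:
  assumes "x \<in> spectral_subspace p" "y \<in> spectral_subspace p"
  shows "x + y \<in> spectral_subspace p"
proof -
  obtain f where f: "\<And>n. f n \<in> homogeneous p" "(\<lambda>n. left_regular G (f n)) \<longlonglongrightarrow> x"
    using spectral_sequence[OF assms(1)] by blast
  obtain g where g: "\<And>n. g n \<in> homogeneous p" "(\<lambda>n. left_regular G (g n)) \<longlonglongrightarrow> y"
    using spectral_sequence[OF assms(2)] by blast
  show ?thesis
    by (rule spectral_limit[OF _ tendsto_add[of "\<lambda>n. left_regular G (f n)" _ _ "\<lambda>n. left_regular G (g n)"]])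
      (use left_regular_in_spectral[OF homogeneous_add[OF f(1) g(1)]] f(2) g(2) in
        \<open>simp_all add: left_regular_add homogeneous_Cc[OF f(1)] homogeneous_Cc[OF g(1)]\<close>)
qed

lemma spectral_scale:
  assumes "x \<in> spectral_subspace p"
  shows "op_scale z x \<in> spectral_subspace p"
proof -
  obtain f where f: "\<And>n. f n \<in> homogeneous p" "(\<lambda>n. left_regular G (f n)) \<longlonglongrightarrow> x"
    using spectral_sequence[OF assms] by blast
  show ?thesis
    by (rule spectral_limit[OF _ bounded_linear.tendsto[OF bounded_linear_op_scale,
          of "\<lambda>n. left_regular G (f n)"]])
      (use left_regular_in_spectral[OF homogeneous_scale[OF f(1), where z = z]] f(2) in
        \<open>simp_all add: left_regular_scale homogeneous_Cc[OF f(1)]\<close>)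
qed

lemma spectral_zero: "0 \<in> spectral_subspace p"
  using left_regular_in_spectral[OF homogeneous_zero] by (simp add: left_regular_zero)

lemma spectral_compose:
  assumes "x \<in> spectral_subspace p" "y \<in> spectral_subspace q"
  shows "x o\<^sub>L y \<in> spectral_subspace (p \<otimes> q)"
proof -
  obtain f where f: "\<And>n. f n \<in> homogeneous p" "(\<lambda>n. left_regular G (f n)) \<longlonglongrightarrow> x"
    using spectral_sequence[OF assms(1)] by blast
  obtain g where g: "\<And>n. g n \<in> homogeneous q" "(\<lambda>n. left_regular G (g n)) \<longlonglongrightarrow> y"
    using spectral_sequence[OF assms(2)] by blast
  show ?thesis
    by (rule spectral_limit[OF _ bounded_bilinear.tendsto[OF bounded_bilinear_blinfun_compose,
          of "\<lambda>n. left_regular G (f n)" _ _ "\<lambda>n. left_regular G (g n)"]])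
      (use left_regular_in_spectral[OF homogeneous_convolution[OF f(1) g(1)]] f(2) g(2) in
        \<open>simp_all add: left_regular_convolution homogeneous_Cc[OF f(1)] homogeneous_Cc[OF g(1)]\<close>)
qed

lemma spectral_adjointable: "x \<in> spectral_subspace p \<Longrightarrow> adjointable x"
  and spectral_op_star: "x \<in> spectral_subspace p \<Longrightarrow> op_star x \<in> spectral_subspace (inv p)"
proof -
  assume "x \<in> spectral_subspace p"
  from spectral_sequence[OF this] obtain f
    where f: "\<And>n. f n \<in> homogeneous p" "(\<lambda>n. left_regular G (f n)) \<longlonglongrightarrow> x" by blast
  have a: "adjointable (left_regular G (f n))" for n
    using f(1) by (intro adjointable_left_regular homogeneous_Cc)
  show "adjointable x" by (rule adjointable_limit(1)[OF a f(2)])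
  show "op_star x \<in> spectral_subspace (inv p)"
    by (rule spectral_limit[OF _ adjointable_limit(2)[OF a f(2)]])
      (use left_regular_in_spectral[OF homogeneous_adjoint_function[OF f(1)]] in
        \<open>simp add: op_star_left_regular homogeneous_Cc[OF f(1)]\<close>)
qed

lemma spectral_inner:
  assumes "p \<in> carrier \<Gamma>" "x \<in> spectral_subspace p" "y \<in> spectral_subspace p"
  shows "op_star x o\<^sub>L y \<in> spectral_subspace \<one>"
  using spectral_compose[OF spectral_op_star[OF assms(2)] assms(3)] assms(1) by simp

subsection \<open>The embedding of the reduced algebra of the kernel\<close>

abbreviation kernel :: "'a set" where "kernel \<equiv> fibre G c \<one>"

abbreviation L\<^sub>e :: "('a \<Rightarrow> complex) \<Rightarrow> 'a operator" where
  "L\<^sub>e \<equiv> left_regular (subgroupoid G kernel)"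

lemma kernel_iff: "x \<in> kernel \<longleftrightarrow> x \<in> arrows G \<and> c x = \<one>"
  by (auto simp: fibre_def)

text \<open>The kernel of the cocycle is open and closed, so extension by zero preserves continuity and
  compactness of supports.\<close>

lemma Cc_subgroupoid: "Cc (subgroupoid G kernel) = homogeneous \<one>"
proof (intro Set.set_eqI iffI)
  let ?T = "subtopology (gtop G) kernel"
  have H: "gtop (subgroupoid G kernel) = ?T" "arrows (subgroupoid G kernel) = kernel"
    unfolding arrows_def[of "subgroupoid G kernel"] by (auto simp: subgroupoid_def kernel_iff)
  fix f
  {
    assume f: "f \<in> Cc (subgroupoid G kernel)"
    then have f0: "\<And>x. x \<notin> kernel \<Longrightarrow> f x = 0" and fc: "continuous_map ?T euclidean f"
      and K: "compactin ?T (gsupp (subgroupoid G kernel) f)"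
      by (auto simp: Cc_def H)
    have "continuous_map (gtop G) euclidean f"
    proof (rule continuous_map_locally)
      fix x assume x: "x \<in> topspace (gtop G)"
      have "openin (gtop G) (arrows G - kernel)"
        using closedin_fibre[of "\<one>"] by (simp add: closedin_def)
      moreover have "continuous_map (subtopology (gtop G) (arrows G - kernel)) euclidean f"
        by (rule continuous_map_eq[where f = "\<lambda>_. 0"]) (use f0 in auto)
      ultimately show "\<exists>U. openin (gtop G) U \<and> x \<in> U \<and> continuous_map (subtopology (gtop G) U) euclidean f"
        using fc openin_fibre[of "\<one>"] x by (cases "x \<in> kernel") auto
    qed
    moreover have "x \<in> gsupp (subgroupoid G kernel) f" if "f x \<noteq> 0" for x
    proof -
      have "{x \<in> kernel. f x \<noteq> 0} \<subseteq> ?T closure_of {x \<in> kernel. f x \<noteq> 0}"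
        by (rule closure_of_subset) (auto simp: kernel_iff)
      then show ?thesis unfolding gsupp_def H using f0 that by blast
    qed
    moreover have "compactin (gtop G) (gsupp (subgroupoid G kernel) f)"
      using K by (simp add: compactin_subtopology)
    ultimately have "f \<in> Cc G" by (intro CcI)
    then show "f \<in> homogeneous \<one>" using f0 by (auto simp: homogeneous_iff kernel_iff)
  next
    assume f: "f \<in> homogeneous \<one>"
    then have s: "gsupp G f \<subseteq> kernel" by (simp add: homogeneous_def)
    from f have f: "f \<in> Cc G" "\<And>x. f x \<noteq> 0 \<Longrightarrow> x \<in> kernel"
      by (auto simp: homogeneous_iff kernel_iff Cc_arrows)
    have "gsupp (subgroupoid G kernel) f \<subseteq> kernel \<inter> gsupp G f"
      unfolding gsupp_def H closure_of_subtopology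
      by (intro Int_mono order_refl closure_of_mono) (auto simp: kernel_iff)
    then have *: "gsupp (subgroupoid G kernel) f \<subseteq> gsupp G f" by blast
    have "compactin ?T (gsupp G f)" using f s by (simp add: Cc_def compactin_subtopology)
    then have "compactin ?T (gsupp (subgroupoid G kernel) f)"
      by (rule closed_compactin[OF _ *]) (simp add: gsupp_def H)
    moreover have "continuous_map ?T euclidean f"
      using Cc_continuous[OF f(1)] by (rule continuous_map_from_subtopology)
    ultimately show "f \<in> Cc (subgroupoid G kernel)" using f by (auto simp: Cc_def H)
  }
qed

lemma convolution_subgroupoid:
  assumes "f \<in> homogeneous \<one>"
  shows "convolution (subgroupoid G kernel) f h x = (if x \<in> kernel then convolution G f h x else 0)"
proof -
  have H: "arrows (subgroupoid G kernel) = kernel" "rng (subgroupoid G kernel) = rng G"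
    "gmul (subgroupoid G kernel) = gmul G" "ginv (subgroupoid G kernel) = ginv G"
    unfolding arrows_def[of "subgroupoid G kernel"] by (auto simp: subgroupoid_def kernel_iff)
  have "(\<Sum>\<^sub>\<infinity>y\<in>{y \<in> kernel. rng G y = rng G x}. f y * h (gmul G (ginv G y) x)) =
      (\<Sum>\<^sub>\<infinity>y\<in>{y \<in> arrows G. rng G y = rng G x}. f y * h (gmul G (ginv G y) x))"
    by (rule infsum_cong_neutral) (use assms in \<open>auto simp: homogeneous_iff kernel_iff\<close>)
  then show ?thesis by (auto simp: convolution_def H kernel_iff)
qed

lemma Rep_left_regular_kernel:
  assumes f: "f \<in> homogeneous \<one>"
  shows "Rep_ell2 (blinfun_apply (L\<^sub>e f) u) x = (if x \<in> kernel then Rep_ell2 (blinfun_apply (left_regular G f) u) x else 0)"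
    and "norm (L\<^sub>e f) \<le> norm (left_regular G f)"
proof -
  define T where "T u = Abs_ell2 (convolution (subgroupoid G kernel) f (Rep_ell2 u))" for u
  have T0: "Rep_ell2 (T u) = (\<lambda>x. if x \<in> kernel then Rep_ell2 (left_regular G f u) x else 0) \<and>
      norm (T u) \<le> norm (left_regular G f u)" for u
  proof -
    have conv: "convolution (subgroupoid G kernel) f (Rep_ell2 u) =
        (\<lambda>x. if x \<in> kernel then Rep_ell2 (left_regular G f u) x else 0)"
      by (simp add: fun_eq_iff convolution_subgroupoid[OF f] Rep_left_regular homogeneous_Cc[OF f])
    obtain v
      where v: "Rep_ell2 v = (\<lambda>x. if x \<in> kernel then Rep_ell2 (left_regular G f u) x else 0)"
        "norm v \<le> norm (left_regular G f u)"
      using ell2_weighted_pullback[of "\<lambda>x. x" kernel "\<lambda>_. 1" 1 "left_regular G f u"]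
      unfolding mult_1_left by auto
    have "T u = v" unfolding T_def conv v(1)[symmetric] by (rule Rep_ell2_inverse)
    with v show ?thesis by simp
  qed
  have T: "Rep_ell2 (T u) x = (if x \<in> kernel then Rep_ell2 (left_regular G f u) x else 0)"
    "norm (T u) \<le> norm (left_regular G f) * norm u" for u x
    by (simp add: T0, rule order_trans[OF conjunct2[OF T0] norm_blinfun])
  have "bounded_linear T"
    by (rule bounded_linear_intro[where K = "norm (left_regular G f)"])
      (auto intro!: ell2_eqI simp: T plus_ell2.rep_eq Rep_ell2_scaleR blinfun.add_right
        blinfun.scaleR_right mult.commute[of "norm _" "norm (left_regular G f)"])
  then have L: "blinfun_apply (L\<^sub>e f) = T"
    unfolding left_regular_def T_def[symmetric, abs_def] by (simp add: bounded_linear_Blinfun_apply)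
  show "Rep_ell2 (blinfun_apply (L\<^sub>e f) u) x = (if x \<in> kernel then Rep_ell2 (blinfun_apply (left_regular G f) u) x else 0)"
    by (simp add: L T)
  show "norm (L\<^sub>e f) \<le> norm (left_regular G f)"
    by (rule norm_blinfun_bound) (simp_all add: L T)
qed

text \<open>Right translation by \<open>y\<close> identifies the arrows with the source and degree of \<open>y\<close> with a
  source fibre of the kernel, and intertwines the two regular representations.\<close>

lemma right_translation:
  assumes y: "y \<in> arrows G"
  shows "\<exists>R :: 'a ell2 \<Rightarrow> 'a ell2.
    (\<forall>u. (norm (R u))\<^sup>2 = (\<Sum>\<^sub>\<infinity>w\<in>{w \<in> arrows G. src G w = src G y \<and> c w = c y}. (cmod (Rep_ell2 u w))\<^sup>2)) \<and>
    (\<forall>f\<in>homogeneous \<one>. \<forall>u. R (left_regular G f u) = L\<^sub>e f (R u))"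
proof -
  define D where "D = {x \<in> kernel. src G x = rng G y}"
  define Q where "Q = {w \<in> arrows G. src G w = src G y \<and> c w = c y}"
  have bij: "bij_betw (\<lambda>x. gmul G x y) D Q"
  proof (rule bij_betwI[where g = "\<lambda>w. gmul G w (ginv G y)"])
    show "(\<lambda>x. gmul G x y) \<in> D \<rightarrow> Q"
      using y by (auto simp: D_def Q_def kernel_iff composable_iff gmul_closed src_gmul c_gmul c_closed)
    show "(\<lambda>w. gmul G w (ginv G y)) \<in> Q \<rightarrow> D"
      using y by (auto simp: D_def Q_def kernel_iff right_quotient c_gmul composable_iff ginv_closed
          rng_ginv c_ginv c_closed)
    show "gmul G (gmul G x y) (ginv G y) = x" if "x \<in> D" for x
      using that y by (simp add: D_def kernel_iff gmul_ginv_cancel_right composable_iff)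
    show "gmul G (gmul G w (ginv G y)) y = w" if "w \<in> Q" for w
      using that y by (simp add: Q_def right_quotient)
  qed
  have "\<exists>v. Rep_ell2 v = (\<lambda>x. if x \<in> D then Rep_ell2 u (gmul G x y) else 0)" for u
    using ell2_weighted_pullback[OF bij_betw_imp_inj_on[OF bij], of "\<lambda>_. 1" 1 u]
    unfolding mult_1_left by auto
  then obtain R where R: "\<And>u. Rep_ell2 (R u) = (\<lambda>x. if x \<in> D then Rep_ell2 u (gmul G x y) else 0)"
    by metis
  show ?thesis
  proof (intro exI[of _ R] conjI allI ballI)
    show "(norm (R u))\<^sup>2 = (\<Sum>\<^sub>\<infinity>w\<in>{w \<in> arrows G. src G w = src G y \<and> c w = c y}. (cmod (Rep_ell2 u w))\<^sup>2)" for u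
    proof -
      have "(norm (R u))\<^sup>2 = (\<Sum>\<^sub>\<infinity>x\<in>D. (cmod (Rep_ell2 u (gmul G x y)))\<^sup>2)"
        unfolding norm_ell2_sq R by (rule infsum_cong_neutral) auto
      also have "\<dots> = (\<Sum>\<^sub>\<infinity>w\<in>Q. (cmod (Rep_ell2 u w))\<^sup>2)"
        by (rule infsum_reindex_bij_betw[OF bij])
      finally show ?thesis by (simp add: Q_def)
    qed
    show "R (left_regular G f u) = L\<^sub>e f (R u)" if f: "f \<in> homogeneous \<one>" for f u
    proof (rule ell2_eqI)
      fix x
      have fC: "f \<in> Cc G" by (rule homogeneous_Cc[OF f])
      show "Rep_ell2 (R (left_regular G f u)) x = Rep_ell2 (L\<^sub>e f (R u)) x"
      proof (cases "x \<in> kernel")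
        case True
        then have x: "x \<in> arrows G" "c x = \<one>" by (auto simp: kernel_iff)
        have z: "z \<in> arrows G" "rng G z = rng G x" "gmul G (ginv G z) x \<in> kernel"
          "src G (gmul G (ginv G z) x) = src G x" if "z \<in> row f x" for z
        proof -
          show *: "z \<in> arrows G" "rng G z = rng G x" using that by (auto simp: row_def)
          show "src G (gmul G (ginv G z) x) = src G x" by (rule left_quotient(2)[OF *(1) x(1) *(2)])
          have "c z = \<one>" using f that by (auto simp: row_def homogeneous_iff)
          then show "gmul G (ginv G z) x \<in> kernel"
            using * x by (simp add: kernel_iff left_quotient c_gmul composable_iff ginv_closed src_ginv c_ginv)
        qed
        have L: "Rep_ell2 (L\<^sub>e f (R u)) x = (\<Sum>z\<in>row f x. f z * Rep_ell2 (R u) (gmul G (ginv G z) x))"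
          using True by (simp add: Rep_left_regular_kernel[OF f] Rep_left_regular[OF fC] convolution_row[OF fC x(1)])
        show ?thesis
        proof (cases "src G x = rng G y")
          case src: True
          then have xy: "(x, y) \<in> composable G" using x y by (simp add: composable_iff)
          have "row f (gmul G x y) = row f x" by (simp add: row_def rng_gmul[OF xy])
          then have "Rep_ell2 (R (left_regular G f u)) x =
              (\<Sum>z\<in>row f x. f z * Rep_ell2 u (gmul G (ginv G z) (gmul G x y)))"
            using True src by (simp add: R D_def Rep_left_regular[OF fC] convolution_row[OF fC gmul_closed[OF xy]])
          also have "\<dots> = (\<Sum>z\<in>row f x. f z * Rep_ell2 (R u) (gmul G (ginv G z) x))"
          proof (rule sum.cong)
            fix z assume "z \<in> row f x"
            note z = z[OF this]
            have "gmul G (gmul G (ginv G z) x) y = gmul G (ginv G z) (gmul G x y)"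
              using z x y xy by (intro gmul_assoc) (simp_all add: composable_iff ginv_closed src_ginv)
            then show "f z * Rep_ell2 u (gmul G (ginv G z) (gmul G x y)) =
                f z * Rep_ell2 (R u) (gmul G (ginv G z) x)"
              using z src by (simp add: R D_def)
          qed simp
          finally show ?thesis using L by simp
        next
          case False
          then have "f z * Rep_ell2 (R u) (gmul G (ginv G z) x) = 0" if "z \<in> row f x" for z
            using z(4)[OF that] by (simp add: R D_def)
          then have "(\<Sum>z\<in>row f x. f z * Rep_ell2 (R u) (gmul G (ginv G z) x)) = 0"
            by (intro sum.neutral ballI)
          then show ?thesis using False L by (simp add: R D_def)
        qed
      qed (simp add: R D_def Rep_left_regular_kernel[OF f])
    qed
  qed
qed

text \<open>The sets of arrows with a common source and degree partition the groupoid.  Hence the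
  representation of the kernel on the square-summable functions of the whole groupoid is a direct sum
  of copies of the representations that define its own reduced norm, each of them occurring at least
  once.  This makes the embedding of the reduced algebra of the kernel isometric.\<close>

theorem norm_left_regular_kernel:
  assumes f: "f \<in> homogeneous \<one>"
  shows "norm (L\<^sub>e f) = norm (left_regular G f)"
proof (rule antisym[OF Rep_left_regular_kernel(2)[OF f] norm_blinfun_bound])
  fix u :: "'a ell2"
  let ?v = "left_regular G f u" and ?C = "(norm (L\<^sub>e f))\<^sup>2"
  \<comment> \<open>the points off the groupoid form one more class, on which \<open>?v\<close> vanishes\<close>
  let ?\<kappa> = "\<lambda>x. if x \<in> arrows G then Some (src G x, c x) else None"
  have "(norm ?v)\<^sup>2 \<le> ?C * (norm u)\<^sup>2"
    unfolding norm_ell2_sq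
  proof (rule infsum_le_by_classes[where \<kappa> = ?\<kappa>, OF ell2_summable ell2_summable])
    fix k
    show "(\<Sum>\<^sub>\<infinity>x\<in>{x. ?\<kappa> x = k}. (cmod (Rep_ell2 ?v x))\<^sup>2) \<le>
        ?C * (\<Sum>\<^sub>\<infinity>x\<in>{x. ?\<kappa> x = k}. (cmod (Rep_ell2 u x))\<^sup>2)"
    proof (cases "\<exists>y\<in>arrows G. ?\<kappa> y = k")
      case True
      then obtain y where y: "y \<in> arrows G" "k = Some (src G y, c y)" by auto
      obtain R :: "'a ell2 \<Rightarrow> 'a ell2" where R: "\<And>u. (norm (R u))\<^sup>2 =
            (\<Sum>\<^sub>\<infinity>w\<in>{w \<in> arrows G. src G w = src G y \<and> c w = c y}. (cmod (Rep_ell2 u w))\<^sup>2)"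
          "\<And>f u. f \<in> homogeneous \<one> \<Longrightarrow> R (left_regular G f u) = L\<^sub>e f (R u)"
        using right_translation[OF y(1)] by blast
      have e: "{x. ?\<kappa> x = k} = {w \<in> arrows G. src G w = src G y \<and> c w = c y}"
        using y by auto
      have "(norm (R ?v))\<^sup>2 \<le> (norm (L\<^sub>e f) * norm (R u))\<^sup>2"
        unfolding R(2)[OF f] by (intro power_mono norm_blinfun) simp
      then show ?thesis unfolding e R(1)[symmetric] by (simp add: power_mult_distrib)
    next
      case False
      then have "Rep_ell2 ?v x = 0" if "?\<kappa> x = k" for x
        using that Rep_left_regular[OF homogeneous_Cc[OF f], of u]
        by (cases "x \<in> arrows G") (auto simp: convolution_off_arrows)
      then have "(\<Sum>\<^sub>\<infinity>x\<in>{x. ?\<kappa> x = k}. (cmod (Rep_ell2 ?v x))\<^sup>2) = 0"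
        by (intro infsum_0) simp
      then show ?thesis by (simp add: infsum_nonneg)
    qed
  qed
  then show "norm ?v \<le> norm (L\<^sub>e f) * norm u"
    by - (rule power2_le_imp_le, simp_all add: power_mult_distrib)
qed simp

end

context cocycle_groupoid
begin

abbreviation coefficients :: "'a operator set" where
  "coefficients \<equiv> coefficient_algebra G \<Gamma> c"

abbreviation embedding :: "'a operator \<Rightarrow> 'a operator" where
  "embedding \<equiv> reduced_embedding G kernel"

lemma coefficients_eq: "coefficients = closure (L\<^sub>e ` homogeneous \<one>)"
  by (simp add: coefficient_algebra_def reduced_algebra_def Cc_subgroupoid)

lemma kernel_regular_diff:
  assumes "f \<in> homogeneous \<one>" "g \<in> homogeneous \<one>"
  shows "L\<^sub>e (\<lambda>x. f x - g x) = L\<^sub>e f - L\<^sub>e g"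
  by (intro blinfun_eqI ell2_eqI)
    (simp add: Rep_left_regular_kernel(1) assms homogeneous_diff homogeneous_Cc[OF assms(1)]
      homogeneous_Cc[OF assms(2)] minus_blinfun.rep_eq Rep_ell2_diff left_regular_diff)

lemma norm_kernel_diff:
  assumes "f \<in> homogeneous \<one>" "g \<in> homogeneous \<one>"
  shows "norm (L\<^sub>e f - L\<^sub>e g) = norm (left_regular G f - left_regular G g)"
  using norm_left_regular_kernel[OF homogeneous_diff[OF assms]]
  by (simp add: kernel_regular_diff assms left_regular_diff homogeneous_Cc[OF assms(1)]
      homogeneous_Cc[OF assms(2)])

text \<open>The regular representations of the kernel and of the whole groupoid have equal norms on functions
  of degree \<open>\<one>\<close>, so the limit \<open>b\<close> depends only on the limit \<open>a\<close>.\<close>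

lemma embedding_eqI:
  assumes f: "\<And>n. f n \<in> homogeneous \<one>" and a: "(\<lambda>n. L\<^sub>e (f n)) \<longlonglongrightarrow> a"
    and b: "(\<lambda>n. left_regular G (f n)) \<longlonglongrightarrow> b"
  shows "embedding a = b"
  unfolding reduced_embedding_def Cc_subgroupoid
proof (rule the_equality)
  show "\<exists>f. (\<forall>n. f n \<in> homogeneous \<one>) \<and> (\<lambda>n. L\<^sub>e (f n)) \<longlonglongrightarrow> a \<and>
      (\<lambda>n. left_regular G (f n)) \<longlonglongrightarrow> b"
    using assms by blast
next
  fix b' assume "\<exists>f. (\<forall>n. f n \<in> homogeneous \<one>) \<and> (\<lambda>n. L\<^sub>e (f n)) \<longlonglongrightarrow> a \<and>
      (\<lambda>n. left_regular G (f n)) \<longlonglongrightarrow> b'"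
  then obtain g where g: "\<And>n. g n \<in> homogeneous \<one>" "(\<lambda>n. L\<^sub>e (g n)) \<longlonglongrightarrow> a"
    "(\<lambda>n. left_regular G (g n)) \<longlonglongrightarrow> b'" by blast
  have "(\<lambda>n. norm (L\<^sub>e (g n) - L\<^sub>e (f n))) \<longlonglongrightarrow> norm (a - a)"
    by (intro tendsto_norm tendsto_diff g a)
  moreover have "(\<lambda>n. norm (left_regular G (g n) - left_regular G (f n))) \<longlonglongrightarrow> norm (b' - b)"
    by (intro tendsto_norm tendsto_diff g b)
  ultimately have "norm (b' - b) = norm (a - a)"
    by (simp only: norm_kernel_diff[OF g(1) f] LIMSEQ_unique)
  then show "b' = b" by simp
qed

lemma embedding_sequence:
  assumes "a \<in> coefficients"
  shows "\<exists>f. (\<forall>n. f n \<in> homogeneous \<one>) \<and> (\<lambda>n. L\<^sub>e (f n)) \<longlonglongrightarrow> a \<and>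
    (\<lambda>n. left_regular G (f n)) \<longlonglongrightarrow> embedding a"
proof -
  obtain w where w: "\<And>n. w n \<in> L\<^sub>e ` homogeneous \<one>" "w \<longlonglongrightarrow> a"
    using assms unfolding coefficients_eq closure_sequential by blast
  then have "\<forall>n. \<exists>f. f \<in> homogeneous \<one> \<and> w n = L\<^sub>e f" by blast
  from choice[OF this] obtain f where f: "\<And>n. f n \<in> homogeneous \<one>" "w = (\<lambda>n. L\<^sub>e (f n))" by blast
  have "Cauchy (\<lambda>n. L\<^sub>e (f n))"
    using w(2) f(2) convergent_Cauchy convergentI by blast
  then have "Cauchy (\<lambda>n. left_regular G (f n))"
    unfolding Cauchy_def dist_norm by (simp only: norm_kernel_diff[OF f(1) f(1)])
  then obtain b where b: "(\<lambda>n. left_regular G (f n)) \<longlonglongrightarrow> b"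
    using Cauchy_convergent_iff convergent_def by blast
  have a: "(\<lambda>n. L\<^sub>e (f n)) \<longlonglongrightarrow> a" using w(2) f(2) by simp
  show ?thesis
    using f(1) a b embedding_eqI[OF f(1) a b] by (intro exI[of _ f]) simp
qed

lemma coefficients_limit:
  "(\<And>n. f n \<in> homogeneous \<one>) \<Longrightarrow> (\<lambda>n. L\<^sub>e (f n)) \<longlonglongrightarrow> a \<Longrightarrow> a \<in> coefficients"
  unfolding coefficients_eq closure_sequential by (intro exI[of _ "\<lambda>n. L\<^sub>e (f n)"]) auto

lemma embedding_diff:
  assumes "a \<in> coefficients" "b \<in> coefficients"
  shows "a - b \<in> coefficients" and "embedding (a - b) = embedding a - embedding b"
proof -
  obtain f where f: "\<And>n. f n \<in> homogeneous \<one>" "(\<lambda>n. L\<^sub>e (f n)) \<longlonglongrightarrow> a"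
    "(\<lambda>n. left_regular G (f n)) \<longlonglongrightarrow> embedding a"
    using embedding_sequence[OF assms(1)] by blast
  obtain g where g: "\<And>n. g n \<in> homogeneous \<one>" "(\<lambda>n. L\<^sub>e (g n)) \<longlonglongrightarrow> b"
    "(\<lambda>n. left_regular G (g n)) \<longlonglongrightarrow> embedding b"
    using embedding_sequence[OF assms(2)] by blast
  have h: "(\<lambda>x. f n x - g n x) \<in> homogeneous \<one>" for n
    by (rule homogeneous_diff[OF f(1) g(1)])
  have 1: "(\<lambda>n. L\<^sub>e (\<lambda>x. f n x - g n x)) \<longlonglongrightarrow> a - b"
    unfolding kernel_regular_diff[OF f(1) g(1)] by (rule tendsto_diff[OF f(2) g(2)])
  have 2: "(\<lambda>n. left_regular G (\<lambda>x. f n x - g n x)) \<longlonglongrightarrow> embedding a - embedding b"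
    unfolding left_regular_diff[OF homogeneous_Cc[OF f(1)] homogeneous_Cc[OF g(1)]]
    by (rule tendsto_diff[OF f(3) g(3)])
  show "a - b \<in> coefficients" by (rule coefficients_limit[OF h 1])
  show "embedding (a - b) = embedding a - embedding b" by (rule embedding_eqI[OF h 1 2])
qed

lemma norm_embedding:
  assumes "a \<in> coefficients"
  shows "norm (embedding a) = norm a"
proof -
  obtain f where f: "\<And>n. f n \<in> homogeneous \<one>" "(\<lambda>n. L\<^sub>e (f n)) \<longlonglongrightarrow> a"
    "(\<lambda>n. left_regular G (f n)) \<longlonglongrightarrow> embedding a"
    using embedding_sequence[OF assms] by blast
  show ?thesis
    using tendsto_norm[OF f(2)] tendsto_norm[OF f(3)]
    unfolding norm_left_regular_kernel[OF f(1)] by (rule LIMSEQ_unique[rotated])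
qed

lemma embedding_image: "embedding ` coefficients = spectral_subspace \<one>"
proof (intro Set.set_eqI iffI)
  fix b assume "b \<in> embedding ` coefficients"
  then obtain a where "a \<in> coefficients" "b = embedding a" by blast
  with embedding_sequence[of a] obtain f where "\<And>n. f n \<in> homogeneous \<one>"
    "(\<lambda>n. left_regular G (f n)) \<longlonglongrightarrow> b" by blast
  then show "b \<in> spectral_subspace \<one>"
    using spectral_limit[of "\<lambda>n. left_regular G (f n)"] left_regular_in_spectral by blast
next
  fix b assume "b \<in> spectral_subspace \<one>"
  then obtain f where f: "\<And>n. f n \<in> homogeneous \<one>" and b: "(\<lambda>n. left_regular G (f n)) \<longlonglongrightarrow> b"
    using spectral_sequence by blast
  have "Cauchy (\<lambda>n. left_regular G (f n))"
    using b convergent_Cauchy convergentI by blast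
  then have "Cauchy (\<lambda>n. L\<^sub>e (f n))"
    unfolding Cauchy_def dist_norm by (simp only: norm_kernel_diff[OF f f])
  then obtain a where a: "(\<lambda>n. L\<^sub>e (f n)) \<longlonglongrightarrow> a"
    using Cauchy_convergent_iff convergent_def by blast
  show "b \<in> embedding ` coefficients"
    using coefficients_limit[OF f a] embedding_eqI[OF f a b] by blast
qed

lemma zero_coefficients: "0 \<in> coefficients"
proof -
  have "left_regular G (\<lambda>_. 0) \<in> spectral_subspace \<one>"
    by (intro left_regular_in_spectral homogeneous_zero)
  then obtain a where "a \<in> coefficients" using embedding_image by blast
  from embedding_diff(1)[OF this this] show ?thesis by simp
qed

section \<open>Multiplication maps of the spectral subspaces\<close>

lemma fibre_bimodule_eq:
  "fibre_bimodule G \<Gamma> c p = operator_bimodule coefficients embedding (spectral_subspace p)"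
  by (simp add: fibre_bimodule_def Let_def operator_bimodule_def spectral_subspace_def homogeneous_def)

lemma spectral_bimodule_pair:
  assumes p: "p \<in> carrier \<Gamma>" and q: "q \<in> carrier \<Gamma>"
  shows "operator_bimodule_pair coefficients embedding
    (spectral_subspace p) (spectral_subspace q) (spectral_subspace (p \<otimes> q))"
proof
  show "embedding a o\<^sub>L x \<in> spectral_subspace p" if "a \<in> coefficients" "x \<in> spectral_subspace p" for a x
    using that spectral_compose[of "embedding a" \<one> x p] embedding_image p by auto
  show "x o\<^sub>L embedding a \<in> spectral_subspace q" if "a \<in> coefficients" "x \<in> spectral_subspace q" for a x
    using that spectral_compose[of x q "embedding a" \<one>] embedding_image q by auto
qed (use p q in \<open>auto simp: zero_coefficients embedding_diff norm_embedding spectral_scale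
    embedding_image spectral_inner[of p] spectral_inner[of "p \<otimes> q"] spectral_compose spectral_zero spectral_add
    closed_spectral_subspace intro: spectral_adjointable\<close>)

lemma multiplication_map_iff:
  assumes "p \<in> carrier \<Gamma>" "q \<in> carrier \<Gamma>"
  shows "multiplication_map G \<Gamma> c p q M \<longleftrightarrow>
    operator_bimodule_pair.is_multiplication coefficients embedding
      (spectral_subspace p) (spectral_subspace q) (spectral_subspace (p \<otimes> q)) M"
  unfolding multiplication_map_def fibre_bimodule_eq
    operator_bimodule_pair.is_multiplication_def[OF spectral_bimodule_pair[OF assms]]
  by simp

definition finite_products :: "'g \<Rightarrow> 'g \<Rightarrow> 'a operator set" where
  "finite_products p q =
    sum_of_products ` {s. set s \<subseteq> spectral_subspace p \<times> spectral_subspace q}"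

lemma multiplication_map_image:
  assumes "p \<in> carrier \<Gamma>" "q \<in> carrier \<Gamma>" "multiplication_map G \<Gamma> c p q M"
  shows "M ` bm_carrier (fibre_tensor G \<Gamma> c p q) = closure (finite_products p q)"
  using operator_bimodule_pair.multiplication_image[OF spectral_bimodule_pair[OF assms(1,2)]] assms
  unfolding multiplication_map_iff[OF assms(1,2)] fibre_bimodule_eq finite_products_def by blast

lemma finite_products_zero: "0 \<in> finite_products p q"
  unfolding finite_products_def by (rule image_eqI[of _ _ "[]"]) auto

lemma finite_products_add:
  assumes "x \<in> finite_products p q" "y \<in> finite_products p q"
  shows "x + y \<in> finite_products p q"
proof -
  obtain s t where "x = sum_of_products s" "set s \<subseteq> spectral_subspace p \<times> spectral_subspace q"
    "y = sum_of_products t" "set t \<subseteq> spectral_subspace p \<times> spectral_subspace q"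
    using assms unfolding finite_products_def by blast
  then show ?thesis
    unfolding finite_products_def by (intro image_eqI[of _ _ "s @ t"]) auto
qed

lemma finite_products_product:
  assumes "x \<in> spectral_subspace p" "y \<in> spectral_subspace q"
  shows "x o\<^sub>L y \<in> finite_products p q"
  unfolding finite_products_def by (rule image_eqI[of _ _ "[(x, y)]"]) (use assms in auto)

lemma finite_products_sum:
  "(\<And>i. i \<in> I \<Longrightarrow> x i \<in> finite_products p q) \<Longrightarrow> (\<Sum>i\<in>I. x i) \<in> finite_products p q"
  by (induct I rule: infinite_finite_induct) (auto simp: finite_products_zero finite_products_add)

lemma finite_products_spectral:
  assumes "p \<in> carrier \<Gamma>" "q \<in> carrier \<Gamma>"
  shows "finite_products p q \<subseteq> spectral_subspace (p \<otimes> q)"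
  using operator_bimodule_pair.sum_of_products_in[OF spectral_bimodule_pair[OF assms]]
  unfolding finite_products_def by blast

definition factorizable :: "'g \<Rightarrow> 'g \<Rightarrow> 'a \<Rightarrow> bool" where
  "factorizable p q x \<longleftrightarrow>
    (\<exists>y\<in>fibre G c p. \<exists>z\<in>fibre G c q. (y, z) \<in> composable G \<and> x = gmul G y z)"

text \<open>Evaluation at \<open>x\<close> is the matrix entry at the pair of \<open>x\<close> and its source, and as such extends to all
  operators.\<close>

lemma evaluation:
  assumes x: "x \<in> arrows G"
  obtains e where "bounded_linear e" "\<And>f. f \<in> Cc G \<Longrightarrow> e (left_regular G f) = f x"
proof
  let ?u = "delta 1 (src G x)"
  show "bounded_linear (\<lambda>T :: 'a operator. Rep_ell2 (T ?u) x)"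
    by (intro bounded_linear_compose[OF bounded_linear_Rep_ell2] blinfun.bounded_linear_left)
  have "gmul G x (ginv G (src G x)) = x"
    using gmul_ginv_cancel_right[of x "src G x"] x
    by (simp add: composable_iff src_closed rng_src gmul_src)
  then show "Rep_ell2 (blinfun_apply (left_regular G f) ?u) x = f x" if "f \<in> Cc G" for f
    using x by (simp add: left_regular_delta[OF that] src_closed src_src)
qed

text \<open>A convolution of functions of degrees \<open>p\<close> and \<open>q\<close> vanishes at an arrow \<open>x\<close> without a factorization, and
  this persists for sums of products of operators and their limits.  A bump function at \<open>x\<close> does not
  vanish there.\<close>

lemma factorizable_if_dense:
  assumes "spectral_subspace (p \<otimes> q) \<subseteq> closure (finite_products p q)"
    and x: "x \<in> fibre G c (p \<otimes> q)"
  shows "factorizable p q x"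
proof (rule ccontr)
  assume nf: "\<not> factorizable p q x"
  have xG: "x \<in> arrows G" using x by (simp add: fibre_def)
  obtain e :: "'a operator \<Rightarrow> complex" where e: "bounded_linear e"
    "\<And>f. f \<in> Cc G \<Longrightarrow> e (left_regular G f) = f x"
    using evaluation[OF xG] by blast
  have zero: "e (T o\<^sub>L T') = 0" if T: "T \<in> spectral_subspace p" and T': "T' \<in> spectral_subspace q" for T T'
  proof -
    obtain f where f: "\<And>n. f n \<in> homogeneous p" "(\<lambda>n. left_regular G (f n)) \<longlonglongrightarrow> T"
      using spectral_sequence[OF T] by blast
    obtain g where g: "\<And>n. g n \<in> homogeneous q" "(\<lambda>n. left_regular G (g n)) \<longlonglongrightarrow> T'"
      using spectral_sequence[OF T'] by blast
    have "convolution G (f n) (g n) x = 0" for n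
    proof (rule ccontr)
      assume "convolution G (f n) (g n) x \<noteq> 0"
      from convolution_nonzero[OF this] obtain y z
        where "(y, z) \<in> composable G" "x = gmul G y z" "f n y \<noteq> 0" "g n z \<noteq> 0" by blast
      with f(1)[of n] g(1)[of n] have "factorizable p q x"
        unfolding factorizable_def by (auto simp: homogeneous_iff fibre_def composable_iff)
      with nf show False by simp
    qed
    then have "e (left_regular G (f n) o\<^sub>L left_regular G (g n)) = 0" for n
      using homogeneous_Cc[OF f(1)] homogeneous_Cc[OF g(1)]
      by (simp add: left_regular_convolution e Cc_convolution)
    moreover have "(\<lambda>n. e (left_regular G (f n) o\<^sub>L left_regular G (g n))) \<longlonglongrightarrow> e (T o\<^sub>L T')"
      by (intro bounded_linear.tendsto[OF e(1)]
          bounded_bilinear.tendsto[OF bounded_bilinear_blinfun_compose] f g)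
    ultimately show ?thesis by (simp add: LIMSEQ_const_iff)
  qed
  have "e (sum_of_products s) = 0" if "set s \<subseteq> spectral_subspace p \<times> spectral_subspace q" for s
    using that
    by (induct s)
      (auto simp: zero linear_0[OF bounded_linear.linear[OF e(1)]]
        linear_add[OF bounded_linear.linear[OF e(1)]])
  then have "finite_products p q \<subseteq> {T. e T = 0}" by (auto simp: finite_products_def)
  moreover have "closed {T. e T = 0}"
    by (intro closed_Collect_eq bounded_linear.continuous_on[OF e(1)] continuous_intros)
  ultimately have "spectral_subspace (p \<otimes> q) \<subseteq> {T. e T = 0}"
    using assms(1) closure_minimal by blast
  moreover obtain f where f: "f \<in> Cc G" "f x \<noteq> 0" "\<And>y. f y \<noteq> 0 \<Longrightarrow> y \<in> fibre G c (p \<otimes> q)"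
    using bump_function[OF openin_fibre x] by blast
  then have "left_regular G f \<in> spectral_subspace (p \<otimes> q)"
    by (intro left_regular_in_spectral) (auto simp: homogeneous_iff fibre_def)
  ultimately show False using f e(2) by auto
qed

text \<open>The arrows at which \<open>k\<close> does not vanish will lie in a bisection.  What matters is that their
  ranges are distinct: multiples of \<open>k\<close> can then be absorbed into the first factor \<open>g\<close>.\<close>

definition local_product :: "'g \<Rightarrow> 'g \<Rightarrow> ('a \<Rightarrow> complex) \<Rightarrow> bool" where
  "local_product p q k \<longleftrightarrow> (\<exists>g\<in>homogeneous p. \<exists>h\<in>homogeneous q.
     k = convolution G g h \<and> inj_on (rng G) {x. k x \<noteq> 0})"

text \<open>For a factorization \<open>x = y z\<close>, bump functions \<open>g\<close> and \<open>h\<close> on bisections \<open>U\<close> and \<open>V\<close> around \<open>y\<close> and \<open>z\<close>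
  have the single summand \<open>g(y) h(z)\<close> at \<open>x\<close>, and the products of arrows of \<open>U\<close> and \<open>V\<close> are determined
  by their range.\<close>

lemma local_product_exists:
  assumes "factorizable p q x"
  shows "\<exists>k. local_product p q k \<and> k x \<noteq> 0"
proof -
  obtain y z where y: "y \<in> fibre G c p" and z: "z \<in> fibre G c q" and yz: "(y, z) \<in> composable G"
    and x: "x = gmul G y z"
    using assms unfolding factorizable_def by blast
  have bump: "\<exists>U f. bisection U \<and> f \<in> homogeneous r \<and> w \<in> U \<and> f w \<noteq> 0 \<and> (\<forall>x. f x \<noteq> 0 \<longrightarrow> x \<in> U)"
    if w: "w \<in> fibre G c r" for w r
  proof -
    have "w \<in> arrows G" using w by (simp add: fibre_def)
    then obtain V where V: "bisection V" "w \<in> V" using bisection_exists by blast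
    let ?U = "V \<inter> fibre G c r"
    have o: "openin (gtop G) ?U" using V openin_fibre by (auto simp: bisection_def)
    obtain f where f: "f \<in> Cc G" "f w \<noteq> 0" "\<And>x. f x \<noteq> 0 \<Longrightarrow> x \<in> ?U"
      using bump_function[OF o, of w] V w by blast
    then have "f \<in> homogeneous r" by (auto simp: homogeneous_iff fibre_def)
    moreover have "bisection ?U" by (rule bisection_subset[OF V(1) o]) blast
    ultimately show ?thesis using f V w by blast
  qed
  obtain U g where U: "bisection U" "g \<in> homogeneous p" "y \<in> U" "g y \<noteq> 0"
    "\<And>x. g x \<noteq> 0 \<Longrightarrow> x \<in> U"
    using bump[OF y] by blast
  obtain V h where V: "bisection V" "h \<in> homogeneous q" "z \<in> V" "h z \<noteq> 0"
    "\<And>x. h x \<noteq> 0 \<Longrightarrow> x \<in> V"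
    using bump[OF z] by blast
  let ?k = "convolution G g h"
  have inj: "inj_on (rng G) U" "inj_on (rng G) V" using U V by (simp_all add: bisection_def)
  have "inj_on (rng G) {x. ?k x \<noteq> 0}"
  proof (rule inj_onI)
    fix x x' assume x: "x \<in> {x. ?k x \<noteq> 0}" "x' \<in> {x. ?k x \<noteq> 0}" and r: "rng G x = rng G x'"
    obtain a b where a: "(a, b) \<in> composable G" "x = gmul G a b" "g a \<noteq> 0" "h b \<noteq> 0"
      using x(1) convolution_nonzero by blast
    obtain a' b' where a': "(a', b') \<in> composable G" "x' = gmul G a' b'" "g a' \<noteq> 0" "h b' \<noteq> 0"
      using x(2) convolution_nonzero by blast
    have "a = a'" using r a a' U(5) rng_gmul inj_onD[OF inj(1)] by metis
    then have "b = b'" using a a' V(5) inj_onD[OF inj(2)] by (metis composable_iff)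
    with \<open>a = a'\<close> show "x = x'" using a a' by simp
  qed
  moreover have "?k x \<noteq> 0"
  proof -
    have xG: "x \<in> arrows G" "rng G x = rng G y" using x yz by (simp_all add: gmul_closed rng_gmul)
    then have "inv_into U (rng G) (rng G x) = y" using U(3) inj(1) by (simp add: inv_into_f_f)
    then have "?k x = g y * h (gmul G (ginv G y) x)"
      using convolution_bisection[OF U(1,5), where h = h and x = x] xG U(3) by simp
    then show ?thesis using U(4) V(4) ginv_gmul_cancel[OF yz] x by simp
  qed
  ultimately show ?thesis
    unfolding local_product_def using U(2) V(2) by blast
qed

text \<open>If \<open>F\<close> lives where a local product \<open>k = g * h\<close> does not vanish, then \<open>F\<close> is the restriction to
  this set of a function of the range alone, namely of \<open>F * 1\<close>; multiplication by the latter commutes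
  with right convolution, so \<open>F k = ((F * 1) g) * h\<close>.\<close>

lemma multiple_of_local_product:
  assumes k: "local_product p q k" and F: "F \<in> Cc G" and nz: "\<And>x. F x \<noteq> 0 \<Longrightarrow> k x \<noteq> 0"
  shows "(\<lambda>x. F x * k x) \<in> Cc G" and "left_regular G (\<lambda>x. F x * k x) \<in> finite_products p q"
proof -
  obtain g h where g: "g \<in> homogeneous p" and h: "h \<in> homogeneous q" and kgh: "k = convolution G g h"
    and inj: "inj_on (rng G) {x. k x \<noteq> 0}"
    using k unfolding local_product_def by blast
  have gC: "g \<in> Cc G" "h \<in> Cc G" using g h homogeneous_Cc by auto
  define r where "r = convolution G F (\<lambda>_. 1)"
  have r: "continuous_map (gtop G) euclidean r"
    unfolding r_def by (rule continuous_convolution[OF F]) simp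
  have rg: "(\<lambda>x. r x * g x) \<in> homogeneous p"
    using g Cc_mult[OF r gC(1)] by (simp add: homogeneous_iff)
  have "convolution G (\<lambda>x. r x * g x) h x = F x * k x" for x
  proof (cases "x \<in> arrows G")
    case x: True
    have Y: "row (\<lambda>x. r x * g x) x \<subseteq> row g x" "row g x \<subseteq> {y \<in> arrows G. rng G y = rng G x}"
      by (auto simp: row_def)
    have "r y = r x" if "y \<in> row g x" for y
      using that x by (auto simp: r_def convolution_def row_def)
    then have "convolution G (\<lambda>x. r x * g x) h x = r x * k x"
      unfolding convolution_eq_sum[OF finite_row[OF gC(1)] Y x] kgh convolution_row[OF gC(1) x]
        sum_distrib_left
      by (intro sum.cong) (simp_all add: mult.assoc)
    also have "r x * k x = F x * k x"
    proof (cases "k x = 0")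
      case False
      then have "row F x \<subseteq> {x}"
        using nz inj by (auto simp: row_def dest: inj_onD)
      then have "r x = F x" unfolding r_def using x by (subst convolution_eq_sum[of "{x}"]) auto
      then show ?thesis by simp
    qed simp
    finally show ?thesis .
  next
    case False
    then show ?thesis using Cc_arrows[OF F] by (auto simp: convolution_off_arrows)
  qed
  then have e: "(\<lambda>x. F x * k x) = convolution G (\<lambda>x. r x * g x) h" by auto
  show "(\<lambda>x. F x * k x) \<in> Cc G"
    unfolding e by (rule Cc_convolution[OF homogeneous_Cc[OF rg] gC(2)])
  show "left_regular G (\<lambda>x. F x * k x) \<in> finite_products p q"
    unfolding e left_regular_convolution[OF homogeneous_Cc[OF rg] gC(2), symmetric]
    by (intro finite_products_product left_regular_in_spectral rg h)
qed

text \<open>If every arrow of degree \<open>p q\<close> factorizes, then no such arrow is a common zero of the local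
  products, so a compactly supported function \<open>f\<close> of this degree is a combination \<open>\<Sum>k. F k k\<close> of local
  products \<open>k\<close> with functions as coefficients.  Each summand is a product of homogeneous functions, so
  \<open>f\<close> is even a finite sum of products.\<close>

lemma dense_if_factorizable:
  assumes "\<And>x. x \<in> fibre G c (p \<otimes> q) \<Longrightarrow> factorizable p q x"
  shows "spectral_subspace (p \<otimes> q) \<subseteq> closure (finite_products p q)"
  unfolding spectral_subspace_def
proof (rule closure_mono, rule image_subsetI)
  fix f assume f: "f \<in> homogeneous (p \<otimes> q)"
  have "continuous_map (gtop G) euclidean k" if "k \<in> Collect (local_product p q)" for k
    using that homogeneous_Cc Cc_convolution Cc_continuous unfolding local_product_def by blast
  moreover have "\<exists>k\<in>Collect (local_product p q). k x \<noteq> 0" if "x \<in> gsupp G f" for x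
    using that f local_product_exists[OF assms] by (auto simp: homogeneous_def)
  ultimately obtain S F where S: "finite S" "S \<subseteq> Collect (local_product p q)"
    and F: "\<forall>k\<in>S. F k \<in> Cc G" "\<forall>k x. F k x \<noteq> 0 \<longrightarrow> f x \<noteq> 0 \<and> k x \<noteq> 0"
      "f = (\<lambda>x. \<Sum>k\<in>S. F k x * k x)"
    using Cc_decompose[OF homogeneous_Cc[OF f], of "Collect (local_product p q)"] by auto
  have *: "(\<lambda>x. F k x * k x) \<in> Cc G" "left_regular G (\<lambda>x. F k x * k x) \<in> finite_products p q"
    if "k \<in> S" for k
    using multiple_of_local_product[of p q k "F k"] that S(2) F(1,2) by auto
  have "left_regular G f = (\<Sum>k\<in>S. left_regular G (\<lambda>x. F k x * k x))"
    by (subst F(3)) (rule left_regular_sum[OF S(1) *(1)])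
  then show "left_regular G f \<in> finite_products p q"
    by (simp add: finite_products_sum *(2))
qed

theorem multiplication_surjective_iff:
  assumes "p \<in> carrier \<Gamma>" "q \<in> carrier \<Gamma>" "multiplication_map G \<Gamma> c p q M"
  shows "M ` bm_carrier (fibre_tensor G \<Gamma> c p q) = bm_carrier (fibre_bimodule G \<Gamma> c (p \<otimes> q)) \<longleftrightarrow>
    (\<forall>x\<in>fibre G c (p \<otimes> q). factorizable p q x)"
proof -
  have "closure (finite_products p q) \<subseteq> spectral_subspace (p \<otimes> q)"
    by (intro closure_minimal finite_products_spectral assms closed_spectral_subspace)
  then have "M ` bm_carrier (fibre_tensor G \<Gamma> c p q) = bm_carrier (fibre_bimodule G \<Gamma> c (p \<otimes> q)) \<longleftrightarrow>
      spectral_subspace (p \<otimes> q) \<subseteq> closure (finite_products p q)"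
    unfolding multiplication_map_image[OF assms] by (auto simp: fibre_bimodule_eq)
  also have "\<dots> \<longleftrightarrow> (\<forall>x\<in>fibre G c (p \<otimes> q). factorizable p q x)"
    using dense_if_factorizable factorizable_if_dense by blast
  finally show ?thesis .
qed

lemma factorizable_unit:
  assumes "x \<in> fibre G c p"
  shows "factorizable \<one> p x" "factorizable p \<one> x"
proof -
  have x: "x \<in> arrows G" using assms by (simp add: fibre_def)
  have "c (src G x) = \<one>" using c_rng[of "src G x"] x by (simp add: src_closed rng_src)
  then show "factorizable p \<one> x"
    unfolding factorizable_def using assms x
    by (intro bexI[of _ x] bexI[of _ "src G x"])
      (auto simp: fibre_def composable_iff src_closed rng_src gmul_src)
  show "factorizable \<one> p x"
    unfolding factorizable_def using assms x c_rng[OF x]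
    by (intro bexI[of _ "rng G x"] bexI[of _ x])
      (auto simp: fibre_def composable_iff rng_closed src_rng gmul_rng)
qed

text \<open>Degrees \<open>p = \<one>\<close> or \<open>q = \<one>\<close> may be left out, because \<open>x = r(x) x = x s(x)\<close> and units have degree \<open>\<one>\<close>.\<close>

lemma unperforated_iff:
  assumes "P \<subseteq> carrier \<Gamma>"
  shows "unperforated G \<Gamma> P c \<longleftrightarrow>
    (\<forall>p\<in>P - {\<one>}. \<forall>q\<in>P - {\<one>}. \<forall>x\<in>fibre G c (p \<otimes> q). factorizable p q x)" (is "_ \<longleftrightarrow> ?R")
proof
  assume "unperforated G \<Gamma> P c"
  then show ?R by (auto simp: unperforated_def factorizable_def)
next
  assume R: ?R
  have "factorizable p q x" if "p \<in> P" "q \<in> P" "x \<in> fibre G c (p \<otimes> q)" for p q x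
    using that R assms factorizable_unit by (cases "p = \<one> \<or> q = \<one>") auto
  then show "unperforated G \<Gamma> P c" by (auto simp: unperforated_def factorizable_def)
qed

end

theorem proposition3p5:
  fixes G :: "'a groupoid" and \<Gamma> :: "('g, 'm) monoid_scheme"
    and P :: "'g set" and c :: "'a \<Rightarrow> 'g"
  assumes "etale_groupoid G"
    and "second_countable (gtop G)"
    and "locally_compact_space (gtop G)"
    and "Hausdorff_space (gtop G)"
    and "group \<Gamma>"
    and "submonoid P \<Gamma>"
    and "continuous_cocycle G \<Gamma> c"
  shows "(\<forall>p\<in>P - {\<one>\<^bsub>\<Gamma>\<^esub>}. \<forall>q\<in>P - {\<one>\<^bsub>\<Gamma>\<^esub>}. \<exists>M. multiplication_map G \<Gamma> c p q M) \<and>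
    (\<forall>M. (\<forall>p\<in>P - {\<one>\<^bsub>\<Gamma>\<^esub>}. \<forall>q\<in>P - {\<one>\<^bsub>\<Gamma>\<^esub>}. multiplication_map G \<Gamma> c p q (M p q)) \<longrightarrow>
       ((\<forall>p\<in>P - {\<one>\<^bsub>\<Gamma>\<^esub>}. \<forall>q\<in>P - {\<one>\<^bsub>\<Gamma>\<^esub>}.
           M p q ` bm_carrier (fibre_tensor G \<Gamma> c p q) =
             bm_carrier (fibre_bimodule G \<Gamma> c (p \<otimes>\<^bsub>\<Gamma>\<^esub> q)))
        \<longleftrightarrow> unperforated G \<Gamma> P c))"
proof -
  interpret cocycle_groupoid G \<Gamma> c
    using assms by (intro cocycle_groupoid.intro lch_etale_groupoid.intro
        lch_etale_groupoid_axioms.intro cocycle_groupoid_axioms.intro)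
  have P: "P \<subseteq> carrier \<Gamma>" using assms(6) by (rule submonoid.subset)
  show ?thesis
  proof (intro conjI allI impI ballI)
    fix p q assume "p \<in> P - {\<one>\<^bsub>\<Gamma>\<^esub>}" "q \<in> P - {\<one>\<^bsub>\<Gamma>\<^esub>}"
    then have pq: "p \<in> carrier \<Gamma>" "q \<in> carrier \<Gamma>" using P by auto
    show "\<exists>M. multiplication_map G \<Gamma> c p q M"
      unfolding multiplication_map_iff[OF pq]
      by (rule operator_bimodule_pair.multiplication_exists[OF spectral_bimodule_pair[OF pq]])
  next
    fix M assume M: "\<forall>p\<in>P - {\<one>\<^bsub>\<Gamma>\<^esub>}. \<forall>q\<in>P - {\<one>\<^bsub>\<Gamma>\<^esub>}. multiplication_map G \<Gamma> c p q (M p q)"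
    have "M p q ` bm_carrier (fibre_tensor G \<Gamma> c p q) =
        bm_carrier (fibre_bimodule G \<Gamma> c (p \<otimes>\<^bsub>\<Gamma>\<^esub> q)) \<longleftrightarrow>
        (\<forall>x\<in>fibre G c (p \<otimes>\<^bsub>\<Gamma>\<^esub> q). factorizable p q x)"
      if "p \<in> P - {\<one>\<^bsub>\<Gamma>\<^esub>}" "q \<in> P - {\<one>\<^bsub>\<Gamma>\<^esub>}" for p q
      using that P M by (intro multiplication_surjective_iff) auto
    then show "(\<forall>p\<in>P - {\<one>\<^bsub>\<Gamma>\<^esub>}. \<forall>q\<in>P - {\<one>\<^bsub>\<Gamma>\<^esub>}.
        M p q ` bm_carrier (fibre_tensor G \<Gamma> c p q) =
          bm_carrier (fibre_bimodule G \<Gamma> c (p \<otimes>\<^bsub>\<Gamma>\<^esub> q))) \<longleftrightarrow> unperforated G \<Gamma> P c"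
      unfolding unperforated_iff[OF P] by simp
  qed
qed

end
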